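(* Let $\varepsilon\in(0,1)$, let $d,k,m,B$ be positive integers, and let $L>0$, $Q_1,Q_2>0$. Let $\mathcal{A}$ be a probability distribution on complex $mB\times d$ matrices, and let $\Phi$ be drawn from the construction described in the context (built from $A\sim\mathcal{A}$ and independent random signs). Assume: (i) almost surely, every entry of every row $a_i$ of $A\sim\mathcal{A}$ has modulus at most $1$; (ii) $\mathbb{E}_{A\sim\mathcal{A}}\sup_{x\in T_k}\left|\frac{1}{mB}\|Ax\|_2^2-\|x\|_2^2\right|\lesssim\sqrt{L/(mB)}$, where $L\le mB\varepsilon^2$; (iii) with probability at least $7/8$ over $A\sim\mathcal{A}$, the following event holds: for every integer $1\le s\le 2k$, $\max_{b\in[m]}\sup_{x\in T_s}\|A_bx\|_2\le Q_1\sqrt{B}+Q_2\sqrt{s}$; (iv) $B\ge\max\{Q_2^2\log^2 m,\;Q_1^2\log m\log k\}$ and $k\ge Q_1^2\log^2 m$; (v) $m> \dfrac{k\log d\,\log^2(Bk)}{\varepsilon^2}$. Then with probability at least $3/4$ (over both $A$ and the signs), $$\sup_{x\in T_k}\left|\frac{1}{mB}\|\Phi x\|_2^2-\|x\|_2^2\right|\lesssim\varepsilon,$$ i.e. $\frac{1}{\sqrt{mB}}\Phi$ satisfies the $(O(\varepsilon),k)$-restricted isometry property.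
   Context: Construction: draw $A\sim\mathcal{A}$ with rows $a_1,\dots,a_{mB}\in\mathbb{C}^d$. For $b\in[m]$ and $i\in[B]$ set $h(b,i)=B(b-1)+i$, and let $A_b$ be the $B\times d$ matrix whose rows are $a_{h(b,1)},\dots,a_{h(b,B)}$. Independently of $A$, draw independent uniformly random signs $\sigma_{b,i}\in\{\pm1\}$, $(b,i)\in[m]\times[B]$. Let $\Phi\in\mathbb{C}^{m\times d}$ be the matrix whose $b$-th row is $\varphi_b=\sum_{i\in[B]}\sigma_{b,i}a_{h(b,i)}$. For an integer $s$, $T_s=\{x\in\mathbb{C}^d:\ x\text{ has at most } s \text{ nonzero entries},\ \|x\|_2\le1\}$. A matrix $\Psi$ has the $(\varepsilon,k)$-RIP if $(1-\varepsilon)\|x\|_2^2\le\|\Psi x\|_2^2\le(1+\varepsilon)\|x\|_2^2$ for all $x$ with at most $k$ nonzero entries. The notation $f\lesssim g$ means $f\le Cg$ for an absolute constant $C$ (the constant in the conclusion depends only on the constant in hypothesis (ii)); $O(\cdot)$ likewise hides absolute constants.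
   Formalization: The formal theorem assumes d ≥ 2: for d = 1, log d = 0 makes (v) vacuous and the claim fails (d = k = m = 1, B = 3, A the all-ones column, Q1 = Q2 = 1, L = 3ε²: the deviation is always at least 2/3). *)

theory Defs
  imports "HOL-Probability.Probability" "Jordan_Normal_Form.Matrix"
begin

unbundle no vec_syntax
unbundle no inner_syntax

(* The absolute constants may not depend on the dimensions, so dimensions are natural numbers
   (carrier_vec, carrier_mat) and not types. All indices start at 0. *)

definition vec_norm2 :: "complex vec \<Rightarrow> real" where
  "vec_norm2 x = L2_set (\<lambda>i. cmod (x $ i)) {..<dim_vec x}"

definition nnz :: "complex vec \<Rightarrow> nat" where
  "nnz x = card {i. i < dim_vec x \<and> x $ i \<noteq> 0}"

definition sparse_unit_ball :: "nat \<Rightarrow> nat \<Rightarrow> complex vec set" where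
  "sparse_unit_ball d s = {x \<in> carrier_vec d. nnz x \<le> s \<and> vec_norm2 x \<le> 1}"

definition RIP :: "real \<Rightarrow> nat \<Rightarrow> complex mat \<Rightarrow> bool" where
  "RIP \<epsilon> k \<Psi> \<longleftrightarrow>
     (\<forall>x \<in> carrier_vec (dim_col \<Psi>). nnz x \<le> k \<longrightarrow>
        (1 - \<epsilon>) * (vec_norm2 x)\<^sup>2 \<le> (vec_norm2 (\<Psi> *\<^sub>v x))\<^sup>2 \<and>
        (vec_norm2 (\<Psi> *\<^sub>v x))\<^sup>2 \<le> (1 + \<epsilon>) * (vec_norm2 x)\<^sup>2)"

(* The Borel sigma-algebra on complex n x d matrices, transported from the space of entries. *)
definition mat_borel :: "nat \<Rightarrow> nat \<Rightarrow> complex mat measure" where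
  "mat_borel n d =
     vimage_algebra (carrier_mat n d) (\<lambda>A. \<lambda>p\<in>{..<n} \<times> {..<d}. A $$ p)
       (\<Pi>\<^sub>M p\<in>{..<n} \<times> {..<d}. borel)"

definition block_index :: "nat \<Rightarrow> nat \<Rightarrow> nat \<Rightarrow> nat" where
  "block_index B b i = B * b + i"

definition block :: "nat \<Rightarrow> complex mat \<Rightarrow> nat \<Rightarrow> complex mat" where
  "block B A b = Matrix.mat B (dim_col A) (\<lambda>(i, j). A $$ (block_index B b i, j))"

definition signs :: "nat \<Rightarrow> nat \<Rightarrow> (nat \<times> nat \<Rightarrow> real) measure" where
  "signs m B = (\<Pi>\<^sub>M p\<in>{..<m} \<times> {..<B}. uniform_count_measure {-1, 1})"

definition signed_mat :: "nat \<Rightarrow> nat \<Rightarrow> complex mat \<Rightarrow> (nat \<times> nat \<Rightarrow> real) \<Rightarrow> complex mat" where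
  "signed_mat m B A \<sigma> =
     Matrix.mat m (dim_col A)
       (\<lambda>(b, j). \<Sum>i<B. complex_of_real (\<sigma> (b, i)) * A $$ (block_index B b i, j))"

end

theory Submission
  imports Defs
begin

text \<open>
  Fix \<open>A\<close> and write \<open>D(x)\<close> for the deviation of the squared norm of \<open>\<Phi>x\<close> from that of \<open>Ax\<close>.
  Comparing \<open>D\<close> for two independent sign patterns \<open>\<sigma>, \<sigma>'\<close> gives \<open>Re \<langle>\<Phi>\<^sub>+x, \<Phi>\<^sub>-x\<rangle>\<close>, where
  \<open>\<Phi>\<^sub>+\<close> and \<open>\<Phi>\<^sub>-\<close> use the coefficients \<open>\<sigma> + \<sigma>'\<close> and \<open>\<sigma> - \<sigma>'\<close>. Exchanging \<open>\<sigma>\<close> and \<open>\<sigma>'\<close> in single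
  coordinates flips the sign of \<open>\<sigma> - \<sigma>'\<close> there and fixes \<open>\<sigma> + \<sigma>'\<close>, so each increment of a chain is
  a Rademacher sum in one of the two arguments. Chaining in the norm \<open>max\<^sub>b |A\<^sub>b x|\<close> bounds the mean
  of \<open>sup |D|\<close> by \<open>G \<sqrt>(E + mean sup |D|)\<close>, hence by \<open>G\<^sup>2 + G \<sqrt>E\<close>, with \<open>G\<close> the entropy sum.

  The entropy sum has order \<open>\<sqrt>(k B ln d) ln (B k)\<close>. Fine scales use rounding to a lattice. At the
  coarse scales \<open>x\<close> is approximated by the average of \<open>n\<close> multiples of coordinate vectors. To get the
  error \<open>\<sqrt>(k B / n)\<close> in all \<open>m\<close> blocks at once without losing \<open>\<sqrt>(ln m)\<close>, the samples are chosen one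
  by one so that a sum over the blocks of exponentials of squared partial sums does not increase.
  This works for \<open>n \<ge> (ln m)\<^sup>2\<close>; for smaller \<open>n\<close> the diameter bound suffices.
\<close>

section \<open>Averages over random signs\<close>

text \<open>The latter is random again, of size E + sup |D|, which makes the bound self-referential.
  Hypotheses (iii) and (iv) make R = Q_1 sqrt B + Q_2 sqrt k satisfy R ln m \<le> 2 sqrt (k B). This
  serves twice: R is the diameter, so the scales below n = (ln m)^2 cost about R ln m sqrt (ln d);
  and R^2 bounds the weak variance of the samples, which lets the greedy potential survive all n
  steps. A net of n samples has log-cardinality of order n ln d and radius of order sqrt (k B / n),
  so every dyadic n between (ln m)^2 and k contributes sqrt (k B ln d); the number of these scales
  is the factor ln (B k). By (v), G is at most a constant times \<epsilon> sqrt (m B), and by (ii) E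
  is of order m B.\<close>

lemma exp_le_quadratic:
  fixes a :: real
  assumes "a \<le> 1"
  shows "exp a \<le> 1 + a + a\<^sup>2"
proof (cases "a \<ge> 0")
  case True then show ?thesis using assms exp_bound by blast
next
  case False
  \<comment> \<open>For negative \<open>a\<close> the reciprocal is estimated: the product of
    \<open>1 + a + a^2\<close> with this lower bound for \<open>exp (- a)\<close> is at least 1,
    because its cubic term is nonnegative.\<close>
  have 1: "1 - a + a\<^sup>2 / 2 \<le> exp (- a)"
    using exp_lower_Taylor_quadratic[of "-a"] False by simp
  have pos: "1 - a + a\<^sup>2 / 2 > 0" using False by (simp add: add_pos_nonneg)
  have "a^3 \<le> 0" using False by (simp add: power_le_zero_eq)
  moreover have "(1 + a + a\<^sup>2) * (1 - a + a\<^sup>2 / 2) = 1 + a\<^sup>2 / 2 - a^3 / 2 + a^4 / 2"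
    by (simp add: field_simps power2_eq_square power3_eq_cube power4_eq_xxxx)
  moreover have "0 \<le> a\<^sup>2 / 2" "0 \<le> a^4 / 2" by simp_all
  ultimately have "(1 + a + a\<^sup>2) * (1 - a + a\<^sup>2 / 2) \<ge> 1" by linarith
  then have "1 / (1 - a + a\<^sup>2 / 2) \<le> 1 + a + a\<^sup>2"
    using pos by (simp add: divide_le_eq)
  moreover have "exp a \<le> 1 / (1 - a + a\<^sup>2 / 2)"
  proof -
    have "exp a = 1 / exp (-a)" by (simp add: exp_minus divide_inverse)
    also have "\<dots> \<le> 1 / (1 - a + a\<^sup>2 / 2)" using 1 pos by (intro divide_left_mono) auto
    finally show ?thesis .
  qed
  ultimately show ?thesis by linarith
qed

text \<open>For small \<open>x\<close> the linear terms of \<open>exp x\<close> and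
  \<open>exp (- x)\<close> cancel in the mean; for \<open>|x| > 1\<close> both exponents are at most
  \<open>x^2\<close>. The sharp exponent \<open>x^2 / 2\<close> would only change constants.\<close>

lemma cosh_le_exp_square:
  fixes x :: real
  shows "(exp x + exp (- x)) / 2 \<le> exp (x\<^sup>2)"
proof -
  have *: "(u + v) / 2 \<le> w" if "u \<le> 1 + x + z" "v \<le> 1 - x + z" "1 + z \<le> w" for u v w z :: real
    using that by (simp add: field_simps)
  have **: "(u + v) / 2 \<le> w" if "u \<le> w" "v \<le> w" for u v w :: real
    using that by (simp add: field_simps)
  show ?thesis
  proof (cases "\<bar>x\<bar> \<le> 1")
    case True
    then have "exp x \<le> 1 + x + x\<^sup>2" "exp (-x) \<le> 1 - x + x\<^sup>2"
      using exp_le_quadratic[of x] exp_le_quadratic[of "-x"] by auto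
    then show ?thesis by (rule *) (rule exp_ge_add_one_self)
  next
    case False
    then have "\<bar>x\<bar> \<le> x\<^sup>2" using self_le_power[of "\<bar>x\<bar>" 2] by simp
    then have "exp x \<le> exp (x\<^sup>2)" "exp (-x) \<le> exp (x\<^sup>2)" by auto
    then show ?thesis by (rule **)
  qed
qed

text \<open>Expectations over the signs are finite averages, so maxima, interchanges and changes of
  variable raise no question of integrability. The link to the product measure is
  \<open>measure_signs\<close>.\<close>

definition avg :: "'a set \<Rightarrow> ('a \<Rightarrow> real) \<Rightarrow> real" where
  "avg S f = (\<Sum>x\<in>S. f x) / real (card S)"

lemma avg_mono: "(\<And>x. x \<in> S \<Longrightarrow> f x \<le> g x) \<Longrightarrow> avg S f \<le> avg S g"
  unfolding avg_def by (intro divide_right_mono sum_mono) auto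

lemma avg_cong: "(\<And>x. x \<in> S \<Longrightarrow> f x = g x) \<Longrightarrow> avg S f = avg S g"
  unfolding avg_def by simp

lemma avg_nonneg: "(\<And>x. x \<in> S \<Longrightarrow> 0 \<le> f x) \<Longrightarrow> 0 \<le> avg S f"
  unfolding avg_def by (simp add: sum_nonneg)

lemma avg_add: "avg S (\<lambda>x. f x + g x) = avg S f + avg S g"
  unfolding avg_def by (simp add: sum.distrib add_divide_distrib)

lemma avg_cmult: "avg S (\<lambda>x. c * f x) = c * avg S f"
  unfolding avg_def by (simp add: sum_distrib_left)

lemma avg_diff: "avg S (\<lambda>x. f x - g x) = avg S f - avg S g"
  unfolding avg_def by (simp add: sum_subtractf diff_divide_distrib)

lemma avg_sum: "avg S (\<lambda>x. \<Sum>j\<in>J. f j x) = (\<Sum>j\<in>J. avg S (f j))"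
  unfolding avg_def by (subst sum.swap) (simp add: sum_divide_distrib)

lemma avg_const: "finite S \<Longrightarrow> S \<noteq> {} \<Longrightarrow> avg S (\<lambda>x. c) = c"
  unfolding avg_def by simp

lemma avg_swap: "avg S (\<lambda>x. avg T (f x)) = avg T (\<lambda>y. avg S (\<lambda>x. f x y))"
  unfolding avg_def sum_divide_distrib[symmetric] by (subst sum.swap) (simp add: mult.commute)

lemma avg_bij: "bij_betw h S S \<Longrightarrow> avg S (\<lambda>x. f (h x)) = avg S f"
  unfolding avg_def by (simp add: sum.reindex_bij_betw)

lemma avg_Times: "avg (S \<times> T) f = avg S (\<lambda>x. avg T (\<lambda>y. f (x, y)))"
  unfolding avg_def by (simp add: sum.cartesian_product card_cartesian_product mult.commute
      sum_divide_distrib[symmetric])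

text \<open>Jensen's inequality, from the tangent line of \<open>exp\<close> at the average.\<close>

lemma exp_avg_le: 
  assumes "finite S" "S \<noteq> {}"
  shows "exp (avg S f) \<le> avg S (\<lambda>x. exp (f x))"
proof -
  let ?a = "avg S f"
  have "avg S (\<lambda>x. exp ?a * (1 + (f x - ?a))) \<le> avg S (\<lambda>x. exp (f x))"
  proof (rule avg_mono)
    fix x
    have "exp ?a * (1 + (f x - ?a)) \<le> exp ?a * exp (f x - ?a)"
      by (intro mult_left_mono exp_ge_add_one_self) simp
    then show "exp ?a * (1 + (f x - ?a)) \<le> exp (f x)" by (simp add: exp_add[symmetric])
  qed
  moreover have "avg S (\<lambda>x. exp ?a * (1 + (f x - ?a))) = exp ?a"
    using assms by (simp add: avg_cmult avg_add avg_diff avg_const)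
  ultimately show ?thesis by simp
qed

text \<open>The difference of the two sides is the variance.\<close>

lemma avg_power2_le:
  assumes "finite S" "S \<noteq> {}"
  shows "(avg S f)\<^sup>2 \<le> avg S (\<lambda>x. (f x)\<^sup>2)"
proof -
  let ?a = "avg S f"
  have "0 \<le> avg S (\<lambda>x. (f x - ?a)\<^sup>2)" by (rule avg_nonneg) simp
  also have "\<dots> = avg S (\<lambda>x. ((f x)\<^sup>2 - (2 * ?a) * f x) + ?a\<^sup>2)"
    by (rule avg_cong) (simp add: power2_eq_square algebra_simps)
  also have "\<dots> = avg S (\<lambda>x. (f x)\<^sup>2) - ?a\<^sup>2"
    using assms by (simp add: avg_add avg_diff avg_cmult avg_const power2_eq_square)
  finally show ?thesis by simp
qed

lemma abs_avg_le: "\<bar>avg S f\<bar> \<le> avg S (\<lambda>x. \<bar>f x\<bar>)"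
  unfolding avg_def by (simp add: divide_right_mono)

section \<open>Rademacher sums and their maxima\<close>

definition sgns :: "nat \<Rightarrow> nat \<Rightarrow> (nat \<times> nat \<Rightarrow> real) set" where
  "sgns m B = PiE ({..<m} \<times> {..<B}) (\<lambda>_. {-1, 1})"

lemma finite_sgns [simp]: "finite (sgns m B)"
  unfolding sgns_def by (intro finite_PiE) auto

lemma sgns_nonempty [simp]: "sgns m B \<noteq> {}"
  unfolding sgns_def by (simp add: PiE_eq_empty_iff)

lemma card_sgns: "card (sgns m B) = 2 ^ (m * B)"
  unfolding sgns_def by (subst card_PiE) (auto simp: numeral_2_eq_2)

lemma sgns_cases: "\<sigma> \<in> sgns m B \<Longrightarrow> b < m \<Longrightarrow> i < B \<Longrightarrow> \<sigma> (b, i) = -1 \<or> \<sigma> (b, i) = 1"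
  unfolding sgns_def by (auto dest!: PiE_mem[where x = "(b,i)"])

definition rad :: "nat \<Rightarrow> nat \<Rightarrow> (nat \<times> nat \<Rightarrow> real) \<Rightarrow> (nat \<Rightarrow> nat \<Rightarrow> real) \<Rightarrow> real" where
  "rad m B \<tau> c = (\<Sum>b<m. \<Sum>i<B. \<tau> (b, i) * c b i)"

text \<open>The exponential of a sum over coordinates is a product, and the sum of a product over
  all sign patterns factorises; each factor is twice a hyperbolic cosine.\<close>

lemma avg_exp_rad_le:
  "avg (sgns m B) (\<lambda>\<tau>. exp (rad m B \<tau> c)) \<le> exp (\<Sum>b<m. \<Sum>i<B. (c b i)\<^sup>2)"
proof -
  let ?P = "{..<m} \<times> {..<B}"
  define e where "e = (\<lambda>p (t::real). exp (t * c (fst p) (snd p)))"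
  have "(\<Sum>\<tau>\<in>sgns m B. exp (rad m B \<tau> c)) = (\<Sum>\<tau>\<in>sgns m B. \<Prod>p\<in>?P. e p (\<tau> p))"
    by (rule sum.cong[OF refl])
      (simp add: rad_def e_def exp_sum[symmetric] sum.cartesian_product split_beta)
  also have "\<dots> = (\<Prod>p\<in>?P. \<Sum>t\<in>{-1, 1}. e p t)"
    unfolding sgns_def by (rule prod_sum_PiE[symmetric]) auto
  also have "\<dots> \<le> (\<Prod>p\<in>?P. 2 * exp ((c (fst p) (snd p))\<^sup>2))"
  proof (intro prod_mono conjI)
    fix p assume "p \<in> ?P"
    show "(\<Sum>t\<in>{-1, 1}. e p t) \<le> 2 * exp ((c (fst p) (snd p))\<^sup>2)"
      using cosh_le_exp_square[of "c (fst p) (snd p)"] by (simp add: e_def add.commute)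
    show "0 \<le> (\<Sum>t\<in>{-1, 1}. e p t)" by (simp add: e_def)
  qed
  also have "\<dots> = 2 ^ (m * B) * exp (\<Sum>b<m. \<Sum>i<B. (c b i)\<^sup>2)"
    unfolding sum.cartesian_product split_beta by (simp add: prod.distrib exp_sum)
  finally show ?thesis
    unfolding avg_def card_sgns by (simp add: divide_le_eq mult.commute)
qed

text \<open>Exponential moments with a union bound: the maximum is replaced by the sum over
  \<open>L\<close> and over both signs, hence \<open>2 * card L\<close> under the logarithm.\<close>

lemma avg_Max_rad_le_pos:
  assumes fin: "finite L" "L \<noteq> {}" and k: "\<kappa> > 0"
    and c: "\<And>l. l \<in> L \<Longrightarrow> (\<Sum>b<m. \<Sum>i<B. (c l b i)\<^sup>2) \<le> \<kappa>\<^sup>2"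
  shows "avg (sgns m B) (\<lambda>\<tau>. MAX l\<in>L. \<bar>rad m B \<tau> (c l)\<bar>) \<le> 2 * sqrt (ln (2 * real (card L))) * \<kappa>"
proof -
  let ?S = "sgns m B" and ?N = "2 * real (card L)"
  define M where "M = (\<lambda>\<tau>. MAX l\<in>L. \<bar>rad m B \<tau> (c l)\<bar>)"
  have "card L \<ge> 1" using fin by (simp add: Suc_le_eq card_gt_0_iff)
  then have N: "?N > 1" by linarith
  define w where "w = sqrt (ln ?N)"
  have w: "w > 0" "w\<^sup>2 = ln ?N" using N by (auto simp: w_def)
  \<comment> \<open>With this parameter the variance term \<open>lm^2 * \<kappa>^2\<close> equals
    the entropy \<open>ln (2 * card L)\<close>.\<close>
  define lm where "lm = w / \<kappa>"
  have lam: "lm > 0" using w k by (simp add: lm_def)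
  have "exp (lm * avg ?S M) \<le> avg ?S (\<lambda>\<tau>. exp (lm * M \<tau>))"
    using exp_avg_le[of ?S "\<lambda>\<tau>. lm * M \<tau>"] by (simp add: avg_cmult)
  also have "\<dots> \<le> avg ?S (\<lambda>\<tau>. \<Sum>l\<in>L. exp (rad m B \<tau> (\<lambda>b i. lm * c l b i)) + exp (rad m B \<tau> (\<lambda>b i. - lm * c l b i)))"
  proof (rule avg_mono)
    fix \<tau>
    have r: "rad m B \<tau> (\<lambda>b i. t * c l b i) = t * rad m B \<tau> (c l)" for t l
      by (simp add: rad_def sum_distrib_left mult_ac)
    have "M \<tau> \<in> (\<lambda>l. \<bar>rad m B \<tau> (c l)\<bar>) ` L" unfolding M_def using fin by (intro Max_in) auto
    then obtain l where l: "l \<in> L" "M \<tau> = \<bar>rad m B \<tau> (c l)\<bar>" by blast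
    have "exp (t * \<bar>x\<bar>) \<le> exp (t * x) + exp (- t * x)" for t x :: real
      by (cases "x \<ge> 0") (simp_all add: abs_if)
    then have "exp (lm * M \<tau>) \<le> exp (lm * rad m B \<tau> (c l)) + exp (- lm * rad m B \<tau> (c l))"
      unfolding l(2) .
    also have "\<dots> \<le> (\<Sum>l\<in>L. exp (lm * rad m B \<tau> (c l)) + exp (- lm * rad m B \<tau> (c l)))"
      using l(1) fin(1) by (intro member_le_sum[where f = "\<lambda>l. exp (lm * rad m B \<tau> (c l)) + exp (- lm * rad m B \<tau> (c l))"]) simp_all
    finally show "exp (lm * M \<tau>) \<le> (\<Sum>l\<in>L. exp (rad m B \<tau> (\<lambda>b i. lm * c l b i)) + exp (rad m B \<tau> (\<lambda>b i. - lm * c l b i)))"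
      by (simp only: r)
  qed
  also have "\<dots> \<le> (\<Sum>l\<in>L. exp (lm\<^sup>2 * \<kappa>\<^sup>2) + exp (lm\<^sup>2 * \<kappa>\<^sup>2))"
  proof -
    have "avg ?S (\<lambda>\<tau>. exp (rad m B \<tau> (\<lambda>b i. t * c l b i))) \<le> exp (lm\<^sup>2 * \<kappa>\<^sup>2)"
      if l: "l \<in> L" and t: "t\<^sup>2 = lm\<^sup>2" for l t
    proof -
      have "(\<Sum>b<m. \<Sum>i<B. (t * c l b i)\<^sup>2) = lm\<^sup>2 * (\<Sum>b<m. \<Sum>i<B. (c l b i)\<^sup>2)"
        by (simp add: power_mult_distrib t sum_distrib_left)
      also have "\<dots> \<le> lm\<^sup>2 * \<kappa>\<^sup>2" by (intro mult_left_mono c l) auto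
      finally show ?thesis
        by (intro order_trans[OF avg_exp_rad_le[of m B "\<lambda>b i. t * c l b i"]]) simp
    qed
    from this[of _ lm] this[of _ "-lm"] show ?thesis
      unfolding avg_sum avg_add by (intro sum_mono add_mono) auto
  qed
  also have "\<dots> = ?N * exp (w\<^sup>2)" using k by (simp add: lm_def power_divide)
  also have "\<dots> = exp (w\<^sup>2 + w\<^sup>2)" using N unfolding exp_add by (simp add: w(2))
  finally have "lm * avg ?S M \<le> w\<^sup>2 + w\<^sup>2" by (simp only: exp_le_cancel_iff)
  then have "avg ?S M \<le> 2 * w * \<kappa>"
  proof -
    have "w * avg ?S M \<le> w * (2 * w * \<kappa>)"
      using \<open>lm * avg ?S M \<le> w\<^sup>2 + w\<^sup>2\<close> k by (simp add: lm_def divide_le_eq power2_eq_square algebra_simps)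
    then show ?thesis using w by (simp only: mult_le_cancel_left_pos)
  qed
  then show ?thesis by (simp add: M_def w_def)
qed

lemma avg_Max_rad_le:
  assumes fin: "finite L" "L \<noteq> {}" and k: "\<kappa> \<ge> 0"
    and c: "\<And>l. l \<in> L \<Longrightarrow> (\<Sum>b<m. \<Sum>i<B. (c l b i)\<^sup>2) \<le> \<kappa>\<^sup>2"
  shows "avg (sgns m B) (\<lambda>\<tau>. MAX l\<in>L. \<bar>rad m B \<tau> (c l)\<bar>) \<le> 2 * sqrt (ln (2 * real (card L))) * \<kappa>"
proof (cases "\<kappa> = 0")
  case False
  then show ?thesis using avg_Max_rad_le_pos[OF fin _ c] k by force
next
  \<comment> \<open>The exponential parameter divides by \<open>\<kappa>\<close>; for
    \<open>\<kappa> = 0\<close> all coefficients vanish instead.\<close>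
  case True
  have "rad m B \<tau> (c l) = 0" if l: "l \<in> L" for l \<tau>
  proof -
    have "(\<Sum>b<m. \<Sum>i<B. (c l b i)\<^sup>2) = 0"
    proof (rule antisym)
      show "(\<Sum>b<m. \<Sum>i<B. (c l b i)\<^sup>2) \<le> 0" using c[OF l] True by simp
    qed (intro sum_nonneg zero_le_power2)
    then have "\<forall>b<m. (\<Sum>i<B. (c l b i)\<^sup>2) = 0"
      by (subst (asm) sum_nonneg_eq_0_iff) (auto intro: sum_nonneg)
    then have "\<forall>b<m. \<forall>i<B. c l b i = 0"
      by (subst (asm) sum_nonneg_eq_0_iff) auto
    then show ?thesis by (simp add: rad_def)
  qed
  then have "(\<lambda>l. \<bar>rad m B \<tau> (c l)\<bar>) ` L = {0}" for \<tau>
    using fin by (simp add: image_constant_conv cong: image_cong)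
  then have "(MAX l\<in>L. \<bar>rad m B \<tau> (c l)\<bar>) = 0" for \<tau> by simp
  then show ?thesis using True by (simp add: avg_const)
qed

text \<open>
  An array \<open>v b i\<close> stands for the values \<open>\<langle>a\<^sub>h\<^sub>(\<^sub>b\<^sub>,\<^sub>i\<^sub>), x\<rangle>\<close>; then \<open>phi\<close> is the \<open>b\<close>-th entry of \<open>\<Phi>x\<close>,
  \<open>bn\<close> and \<open>tot\<close> are the squared norms of \<open>A\<^sub>b x\<close> and \<open>Ax\<close>, and \<open>cross\<close> is \<open>Re \<langle>\<Phi>\<^sub>c w, \<Phi>\<^sub>e z\<rangle>\<close>.
\<close>

definition phi :: "nat \<Rightarrow> (nat \<times> nat \<Rightarrow> real) \<Rightarrow> (nat \<Rightarrow> nat \<Rightarrow> complex) \<Rightarrow> nat \<Rightarrow> complex" where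
  "phi B c v b = (\<Sum>i<B. complex_of_real (c (b, i)) * v b i)"

definition sqn :: "nat \<Rightarrow> nat \<Rightarrow> (nat \<times> nat \<Rightarrow> real) \<Rightarrow> (nat \<Rightarrow> nat \<Rightarrow> complex) \<Rightarrow> real" where
  "sqn m B c v = (\<Sum>b<m. (cmod (phi B c v b))\<^sup>2)"

definition bn :: "nat \<Rightarrow> (nat \<Rightarrow> nat \<Rightarrow> complex) \<Rightarrow> nat \<Rightarrow> real" where
  "bn B v b = (\<Sum>i<B. (cmod (v b i))\<^sup>2)"

definition tot :: "nat \<Rightarrow> nat \<Rightarrow> (nat \<Rightarrow> nat \<Rightarrow> complex) \<Rightarrow> real" where
  "tot m B v = (\<Sum>b<m. bn B v b)"

definition cross :: "nat \<Rightarrow> nat \<Rightarrow> (nat \<times> nat \<Rightarrow> real) \<Rightarrow> (nat \<times> nat \<Rightarrow> real) \<Rightarrow>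
    (nat \<Rightarrow> nat \<Rightarrow> complex) \<Rightarrow> (nat \<Rightarrow> nat \<Rightarrow> complex) \<Rightarrow> real" where
  "cross m B c e w z = (\<Sum>b<m. Re (phi B c w b * cnj (phi B e z b)))"

lemma bn_nonneg [simp]: "0 \<le> bn B v b" unfolding bn_def by (simp add: sum_nonneg)
lemma tot_nonneg [simp]: "0 \<le> tot m B v" unfolding tot_def by (simp add: sum_nonneg)
lemma sqn_nonneg [simp]: "0 \<le> sqn m B c v" unfolding sqn_def by (simp add: sum_nonneg)

section \<open>Decoupling of the sign chaos\<close>

lemma bij_betw_involution: "(\<And>x. x \<in> S \<Longrightarrow> h x \<in> S) \<Longrightarrow> (\<And>x. x \<in> S \<Longrightarrow> h (h x) = x) \<Longrightarrow> bij_betw h S S"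
  by (rule bij_betw_byWitness[where f' = h]) auto

text \<open>Flipping the sign at \<open>(b, i)\<close> permutes \<open>sgns m B\<close> and negates
  the product when \<open>i\<close> and \<open>j\<close> differ.\<close>

lemma avg_sgns_mult:
  assumes "b < m" "i < B" "j < B"
  shows "avg (sgns m B) (\<lambda>\<sigma>. \<sigma> (b, i) * \<sigma> (b, j)) = (if i = j then 1 else 0)"
proof (cases "i = j")
  case True
  have "avg (sgns m B) (\<lambda>\<sigma>. \<sigma> (b, i) * \<sigma> (b, j)) = avg (sgns m B) (\<lambda>\<sigma>. 1)"
    by (rule avg_cong) (use sgns_cases[OF _ assms(1,3)] True in fastforce)
  then show ?thesis using True by (simp add: avg_const)
next
  case False
  define h where "h = (\<lambda>\<sigma>::nat \<times> nat \<Rightarrow> real. \<sigma>((b, i) := - \<sigma> (b, i)))"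
  have "bij_betw h (sgns m B) (sgns m B)"
    by (rule bij_betw_involution)
      (use assms in \<open>auto simp: h_def sgns_def PiE_iff extensional_def\<close>)
  then have "avg (sgns m B) (\<lambda>\<sigma>. \<sigma> (b, i) * \<sigma> (b, j)) = avg (sgns m B) (\<lambda>\<sigma>. h \<sigma> (b, i) * h \<sigma> (b, j))"
    by (rule avg_bij[symmetric])
  also have "\<dots> = avg (sgns m B) (\<lambda>\<sigma>. (-1) * (\<sigma> (b, i) * \<sigma> (b, j)))"
    using False by (simp add: h_def)
  also have "\<dots> = - avg (sgns m B) (\<lambda>\<sigma>. \<sigma> (b, i) * \<sigma> (b, j))"
    by (subst avg_cmult) simp
  finally show ?thesis using False by simp
qed

lemma cmod_phi_square:
  "(cmod (phi B c v b))\<^sup>2 = (\<Sum>i<B. \<Sum>j<B. Re (v b i * cnj (v b j)) * (c (b, i) * c (b, j)))"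
proof -
  have "(cmod (phi B c v b))\<^sup>2 = Re (phi B c v b * cnj (phi B c v b))"
    by (simp only: complex_norm_square[symmetric] Re_complex_of_real)
  also have "\<dots> = (\<Sum>i<B. \<Sum>j<B. Re (complex_of_real (c (b, i)) * v b i * cnj (complex_of_real (c (b, j)) * v b j)))"
    unfolding phi_def cnj_sum sum_product Re_sum ..
  also have "\<dots> = (\<Sum>i<B. \<Sum>j<B. Re (v b i * cnj (v b j)) * (c (b, i) * c (b, j)))"
    by (intro sum.cong refl) (simp add: algebra_simps)
  finally show ?thesis .
qed

text \<open>Only diagonal terms survive. This centring allows the deviation to be compared with an
  independent copy of the signs.\<close>

lemma avg_sqn: "avg (sgns m B) (\<lambda>\<sigma>. sqn m B \<sigma> v) = tot m B v"
proof -
  have "avg (sgns m B) (\<lambda>\<sigma>. sqn m B \<sigma> v) =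
      (\<Sum>b<m. \<Sum>i<B. \<Sum>j<B. Re (v b i * cnj (v b j)) * avg (sgns m B) (\<lambda>\<sigma>. \<sigma> (b, i) * \<sigma> (b, j)))"
    unfolding sqn_def cmod_phi_square avg_sum avg_cmult ..
  also have "\<dots> = (\<Sum>b<m. \<Sum>i<B. \<Sum>j<B. if i = j then Re (v b i * cnj (v b j)) else 0)"
    by (intro sum.cong refl) (simp add: avg_sgns_mult)
  also have "\<dots> = tot m B v"
    unfolding tot_def bn_def cmod_power2 by (intro sum.cong refl) (simp add: power2_eq_square)
  finally show ?thesis .
qed

lemma phi_add: "phi B (\<lambda>p. c p + e p) v b = phi B c v b + phi B e v b"
  by (simp add: phi_def sum.distrib algebra_simps)

lemma phi_diff: "phi B (\<lambda>p. c p - e p) v b = phi B c v b - phi B e v b"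
  by (simp add: phi_def sum_subtractf algebra_simps)

lemma phi_diff_right: "phi B c (\<lambda>b i. v b i - w b i) b = phi B c v b - phi B c w b"
  by (simp add: phi_def sum_subtractf algebra_simps)

lemma sqrt_sqn: "sqrt (sqn m B c v) = L2_set (\<lambda>b. cmod (phi B c v b)) {..<m}"
  by (simp add: sqn_def L2_set_def)

lemma sqrt_sqn_add_le: "sqrt (sqn m B (\<lambda>p. c p + e p) v) \<le> sqrt (sqn m B c v) + sqrt (sqn m B e v)"
proof -
  have "sqrt (sqn m B (\<lambda>p. c p + e p) v) \<le> L2_set (\<lambda>b. cmod (phi B c v b) + cmod (phi B e v b)) {..<m}"
    unfolding sqrt_sqn by (intro L2_set_mono) (auto simp: phi_add norm_triangle_ineq)
  also have "\<dots> \<le> sqrt (sqn m B c v) + sqrt (sqn m B e v)"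
    unfolding sqrt_sqn by (rule L2_set_triangle_ineq)
  finally show ?thesis .
qed

text \<open>Polarisation \<open>|x|^2 - |y|^2 = Re ((x + y) * cnj (x - y))\<close> in each
  block.\<close>

lemma sqn_diff_eq_cross:
  "sqn m B \<sigma> v - sqn m B \<sigma>' v = cross m B (\<lambda>p. \<sigma> p + \<sigma>' p) (\<lambda>p. \<sigma> p - \<sigma>' p) v v"
proof -
  have "(cmod x)\<^sup>2 - (cmod y)\<^sup>2 = Re ((x + y) * cnj (x - y))" for x y
    unfolding cmod_power2 by (simp add: algebra_simps power2_eq_square)
  then show ?thesis unfolding sqn_def cross_def phi_add phi_diff sum_subtractf[symmetric] by (intro sum.cong refl)
qed

lemma cross_telescope:
  "cross m B c e w w - cross m B c e w' w' =
    cross m B c e w (\<lambda>b i. w b i - w' b i) + cross m B c e (\<lambda>b i. w b i - w' b i) w'"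
  unfolding cross_def phi_diff_right sum.distrib[symmetric] sum_subtractf[symmetric]
  by (intro sum.cong refl) (simp add: algebra_simps)

lemma cross_commute: "cross m B c e w z = cross m B e c z w"
  by (simp add: cross_def mult.commute)

lemma cross_eq_rad:
  "cross m B c (\<lambda>p. \<tau> p * e p) w z = rad m B \<tau> (\<lambda>b i. e (b, i) * Re (phi B c w b * cnj (z b i)))"
  unfolding cross_def rad_def phi_def[of B "\<lambda>p. \<tau> p * e p"] cnj_sum sum_distrib_left Re_sum
  by (intro sum.cong refl) (simp add: algebra_simps)

lemma cross_cong:
  assumes "\<And>b i. b < m \<Longrightarrow> i < B \<Longrightarrow> c (b, i) = c' (b, i)" "\<And>b i. b < m \<Longrightarrow> i < B \<Longrightarrow> e (b, i) = e' (b, i)"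
  shows "cross m B c e w z = cross m B c' e' w z"
proof -
  have "phi B c w b = phi B c' w b" "phi B e z b = phi B e' z b" if "b < m" for b
    using assms that by (simp_all add: phi_def)
  then show ?thesis by (simp add: cross_def)
qed

text \<open>The bijection exchanges \<open>\<sigma>\<close> and \<open>\<sigma>'\<close> where
  \<open>\<tau>\<close> is -1. The assumption on \<open>f\<close> confines its dependence to the
  index grid: outside the grid sign patterns have the default value, and the two arguments of
  \<open>f\<close> may differ there.\<close>

lemma avg_swap_signs:
  assumes t: "\<tau> \<in> sgns m B" and that: "\<And>c e c' e'. (\<And>b i. b < m \<Longrightarrow> i < B \<Longrightarrow> c (b, i) = c' (b, i)) \<Longrightarrow>
        (\<And>b i. b < m \<Longrightarrow> i < B \<Longrightarrow> e (b, i) = e' (b, i)) \<Longrightarrow> f c e = f c' e'"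
  shows "avg (sgns m B \<times> sgns m B) (\<lambda>(\<sigma>, \<sigma>'). f (\<lambda>p. \<sigma> p + \<sigma>' p) (\<lambda>p. \<tau> p * (\<sigma> p - \<sigma>' p)))
    = avg (sgns m B \<times> sgns m B) (\<lambda>(\<sigma>, \<sigma>'). f (\<lambda>p. \<sigma> p + \<sigma>' p) (\<lambda>p. \<sigma> p - \<sigma>' p))"
proof -
  define h where "h = (\<lambda>(\<sigma>::nat \<times> nat \<Rightarrow> real, \<sigma>'::nat \<times> nat \<Rightarrow> real). 
     (\<lambda>p. if \<tau> p = 1 then \<sigma> p else \<sigma>' p, \<lambda>p. if \<tau> p = 1 then \<sigma>' p else \<sigma> p))"
  have bij: "bij_betw h (sgns m B \<times> sgns m B) (sgns m B \<times> sgns m B)"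
  proof (rule bij_betw_involution)
    show "h x \<in> sgns m B \<times> sgns m B" if "x \<in> sgns m B \<times> sgns m B" for x
      using that by (simp add: h_def sgns_def PiE_iff extensional_def split_beta mem_Times_iff)
    show "h (h x) = x" for x
      by (simp add: h_def split_beta prod_eq_iff if_distrib cong: if_cong)
  qed
  show ?thesis
    unfolding avg_bij[OF bij, of "\<lambda>(\<sigma>, \<sigma>'). f (\<lambda>p. \<sigma> p + \<sigma>' p) (\<lambda>p. \<sigma> p - \<sigma>' p)", symmetric]
  proof (rule avg_cong, clarify)
    fix \<sigma> \<sigma>' :: "nat \<times> nat \<Rightarrow> real"
    let ?s = "\<lambda>p. if \<tau> p = 1 then \<sigma> p else \<sigma>' p" and ?s' = "\<lambda>p. if \<tau> p = 1 then \<sigma>' p else \<sigma> p"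
    have "f (\<lambda>p. \<sigma> p + \<sigma>' p) (\<lambda>p. \<tau> p * (\<sigma> p - \<sigma>' p)) = f (\<lambda>p. ?s p + ?s' p) (\<lambda>p. ?s p - ?s' p)"
    proof (rule that)
      fix b i assume "b < m" "i < B"
      then show "\<tau> (b, i) * (\<sigma> (b, i) - \<sigma>' (b, i)) = ?s (b, i) - ?s' (b, i)"
        using sgns_cases[OF t, of b i] by auto
    qed simp
    then show "f (\<lambda>p. \<sigma> p + \<sigma>' p) (\<lambda>p. \<tau> p * (\<sigma> p - \<sigma>' p)) =
        (case h (\<sigma>, \<sigma>') of (\<sigma>, \<sigma>') \<Rightarrow> f (\<lambda>p. \<sigma> p + \<sigma>' p) (\<lambda>p. \<sigma> p - \<sigma>' p))"
      by (simp only: h_def prod.case)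
  qed
qed

text \<open>Negating \<open>\<sigma>'\<close> exchanges sum and difference; restricting the negated
  pattern keeps it extensional.\<close>

lemma avg_neg_signs:
  assumes that: "\<And>c e c' e'. (\<And>b i. b < m \<Longrightarrow> i < B \<Longrightarrow> c (b, i) = c' (b, i)) \<Longrightarrow>
        (\<And>b i. b < m \<Longrightarrow> i < B \<Longrightarrow> e (b, i) = e' (b, i)) \<Longrightarrow> f c e = f c' e'"
  shows
  "avg (sgns m B \<times> sgns m B) (\<lambda>(\<sigma>, \<sigma>'). f (\<lambda>p. \<sigma> p + \<sigma>' p) (\<lambda>p. \<sigma> p - \<sigma>' p))
    = avg (sgns m B \<times> sgns m B) (\<lambda>(\<sigma>, \<sigma>'). f (\<lambda>p. \<sigma> p - \<sigma>' p) (\<lambda>p. \<sigma> p + \<sigma>' p))"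
proof -
  define h where "h = (\<lambda>(\<sigma>::nat \<times> nat \<Rightarrow> real, \<sigma>'::nat \<times> nat \<Rightarrow> real). 
     (\<sigma>, \<lambda>p\<in>{..<m}\<times>{..<B}. - \<sigma>' p))"
  have bij: "bij_betw h (sgns m B \<times> sgns m B) (sgns m B \<times> sgns m B)"
  proof (rule bij_betw_involution)
    show "h x \<in> sgns m B \<times> sgns m B" if "x \<in> sgns m B \<times> sgns m B" for x
      using that by (auto simp: h_def sgns_def PiE_iff split_beta mem_Times_iff)
    show "h (h x) = x" if "x \<in> sgns m B \<times> sgns m B" for x
    proof -
      have "(\<lambda>p\<in>{..<m}\<times>{..<B}. - (\<lambda>p\<in>{..<m}\<times>{..<B}. - snd x p) p) = restrict (snd x) ({..<m}\<times>{..<B})"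
        by (intro restrict_ext) simp
      also have "\<dots> = snd x" using that unfolding sgns_def mem_Times_iff by (rule PiE_restrict[OF conjunct2])
      finally show ?thesis by (simp only: h_def split_beta fst_conv snd_conv prod.collapse)
    qed
  qed
  show ?thesis
    unfolding avg_bij[OF bij, of "\<lambda>(\<sigma>, \<sigma>'). f (\<lambda>p. \<sigma> p + \<sigma>' p) (\<lambda>p. \<sigma> p - \<sigma>' p)", symmetric]
  proof (rule avg_cong, clarify)
    fix \<sigma> \<sigma>' :: "nat \<times> nat \<Rightarrow> real"
    let ?s' = "\<lambda>p\<in>{..<m}\<times>{..<B}. - \<sigma>' p"
    have "f (\<lambda>p. \<sigma> p - \<sigma>' p) (\<lambda>p. \<sigma> p + \<sigma>' p) = f (\<lambda>p. \<sigma> p + ?s' p) (\<lambda>p. \<sigma> p - ?s' p)"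
      by (rule that) simp_all
    then show "(case h (\<sigma>, \<sigma>') of (\<sigma>, \<sigma>') \<Rightarrow> f (\<lambda>p. \<sigma> p + \<sigma>' p) (\<lambda>p. \<sigma> p - \<sigma>' p))
        = f (\<lambda>p. \<sigma> p - \<sigma>' p) (\<lambda>p. \<sigma> p + \<sigma>' p)"
      by (simp only: h_def prod.case)
  qed
qed

section \<open>Chaining for the decoupled chaos\<close>

definition near :: "nat \<Rightarrow> nat \<Rightarrow> real \<Rightarrow> (nat \<Rightarrow> nat \<Rightarrow> complex) \<Rightarrow> (nat \<Rightarrow> nat \<Rightarrow> complex) \<Rightarrow> bool" where
  "near m B u v w \<longleftrightarrow> (\<forall>b<m. sqrt (bn B (\<lambda>b i. v b i - w b i) b) \<le> u)"

lemma sqrt_bn: "sqrt (bn B v b) = L2_set (\<lambda>i. cmod (v b i)) {..<B}"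
  by (simp add: bn_def L2_set_def)

lemma sqrt_bn_add: "sqrt (bn B (\<lambda>b i. v b i + w b i) b) \<le> sqrt (bn B v b) + sqrt (bn B w b)"
proof -
  have "sqrt (bn B (\<lambda>b i. v b i + w b i) b) \<le> L2_set (\<lambda>i. cmod (v b i) + cmod (w b i)) {..<B}"
    unfolding sqrt_bn by (intro L2_set_mono) (auto simp: norm_triangle_ineq)
  also have "\<dots> \<le> sqrt (bn B v b) + sqrt (bn B w b)"
    unfolding sqrt_bn by (rule L2_set_triangle_ineq)
  finally show ?thesis .
qed

lemma near_commute: "near m B u v w \<longleftrightarrow> near m B u w v"
  unfolding near_def bn_def by (simp add: norm_minus_commute)

lemma near_trans: "near m B u v w \<Longrightarrow> near m B u' w z \<Longrightarrow> near m B (u + u') v z"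
  unfolding near_def
proof (intro allI impI)
  fix b assume *: "\<forall>b<m. sqrt (bn B (\<lambda>b i. v b i - w b i) b) \<le> u"
    "\<forall>b<m. sqrt (bn B (\<lambda>b i. w b i - z b i) b) \<le> u'" "b < m"
  have "sqrt (bn B (\<lambda>b i. v b i - z b i) b) \<le> sqrt (bn B (\<lambda>b i. v b i - w b i) b) + sqrt (bn B (\<lambda>b i. w b i - z b i) b)"
    using sqrt_bn_add[of B "\<lambda>b i. v b i - w b i" "\<lambda>b i. w b i - z b i" b] by simp
  then show "sqrt (bn B (\<lambda>b i. v b i - z b i) b) \<le> u + u'" using *(1)[rule_format, OF *(3)] *(2)[rule_format, OF *(3)] by linarith
qed

text \<open>After insertion of \<open>\<tau>\<close>, with \<open>\<sigma>\<close> and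
  \<open>\<sigma>'\<close> frozen, each \<open>cross\<close> is a Rademacher sum in
  \<open>\<tau>\<close>. The largest block norm of \<open>z\<close> comes out of the sum over the
  blocks and leaves the squared norm of the signed frozen argument \<open>w\<close>, at most
  \<open>(S \<sigma> + S \<sigma>')^2\<close>. The bound \<open>S\<close> is a function of the signs
  because it is itself random and is averaged only at the end.\<close>

lemma avg_cross_le:
  assumes fin: "finite L" "L \<noteq> {}" and r: "r \<ge> 0" and N: "card L \<le> N"
    and wL: "\<And>w z \<sigma>. (w, z) \<in> L \<Longrightarrow> \<sigma> \<in> sgns m B \<Longrightarrow> sqrt (sqn m B \<sigma> w) \<le> S \<sigma>"
    and zL: "\<And>w z b. (w, z) \<in> L \<Longrightarrow> b < m \<Longrightarrow> sqrt (bn B z b) \<le> r"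
  shows "avg (sgns m B \<times> sgns m B) (\<lambda>s. MAX l\<in>L. \<bar>cross m B (\<lambda>p. fst s p + snd s p) (\<lambda>p. fst s p - snd s p) (fst l) (snd l)\<bar>)
    \<le> 8 * r * sqrt (ln (2 * real N)) * avg (sgns m B) S"
proof -
  let ?O = "sgns m B"
  let ?f = "\<lambda>c e. MAX l\<in>L. \<bar>cross m B c e (fst l) (snd l)\<bar>"
  let ?a = "avg (?O \<times> ?O) (\<lambda>(\<sigma>, \<sigma>'). ?f (\<lambda>p. \<sigma> p + \<sigma>' p) (\<lambda>p. \<sigma> p - \<sigma>' p))"
  have congf: "?f c e = ?f c' e'" if "\<And>b i. b < m \<Longrightarrow> i < B \<Longrightarrow> c (b, i) = c' (b, i)"
      "\<And>b i. b < m \<Longrightarrow> i < B \<Longrightarrow> e (b, i) = e' (b, i)" for c e c' e'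
  proof -
    have "cross m B c e w z = cross m B c' e' w z" for w z
      by (rule cross_cong) (use that in auto)
    then show ?thesis by simp
  qed
  have swap: "avg (?O \<times> ?O) (\<lambda>(\<sigma>, \<sigma>'). ?f (\<lambda>p. \<sigma> p + \<sigma>' p) (\<lambda>p. \<tau> p * (\<sigma> p - \<sigma>' p))) = ?a" 
    if "\<tau> \<in> ?O" for \<tau>
    by (rule avg_swap_signs[OF that, of ?f, OF congf]) auto
  have "?a = avg ?O (\<lambda>\<tau>. ?a)" by (simp add: avg_const)
  also have "\<dots> = avg ?O (\<lambda>\<tau>. avg (?O \<times> ?O) (\<lambda>(\<sigma>, \<sigma>'). ?f (\<lambda>p. \<sigma> p + \<sigma>' p) (\<lambda>p. \<tau> p * (\<sigma> p - \<sigma>' p))))"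
    by (rule avg_cong) (simp add: swap)
  also have "\<dots> = avg (?O \<times> ?O) (\<lambda>x. avg ?O (\<lambda>\<tau>. case x of (\<sigma>, \<sigma>') \<Rightarrow> ?f (\<lambda>p. \<sigma> p + \<sigma>' p) (\<lambda>p. \<tau> p * (\<sigma> p - \<sigma>' p))))"
    by (rule avg_swap)
  also have "\<dots> \<le> avg (?O \<times> ?O) (\<lambda>(\<sigma>, \<sigma>'). 4 * r * sqrt (ln (2 * real N)) * (S \<sigma> + S \<sigma>'))"
  proof (rule avg_mono, clarify)
    fix \<sigma> \<sigma>' assume s: "\<sigma> \<in> ?O" "\<sigma>' \<in> ?O"
    let ?c = "\<lambda>p. \<sigma> p + \<sigma>' p" and ?e = "\<lambda>p. \<sigma> p - \<sigma>' p"
    let ?k = "\<lambda>l b i. ?e (b, i) * Re (phi B ?c (fst l) b * cnj (snd l b i))"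
    have nn: "0 \<le> S \<sigma>" "0 \<le> S \<sigma>'"
    proof -
      obtain w z where wz: "(w, z) \<in> L" using fin by auto
      have "0 \<le> sqrt (sqn m B \<sigma> w)" for \<sigma> by simp
      then show "0 \<le> S \<sigma>" "0 \<le> S \<sigma>'" using wL[OF wz] s by (meson order_trans)+
    qed
    have "avg ?O (\<lambda>\<tau>. ?f ?c (\<lambda>p. \<tau> p * ?e p)) = avg ?O (\<lambda>\<tau>. MAX l\<in>L. \<bar>rad m B \<tau> (?k l)\<bar>)"
      unfolding cross_eq_rad ..
    also have "\<dots> \<le> 2 * sqrt (ln (2 * real (card L))) * (2 * r * (S \<sigma> + S \<sigma>'))"
    proof (rule avg_Max_rad_le[OF fin])
      show "0 \<le> 2 * r * (S \<sigma> + S \<sigma>')" using nn r by simp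
      fix l assume "l \<in> L"
      then obtain w z where l: "l = (w, z)" "(w, z) \<in> L" by (cases l) auto
      have "(\<Sum>b<m. \<Sum>i<B. (?k l b i)\<^sup>2) \<le> (\<Sum>b<m. \<Sum>i<B. 4 * ((cmod (phi B ?c w b))\<^sup>2 * (cmod (z b i))\<^sup>2))"
      proof (intro sum_mono)
        fix b i assume bi: "b \<in> {..<m}" "i \<in> {..<B}"
        have "(?e (b, i))\<^sup>2 \<le> 4"
          using sgns_cases[OF s(1), of b i] sgns_cases[OF s(2), of b i] bi by auto
        moreover have "(Re (phi B ?c w b * cnj (z b i)))\<^sup>2 \<le> (cmod (phi B ?c w b))\<^sup>2 * (cmod (z b i))\<^sup>2"
        proof -
          have "\<bar>Re (phi B ?c w b * cnj (z b i))\<bar> \<le> cmod (phi B ?c w b) * cmod (z b i)"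
            by (metis abs_Re_le_cmod norm_mult complex_mod_cnj)
          then have "\<bar>Re (phi B ?c w b * cnj (z b i))\<bar>\<^sup>2 \<le> (cmod (phi B ?c w b) * cmod (z b i))\<^sup>2"
            by (rule power_mono) simp
          then show ?thesis by (simp only: power2_abs power_mult_distrib)
        qed
        ultimately show "(?k l b i)\<^sup>2 \<le> 4 * ((cmod (phi B ?c w b))\<^sup>2 * (cmod (z b i))\<^sup>2)"
          unfolding power_mult_distrib l fst_conv snd_conv by (intro mult_mono) auto
      qed
      also have "\<dots> = (\<Sum>b<m. 4 * (cmod (phi B ?c w b))\<^sup>2 * bn B z b)"
        unfolding bn_def by (simp add: sum_distrib_left mult.assoc)
      also have "\<dots> \<le> (\<Sum>b<m. 4 * (cmod (phi B ?c w b))\<^sup>2 * r\<^sup>2)"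
      proof (intro sum_mono mult_left_mono)
        fix b assume "b \<in> {..<m}"
        then have "sqrt (bn B z b) \<le> r" using zL l by auto
        then show "bn B z b \<le> r\<^sup>2" by (metis bn_nonneg real_sqrt_ge_zero real_sqrt_pow2 power_mono)
      qed auto
      also have "\<dots> = 4 * r\<^sup>2 * sqn m B ?c w"
        by (simp add: sqn_def sum_distrib_left mult_ac)
      also have "\<dots> \<le> 4 * r\<^sup>2 * (S \<sigma> + S \<sigma>')\<^sup>2"
      proof (intro mult_left_mono)
        have "sqrt (sqn m B ?c w) \<le> S \<sigma> + S \<sigma>'"
          using sqrt_sqn_add_le[of m B \<sigma> \<sigma>' w] wL[OF l(2) s(1)] wL[OF l(2) s(2)] by linarith
        then show "sqn m B ?c w \<le> (S \<sigma> + S \<sigma>')\<^sup>2"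
          by (metis sqn_nonneg real_sqrt_ge_zero real_sqrt_pow2 power_mono)
      qed simp
      finally show "(\<Sum>b<m. \<Sum>i<B. (?k l b i)\<^sup>2) \<le> (2 * r * (S \<sigma> + S \<sigma>'))\<^sup>2"
        by (simp add: power_mult_distrib)
    qed
    also have "\<dots> \<le> 2 * sqrt (ln (2 * real N)) * (2 * r * (S \<sigma> + S \<sigma>'))"
    proof -
      have "card L > 0" using fin by (simp add: card_gt_0_iff)
      then have "ln (2 * real (card L)) \<le> ln (2 * real N)" using N by simp
      then show ?thesis using nn r by (intro mult_right_mono mult_left_mono) auto
    qed
    finally show "avg ?O (\<lambda>\<tau>. ?f ?c (\<lambda>p. \<tau> p * ?e p)) \<le> 4 * r * sqrt (ln (2 * real N)) * (S \<sigma> + S \<sigma>')"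
      by (simp add: algebra_simps)
  qed
  also have "\<dots> = 8 * r * sqrt (ln (2 * real N)) * avg ?O S"
    by (simp add: avg_Times avg_cmult avg_add avg_const)
  finally show ?thesis unfolding case_prod_unfold .
qed

text \<open>For increments in the other argument, negating \<open>\<sigma>'\<close> exchanges the
  roles of sum and difference.\<close>

lemma avg_cross_le':
  assumes fin: "finite L" "L \<noteq> {}" and r: "r \<ge> 0" and N: "card L \<le> N"
    and wL: "\<And>w z \<sigma>. (w, z) \<in> L \<Longrightarrow> \<sigma> \<in> sgns m B \<Longrightarrow> sqrt (sqn m B \<sigma> w) \<le> S \<sigma>"
    and zL: "\<And>w z b. (w, z) \<in> L \<Longrightarrow> b < m \<Longrightarrow> sqrt (bn B z b) \<le> r"
  shows "avg (sgns m B \<times> sgns m B) (\<lambda>s. MAX l\<in>L. \<bar>cross m B (\<lambda>p. fst s p + snd s p) (\<lambda>p. fst s p - snd s p) (snd l) (fst l)\<bar>)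
    \<le> 8 * r * sqrt (ln (2 * real N)) * avg (sgns m B) S"
proof -
  let ?f = "\<lambda>c e. MAX l\<in>L. \<bar>cross m B c e (fst l) (snd l)\<bar>"
  have congf: "?f c e = ?f c' e'" if "\<And>b i. b < m \<Longrightarrow> i < B \<Longrightarrow> c (b, i) = c' (b, i)"
      "\<And>b i. b < m \<Longrightarrow> i < B \<Longrightarrow> e (b, i) = e' (b, i)" for c e c' e'
  proof -
    have "cross m B c e w z = cross m B c' e' w z" for w z
      by (rule cross_cong) (use that in auto)
    then show ?thesis by simp
  qed
  have "avg (sgns m B \<times> sgns m B) (\<lambda>s. ?f (\<lambda>p. fst s p + snd s p) (\<lambda>p. fst s p - snd s p))
      \<le> 8 * r * sqrt (ln (2 * real N)) * avg (sgns m B) S"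
    by (rule avg_cross_le[OF fin r N]) (erule (1) wL, erule (1) zL)
  also have "avg (sgns m B \<times> sgns m B) (\<lambda>s. ?f (\<lambda>p. fst s p + snd s p) (\<lambda>p. fst s p - snd s p))
      = avg (sgns m B \<times> sgns m B) (\<lambda>s. ?f (\<lambda>p. fst s p - snd s p) (\<lambda>p. fst s p + snd s p))"
    by (rule avg_neg_signs[of m B ?f, OF congf, unfolded case_prod_unfold])
  finally show ?thesis
    unfolding cross_commute[where w = "snd l" and z = "fst l" for l] .
qed

text \<open>Resolves the self-referential bound of the chaining argument. If \<open>Q\<close>
  exceeds \<open>G * sqrt E\<close>, then \<open>G^2 * E \<le> (G * sqrt E) * Q\<close>, so the
  squared hypothesis becomes linear after division by \<open>Q\<close>.\<close>

lemma quadratic_bound: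
  fixes Q G E :: real
  assumes "0 \<le> Q" "0 \<le> G" "0 \<le> E" "Q \<le> G * sqrt (E + Q)"
  shows "Q \<le> G\<^sup>2 + G * sqrt E"
proof (rule ccontr)
  assume *: "\<not> Q \<le> G\<^sup>2 + G * sqrt E"
  then have Q: "Q > G\<^sup>2 + G * sqrt E" by simp
  have "Q\<^sup>2 \<le> (G * sqrt (E + Q))\<^sup>2" using assms by (intro power_mono) auto
  also have "\<dots> = G\<^sup>2 * Q + (G * sqrt E) * (G * sqrt E)" using assms
    by (simp add: power_mult_distrib algebra_simps power2_eq_square)
  also have "\<dots> \<le> G\<^sup>2 * Q + (G * sqrt E) * Q"
    using assms less_imp_le[OF Q] zero_le_power2[of G] by (intro add_left_mono mult_left_mono) (linarith, simp)
  also have "\<dots> = (G\<^sup>2 + G * sqrt E) * Q" by (simp add: algebra_simps)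
  also have "\<dots> < Q * Q"
  proof (rule mult_strict_right_mono[OF Q])
    have "0 \<le> G\<^sup>2 + G * sqrt E" using assms by simp
    then show "0 < Q" using Q by linarith
  qed
  finally show False by (simp add: power2_eq_square)
qed

lemma chaining:
  fixes V :: "(nat \<Rightarrow> nat \<Rightarrow> complex) set" and \<pi> :: "nat \<Rightarrow> (nat \<Rightarrow> nat \<Rightarrow> complex) \<Rightarrow> (nat \<Rightarrow> nat \<Rightarrow> complex)"
  assumes V: "finite V" "V \<noteq> {}"
    and pi0: "\<And>v. v \<in> V \<Longrightarrow> \<pi> 0 v = (\<lambda>b i. 0)"
    and piJ: "\<And>v. v \<in> V \<Longrightarrow> \<pi> J v = v"
    and piV: "\<And>v j. v \<in> V \<Longrightarrow> j \<le> J \<Longrightarrow> \<pi> j v \<in> V"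
    and card_pi: "\<And>j. j \<le> J \<Longrightarrow> card (\<pi> j ` V) \<le> N j"
    and near: "\<And>v j. v \<in> V \<Longrightarrow> j \<le> J \<Longrightarrow> near m B (u j) v (\<pi> j v)"
    and u: "\<And>j. u j \<ge> 0"
    and E: "\<And>v. v \<in> V \<Longrightarrow> tot m B v \<le> E"
    and G: "G = 16 * (\<Sum>j<J. (u j + u (Suc j)) * sqrt (ln (2 * real (N j * N (Suc j)))))"
  shows "avg (sgns m B) (\<lambda>\<sigma>. MAX v\<in>V. \<bar>sqn m B \<sigma> v - tot m B v\<bar>) \<le> G\<^sup>2 + G * sqrt E"
proof -
  let ?O = "sgns m B"
  define D where "D = (\<lambda>\<sigma>. MAX v\<in>V. \<bar>sqn m B \<sigma> v - tot m B v\<bar>)"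
  define S where "S = (\<lambda>\<sigma>. MAX v\<in>V. sqrt (sqn m B \<sigma> v))"
  define X where "X s w z = cross m B (\<lambda>p. fst s p + snd s p) (\<lambda>p. fst s p - snd s p) w z"
    for s :: "(nat \<times> nat \<Rightarrow> real) \<times> (nat \<times> nat \<Rightarrow> real)" and w z
  define F where "F s v = X s v v" for s v
  define dl where "dl = (\<lambda>j v b i. \<pi> (Suc j) v b i - \<pi> j v b i)"
  \<comment> \<open>The two kinds of increments from \<open>cross_telescope\<close>: a change of
    argument is paired with the new point in \<open>L1\<close> and with the old point in
    \<open>L2\<close>.\<close>
  define L1 where "L1 = (\<lambda>j. (\<lambda>v. (\<pi> (Suc j) v, dl j v)) ` V)"
  define L2 where "L2 = (\<lambda>j. (\<lambda>v. (\<pi> j v, dl j v)) ` V)"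
  have SV: "sqrt (sqn m B \<sigma> v) \<le> S \<sigma>" if "v \<in> V" for v \<sigma>
    unfolding S_def using that V by (intro Max_ge) auto
  have DV: "\<bar>sqn m B \<sigma> v - tot m B v\<bar> \<le> D \<sigma>" if "v \<in> V" for v \<sigma>
    unfolding D_def using that V by (intro Max_ge) auto
  have Dle: "D \<sigma> \<le> x" if "\<And>v. v \<in> V \<Longrightarrow> \<bar>sqn m B \<sigma> v - tot m B v\<bar> \<le> x" for \<sigma> x
    unfolding D_def using that V by (intro Max.boundedI) auto
  have S_nonneg: "0 \<le> S \<sigma>" for \<sigma>
  proof -
    obtain v where "v \<in> V" using V by auto
    have "0 \<le> sqrt (sqn m B \<sigma> v)" by simp
    also have "\<dots> \<le> S \<sigma>" by (rule SV) fact
    finally show ?thesis .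
  qed
  have D_nonneg: "0 \<le> D \<sigma>" for \<sigma>
  proof -
    obtain v where "v \<in> V" using V by auto
    have "0 \<le> \<bar>sqn m B \<sigma> v - tot m B v\<bar>" by simp
    also have "\<dots> \<le> D \<sigma>" by (rule DV) fact
    finally show ?thesis .
  qed
  have finL: "finite (L1 j)" "L1 j \<noteq> {}" "finite (L2 j)" "L2 j \<noteq> {}" for j
    using V by (auto simp: L1_def L2_def)
  have cardL: "card (L1 j) \<le> N j * N (Suc j)" "card (L2 j) \<le> N j * N (Suc j)" if j: "j < J" for j
  proof -
    let ?P = "\<pi> j ` V \<times> \<pi> (Suc j) ` V"
    have "card ?P \<le> N j * N (Suc j)"
      unfolding card_cartesian_product using card_pi j by (intro mult_mono) auto
    moreover have "L1 j \<subseteq> (\<lambda>(w', w). (w, \<lambda>b i. w b i - w' b i)) ` ?P"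
      "L2 j \<subseteq> (\<lambda>(w', w). (w', \<lambda>b i. w b i - w' b i)) ` ?P"
      by (auto simp: L1_def L2_def dl_def image_iff)
    then have "card (L1 j) \<le> card ?P" "card (L2 j) \<le> card ?P"
      using V by (meson surj_card_le finite_SigmaI finite_imageI)+
    ultimately show "card (L1 j) \<le> N j * N (Suc j)" "card (L2 j) \<le> N j * N (Suc j)" by auto
  qed
  have dl: "sqrt (bn B (dl j v) b) \<le> u j + u (Suc j)" if "v \<in> V" "j < J" "b < m" for j v b
  proof -
    have "near m B (u (Suc j) + u j) (\<pi> (Suc j) v) (\<pi> j v)"
      using near_trans[of m B "u (Suc j)" "\<pi> (Suc j) v" v "u j" "\<pi> j v"] near[of v "Suc j"] near[of v j] that
      by (simp add: near_commute[of m B "u (Suc j)"])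
    then show ?thesis using that by (simp add: near_def dl_def add.commute)
  qed
  \<comment> \<open>Symmetrisation: \<open>tot\<close> is the average of \<open>sqn\<close> over the
    independent copy \<open>\<sigma>'\<close>, and absolute value and maximum are moved inside that
    average.\<close>
  have "avg ?O D \<le> avg ?O (\<lambda>\<sigma>. avg ?O (\<lambda>\<sigma>'. MAX v\<in>V. \<bar>F (\<sigma>, \<sigma>') v\<bar>))"
  proof (rule avg_mono, rule Dle)
    fix \<sigma> v assume v: "v \<in> V"
    have "sqn m B \<sigma> v - tot m B v = avg ?O (\<lambda>\<sigma>'. sqn m B \<sigma> v - sqn m B \<sigma>' v)"
      by (simp add: avg_diff avg_const avg_sqn)
    then have "\<bar>sqn m B \<sigma> v - tot m B v\<bar> \<le> avg ?O (\<lambda>\<sigma>'. \<bar>sqn m B \<sigma> v - sqn m B \<sigma>' v\<bar>)"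
      using abs_avg_le by metis
    also have "\<dots> \<le> avg ?O (\<lambda>\<sigma>'. MAX v\<in>V. \<bar>F (\<sigma>, \<sigma>') v\<bar>)"
      unfolding sqn_diff_eq_cross F_def X_def fst_conv snd_conv using v V by (intro avg_mono Max_ge) auto
    finally show "\<bar>sqn m B \<sigma> v - tot m B v\<bar> \<le> avg ?O (\<lambda>\<sigma>'. MAX v\<in>V. \<bar>F (\<sigma>, \<sigma>') v\<bar>)" .
  qed
  also have "\<dots> = avg (?O \<times> ?O) (\<lambda>s. MAX v\<in>V. \<bar>F s v\<bar>)" by (simp add: avg_Times)
  also have "\<dots> \<le> avg (?O \<times> ?O) (\<lambda>s. \<Sum>j<J. (MAX l\<in>L1 j. \<bar>X s (fst l) (snd l)\<bar>) + (MAX l\<in>L2 j. \<bar>X s (snd l) (fst l)\<bar>))"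
  proof (rule avg_mono)
    fix s :: "(nat \<times> nat \<Rightarrow> real) \<times> (nat \<times> nat \<Rightarrow> real)"
    have "\<bar>F s v\<bar> \<le> (\<Sum>j<J. (MAX l\<in>L1 j. \<bar>X s (fst l) (snd l)\<bar>) + (MAX l\<in>L2 j. \<bar>X s (snd l) (fst l)\<bar>))" if v: "v \<in> V" for v
    proof -
      have "F s (\<pi> 0 v) = 0" unfolding pi0[OF v] by (simp add: F_def X_def cross_def phi_def)
      then have "F s v = (\<Sum>j<J. F s (\<pi> (Suc j) v) - F s (\<pi> j v))"
        using sum_lessThan_telescope[of "\<lambda>j. F s (\<pi> j v)" J] piJ[OF v] by simp
      also have "\<dots> = (\<Sum>j<J. X s (\<pi> (Suc j) v) (dl j v) + X s (dl j v) (\<pi> j v))"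
        by (intro sum.cong refl) (simp only: F_def X_def dl_def cross_telescope)
      finally have "\<bar>F s v\<bar> \<le> (\<Sum>j<J. \<bar>X s (\<pi> (Suc j) v) (dl j v)\<bar> + \<bar>X s (dl j v) (\<pi> j v)\<bar>)"
        by (simp only:) (rule order_trans[OF sum_abs], intro sum_mono abs_triangle_ineq)
      also have "\<dots> \<le> (\<Sum>j<J. (MAX l\<in>L1 j. \<bar>X s (fst l) (snd l)\<bar>) + (MAX l\<in>L2 j. \<bar>X s (snd l) (fst l)\<bar>))"
      proof (intro sum_mono add_mono Max_ge)
        fix j
        show "\<bar>X s (\<pi> (Suc j) v) (dl j v)\<bar> \<in> (\<lambda>l. \<bar>X s (fst l) (snd l)\<bar>) ` L1 j"
          unfolding L1_def image_image by (rule image_eqI[OF _ v]) simp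
        show "\<bar>X s (dl j v) (\<pi> j v)\<bar> \<in> (\<lambda>l. \<bar>X s (snd l) (fst l)\<bar>) ` L2 j"
          unfolding L2_def image_image by (rule image_eqI[OF _ v]) simp
      qed (intro finite_imageI finL)+
      finally show ?thesis .
    qed
    then show "(MAX v\<in>V. \<bar>F s v\<bar>) \<le> (\<Sum>j<J. (MAX l\<in>L1 j. \<bar>X s (fst l) (snd l)\<bar>) + (MAX l\<in>L2 j. \<bar>X s (snd l) (fst l)\<bar>))"
      using V by (intro Max.boundedI) auto
  qed
  also have "\<dots> = (\<Sum>j<J. avg (?O \<times> ?O) (\<lambda>s. MAX l\<in>L1 j. \<bar>X s (fst l) (snd l)\<bar>) + avg (?O \<times> ?O) (\<lambda>s. MAX l\<in>L2 j. \<bar>X s (snd l) (fst l)\<bar>))"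
    by (simp only: avg_sum avg_add)
  also have "\<dots> \<le> (\<Sum>j<J. 8 * (u j + u (Suc j)) * sqrt (ln (2 * real (N j * N (Suc j)))) * avg ?O S +
      8 * (u j + u (Suc j)) * sqrt (ln (2 * real (N j * N (Suc j)))) * avg ?O S)"
  proof (intro sum_mono add_mono)
    fix j assume j: "j \<in> {..<J}"
    show "avg (?O \<times> ?O) (\<lambda>s. MAX l\<in>L1 j. \<bar>X s (fst l) (snd l)\<bar>) \<le> 8 * (u j + u (Suc j)) * sqrt (ln (2 * real (N j * N (Suc j)))) * avg ?O S"
      unfolding X_def
    proof (rule avg_cross_le[OF finL(1,2)])
      show "0 \<le> u j + u (Suc j)" using u by (simp add: add_nonneg_nonneg)
      show "card (L1 j) \<le> N j * N (Suc j)" using cardL(1) j by simp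
      fix w z \<sigma> b assume "(w, z) \<in> L1 j"
      then obtain v where v: "v \<in> V" "w = \<pi> (Suc j) v" "z = dl j v" unfolding L1_def by (elim imageE) simp
      show "sqrt (sqn m B \<sigma> w) \<le> S \<sigma>" unfolding v(2) by (rule SV, rule piV[OF v(1)]) (use j in simp)
      show "sqrt (bn B z b) \<le> u j + u (Suc j)" if "b < m" unfolding v(3) using dl[OF v(1) _ that] j by simp
    qed
    show "avg (?O \<times> ?O) (\<lambda>s. MAX l\<in>L2 j. \<bar>X s (snd l) (fst l)\<bar>) \<le> 8 * (u j + u (Suc j)) * sqrt (ln (2 * real (N j * N (Suc j)))) * avg ?O S"
      unfolding X_def
    proof (rule avg_cross_le'[OF finL(3,4)])
      show "0 \<le> u j + u (Suc j)" using u by (simp add: add_nonneg_nonneg)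
      show "card (L2 j) \<le> N j * N (Suc j)" using cardL(2) j by simp
      fix w z \<sigma> b assume "(w, z) \<in> L2 j"
      then obtain v where v: "v \<in> V" "w = \<pi> j v" "z = dl j v" unfolding L2_def by (elim imageE) simp
      show "sqrt (sqn m B \<sigma> w) \<le> S \<sigma>" unfolding v(2) by (rule SV, rule piV[OF v(1)]) (use j in simp)
      show "sqrt (bn B z b) \<le> u j + u (Suc j)" if "b < m" unfolding v(3) using dl[OF v(1) _ that] j by simp
    qed
  qed
  also have "\<dots> = G * avg ?O S"
    by (simp add: G sum_distrib_right sum_distrib_left algebra_simps)
  finally have 1: "avg ?O D \<le> G * avg ?O S" .
  \<comment> \<open>The bound closes on itself: a squared norm is its mean, at most
    \<open>E\<close>, plus the deviation that is being estimated.\<close>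
  have "(avg ?O S)\<^sup>2 \<le> avg ?O (\<lambda>\<sigma>. (S \<sigma>)\<^sup>2)" by (rule avg_power2_le) auto
  also have "\<dots> \<le> avg ?O (\<lambda>\<sigma>. E + D \<sigma>)"
  proof (rule avg_mono)
    fix \<sigma>
    have "S \<sigma> \<in> (\<lambda>v. sqrt (sqn m B \<sigma> v)) ` V" unfolding S_def using V by (intro Max_in) auto
    then obtain v where v: "v \<in> V" "S \<sigma> = sqrt (sqn m B \<sigma> v)" by auto
    show "(S \<sigma>)\<^sup>2 \<le> E + D \<sigma>" using DV[OF v(1), of \<sigma>] E[OF v(1)] v(2) by simp
  qed
  also have "\<dots> = E + avg ?O D" by (simp add: avg_add avg_const)
  finally have 2: "avg ?O S \<le> sqrt (E + avg ?O D)" by (rule real_le_rsqrt)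
  have G0: "0 \<le> G" 
  proof -
    have "0 \<le> sqrt (ln (2 * real (N j * N (Suc j))))" if "j < J" for j
    proof -
      have "card (\<pi> j ` V) \<ge> 1" "card (\<pi> (Suc j) ` V) \<ge> 1" using V by (auto simp: Suc_le_eq card_gt_0_iff)
      then have "1 \<le> N j" "1 \<le> N (Suc j)" using card_pi[of j] card_pi[of "Suc j"] that by auto
      then have "1 \<le> N j * N (Suc j)" by simp
      then have "1 \<le> real (N j * N (Suc j))" by (simp only: real_of_nat_ge_one_iff)
      then show ?thesis by (intro real_sqrt_ge_zero ln_ge_zero) linarith
    qed
    then show ?thesis unfolding G using u by (intro mult_nonneg_nonneg sum_nonneg) auto
  qed
  have "avg ?O D \<le> G * sqrt (E + avg ?O D)"
    by (rule order_trans[OF 1 mult_left_mono[OF 2 G0]])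
  moreover have "0 \<le> E"
  proof -
    obtain v where "v \<in> V" using V by auto
    then show ?thesis using E[of v] tot_nonneg[of m B v] by linarith
  qed
  ultimately have "avg ?O D \<le> G\<^sup>2 + G * sqrt E"
    using G0 D_nonneg by (intro quadratic_bound avg_nonneg) auto
  then show ?thesis by (simp add: D_def)
qed

section \<open>Greedy sampling\<close>

text \<open>One greedy step in one block: \<open>nv\<close> is the squared norm of the partial sum,
  \<open>x j\<close> its real inner product with sample \<open>j\<close>, and \<open>y j\<close> the
  squared norm of the sample. The linear term in \<open>x\<close> averages to zero. The quadratic
  one is at most a multiple of \<open>nv\<close>, so a change of the coefficient of
  \<open>nv\<close> in the exponent can absorb it.\<close>

lemma exp_moment_step:
  fixes p x y :: "'a \<Rightarrow> real"
  assumes fin: "finite S" and p: "\<And>j. j \<in> S \<Longrightarrow> 0 \<le> p j" "(\<Sum>j\<in>S. p j) = 1"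
    and x0: "(\<Sum>j\<in>S. p j * x j) = 0" and x2: "(\<Sum>j\<in>S. p j * (x j)\<^sup>2) \<le> s2 * nv"
    and y1: "(\<Sum>j\<in>S. p j * y j) \<le> t2" and y: "\<And>j. j \<in> S \<Longrightarrow> 0 \<le> y j" 
    and mu: "0 \<le> \<mu>" and le1: "\<And>j. j \<in> S \<Longrightarrow> 2 * \<mu> * x j + \<mu> * y j \<le> 1" "\<And>j. j \<in> S \<Longrightarrow> \<mu> * y j \<le> 1"
  shows "(\<Sum>j\<in>S. p j * exp (\<mu> * (nv + 2 * x j + y j))) \<le> exp (3 * \<mu> * t2 + (\<mu> + 8 * \<mu>\<^sup>2 * s2) * nv)"
proof -
  have eq: "(\<Sum>j\<in>S. p j * exp (\<mu> * (nv + 2 * x j + y j))) = exp (\<mu> * nv) * (\<Sum>j\<in>S. p j * exp (2 * \<mu> * x j + \<mu> * y j))"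
    unfolding sum_distrib_left by (intro sum.cong refl) (simp add: exp_add algebra_simps)
  have "(\<Sum>j\<in>S. p j * exp (2 * \<mu> * x j + \<mu> * y j)) \<le> (\<Sum>j\<in>S. p j * (1 + 2 * \<mu> * x j + 3 * \<mu> * y j + 8 * \<mu>\<^sup>2 * (x j)\<^sup>2))"
  proof (intro sum_mono mult_left_mono p)
    fix j assume j: "j \<in> S"
    let ?u = "2 * \<mu> * x j" and ?v = "\<mu> * y j"
    have "exp (?u + ?v) \<le> 1 + (?u + ?v) + (?u + ?v)\<^sup>2" by (rule exp_le_quadratic[OF le1(1)[OF j]])
    \<comment> \<open>The later factor 8 is 2 * 4 from the square of \<open>2 * \<mu> * x j\<close>;
      the factor 3 is 1 + 2 from \<open>?v + 2 * ?v^2\<close> with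
      \<open>?v^2 \<le> ?v\<close>.\<close>
    moreover have "(?u + ?v)\<^sup>2 \<le> 2 * ?u\<^sup>2 + 2 * ?v\<^sup>2"
      using sum_squares_bound[of ?u ?v] by (simp add: power2_eq_square algebra_simps)
    moreover have "?v\<^sup>2 \<le> ?v"
      unfolding power2_eq_square using mult_left_mono[OF le1(2)[OF j], of ?v] mu y[OF j] by simp
    moreover have "?u\<^sup>2 = 4 * \<mu>\<^sup>2 * (x j)\<^sup>2" by (simp add: power_mult_distrib)
    ultimately show "exp (?u + ?v) \<le> 1 + ?u + 3 * \<mu> * y j + 8 * \<mu>\<^sup>2 * (x j)\<^sup>2" by linarith
  qed
  also have "\<dots> = (\<Sum>j\<in>S. p j) + 2 * \<mu> * (\<Sum>j\<in>S. p j * x j) + 3 * \<mu> * (\<Sum>j\<in>S. p j * y j) + 8 * \<mu>\<^sup>2 * (\<Sum>j\<in>S. p j * (x j)\<^sup>2)"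
    unfolding sum_distrib_left sum.distrib[symmetric] by (intro sum.cong refl) (simp add: algebra_simps)
  also have "\<dots> \<le> 1 + 3 * \<mu> * t2 + 8 * \<mu>\<^sup>2 * (s2 * nv)"
    unfolding x0 p(2) using mult_left_mono[OF y1, of "3 * \<mu>"] mult_left_mono[OF x2, of "8 * \<mu>\<^sup>2"] mu by simp
  also have "\<dots> \<le> exp (3 * \<mu> * t2 + 8 * \<mu>\<^sup>2 * (s2 * nv))"
    using exp_ge_add_one_self[of "3 * \<mu> * t2 + 8 * \<mu>\<^sup>2 * (s2 * nv)"] by (simp only: add.assoc)
  finally have "exp (\<mu> * nv) * (\<Sum>j\<in>S. p j * exp (2 * \<mu> * x j + \<mu> * y j)) \<le>
      exp (\<mu> * nv) * exp (3 * \<mu> * t2 + 8 * \<mu>\<^sup>2 * (s2 * nv))" by (intro mult_left_mono) auto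
  then show ?thesis unfolding eq by (simp add: exp_add[symmetric] algebra_simps)
qed

lemma bn_add: "bn B (\<lambda>b i. v b i + w b i) b = bn B v b + 2 * Re (\<Sum>i<B. v b i * cnj (w b i)) + bn B w b"
proof -
  have "(cmod (x + y))\<^sup>2 = (cmod x)\<^sup>2 + 2 * Re (x * cnj y) + (cmod y)\<^sup>2" for x y
    unfolding cmod_power2 by (simp add: power2_eq_square algebra_simps)
  then show ?thesis by (simp add: bn_def sum.distrib sum_distrib_left)
qed

lemma cmod_sum_cnj_le: "cmod (\<Sum>i<B. v b i * cnj (w b i)) \<le> sqrt (bn B v b) * sqrt (bn B w b)"
proof -
  have "cmod (\<Sum>i<B. v b i * cnj (w b i)) \<le> (\<Sum>i<B. \<bar>cmod (v b i)\<bar> * \<bar>cmod (w b i)\<bar>)"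
    by (rule order_trans[OF norm_sum]) (simp add: norm_mult)
  also have "\<dots> \<le> sqrt (bn B v b) * sqrt (bn B w b)"
    unfolding sqrt_bn by (rule L2_set_mult_ineq)
  finally show ?thesis .
qed

lemma ex_le_weighted_sum:
  fixes p f :: "'a \<Rightarrow> real"
  assumes "finite S" "\<And>j. j \<in> S \<Longrightarrow> 0 \<le> p j" "(\<Sum>j\<in>S. p j) = 1" "(\<Sum>j\<in>S. p j * f j) \<le> c"
  shows "\<exists>j\<in>S. f j \<le> c"
proof (rule ccontr)
  assume "\<not> ?thesis"
  then have gt: "f j > c" if "j \<in> S" for j using that by force
  have "\<exists>j\<in>S. p j > 0"
  proof (rule ccontr)
    assume "\<not> ?thesis"
    then have "(\<Sum>j\<in>S. p j) \<le> 0" by (intro sum_nonpos) force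
    then show False using assms(3) by simp
  qed
  then obtain k where k: "k \<in> S" "p k > 0" by auto
  have "(\<Sum>j\<in>S. p j * c) < (\<Sum>j\<in>S. p j * f j)"
  proof (rule sum_strict_mono_ex1[OF assms(1)])
    show "\<forall>j\<in>S. p j * c \<le> p j * f j" using gt assms(2) by (meson less_imp_le mult_left_mono)
    show "\<exists>j\<in>S. p j * c < p j * f j" using k gt by (meson mult_strict_left_mono)
  qed
  then show False using assms(3,4) by (simp add: sum_distrib_right[symmetric])
qed

text \<open>Derandomised sampling by conditional expectations. The strong variance \<open>t2\<close>
  is compensated by \<open>6 * la * t2\<close> per step; \<open>s2\<close> is the weak variance.
  Since the mean of the potential over the next sample does not exceed its present value, some
  sample keeps it at most \<open>m\<close>. Each single term then bounds its block, and
  \<open>ln m\<close> is paid once for the whole run.\<close>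

lemma greedy_selection:
  fixes \<xi> :: "'a \<Rightarrow> nat \<Rightarrow> nat \<Rightarrow> complex" and p :: "'a \<Rightarrow> real"
  assumes fin: "finite S" and p: "\<And>j. j \<in> S \<Longrightarrow> 0 \<le> p j" "(\<Sum>j\<in>S. p j) = 1"
    and mean: "\<And>b i. b < m \<Longrightarrow> i < B \<Longrightarrow> (\<Sum>j\<in>S. complex_of_real (p j) * \<xi> j b i) = 0"
    and M: "\<And>j b. j \<in> S \<Longrightarrow> b < m \<Longrightarrow> bn B (\<xi> j) b \<le> M\<^sup>2"
    and t2: "\<And>b. b < m \<Longrightarrow> (\<Sum>j\<in>S. p j * bn B (\<xi> j) b) \<le> t2" "0 \<le> t2"
    and s2: "\<And>v b. b < m \<Longrightarrow> (\<Sum>j\<in>S. p j * (Re (\<Sum>i<B. v b i * cnj (\<xi> j b i)))\<^sup>2) \<le> s2 * bn B v b"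
    and la: "0 < la" and n: "0 < n" and m: "0 < m" "ln (real m) \<le> l"
    and D: "0 \<le> D" "0 \<le> M" "l + 6 * la * t2 * real n \<le> la * D\<^sup>2"
    and s2n: "0 \<le> s2" "32 * la * s2 * real n \<le> 1" and le1: "4 * la * (D * M) + 2 * la * M\<^sup>2 \<le> 1"
  shows "\<exists>J. (\<forall>t<n. J t \<in> S) \<and> (\<forall>b<m. bn B (\<lambda>b i. \<Sum>t<n. \<xi> (J t) b i) b \<le> D\<^sup>2)"
proof -
  \<comment> \<open>The exponent decreases from \<open>2 la\<close> to \<open>la\<close>; its decrease \<open>la / n\<close> per step absorbs the weak variance.\<close>
  define mu where "mu = (\<lambda>k. la * (2 - real k / real n))"
  define V where "V = (\<lambda>(J :: nat \<Rightarrow> 'a) (k :: nat) b i. \<Sum>t<k. \<xi> (J t) b i)"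
  define Pot where "Pot = (\<lambda>J k. \<Sum>b<m. exp (mu k * bn B (V J k) b - 6 * la * t2 * real k))"
  have mu_bounds: "la \<le> mu k" "mu k \<le> 2 * la" "0 \<le> mu k" if "k \<le> n" for k
  proof -
    have "real k / real n \<le> 1" "0 \<le> real k / real n" using that n by simp_all
    then have "la * 1 \<le> la * (2 - real k / real n)" "la * (2 - real k / real n) \<le> la * 2"
      using la by (intro mult_left_mono; simp)+
    then show "la \<le> mu k" "mu k \<le> 2 * la" "0 \<le> mu k" using la by (auto simp: mu_def)
  qed
  \<comment> \<open>Needed at every \<open>k\<close> and not only at the end: the bound
    \<open>D\<close> on the current partial sum keeps the exponents of the next step below
    1.\<close>
  have small: "bn B (V J k) b \<le> D\<^sup>2" if "Pot J k \<le> real m" "k \<le> n" "b < m" for J k b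
  proof -
    have "exp (mu k * bn B (V J k) b - 6 * la * t2 * real k) \<le> Pot J k"
      unfolding Pot_def using that by (intro member_le_sum[where f = "\<lambda>b. exp (mu k * bn B (V J k) b - 6 * la * t2 * real k)"]) auto
    also have "\<dots> \<le> exp (ln (real m))" using that m by simp
    finally have "mu k * bn B (V J k) b - 6 * la * t2 * real k \<le> l" using m(2) by simp
    moreover have "la * bn B (V J k) b \<le> mu k * bn B (V J k) b"
      using mu_bounds[OF that(2)] by (intro mult_right_mono) auto
    moreover have "6 * la * t2 * real k \<le> 6 * la * t2 * real n"
      using la t2(2) that(2) by (intro mult_left_mono) auto
    ultimately have "la * bn B (V J k) b \<le> la * D\<^sup>2" using D(3) by linarith
    then show ?thesis using la by simp
  qed
  have "k \<le> n \<Longrightarrow> \<exists>J. (\<forall>t<k. J t \<in> S) \<and> Pot J k \<le> real m" for k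
  proof (induction k)
    case 0
    then show ?case by (simp add: Pot_def V_def bn_def)
  next
    case (Suc k)
    then obtain J where J: "\<forall>t<k. J t \<in> S" "Pot J k \<le> real m" by auto
    let ?mu = "mu (Suc k)"
    define W where "W = V J k"
    define X where "X = (\<lambda>j b. Re (\<Sum>i<B. W b i * cnj (\<xi> j b i)))"
    have mub: "la \<le> ?mu" "?mu \<le> 2 * la" "0 \<le> ?mu" using mu_bounds[OF Suc.prems] .
    have muk: "?mu + 8 * ?mu\<^sup>2 * s2 \<le> mu k"
    proof -
      have "?mu\<^sup>2 \<le> (2 * la)\<^sup>2" using mub by (intro power_mono) auto
      then have "8 * ?mu\<^sup>2 * s2 \<le> 8 * (2 * la)\<^sup>2 * s2" using s2n(1) by (intro mult_right_mono) auto
      also have "\<dots> = la * (32 * la * s2 * real n) / real n" using n by (simp add: power2_eq_square)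
      also have "\<dots> \<le> la * 1 / real n" using s2n(2) la n by (intro divide_right_mono mult_left_mono) auto
      also have "\<dots> = mu k - ?mu" using n by (simp add: mu_def field_simps)
      finally show ?thesis by linarith
    qed
    have block: "(\<Sum>j\<in>S. p j * exp (?mu * (bn B W b + 2 * X j b + bn B (\<xi> j) b) - 6 * la * t2 * real (Suc k)))
        \<le> exp (mu k * bn B W b - 6 * la * t2 * real k)" if b: "b < m" for b
    proof -
      have W: "sqrt (bn B W b) \<le> D" using small[OF J(2) _ b] Suc.prems D(1) real_le_lsqrt by (simp add: W_def)
      have y: "?mu * bn B (\<xi> j) b \<le> 2 * la * M\<^sup>2" if "j \<in> S" for j
        using mub M[OF that b] by (intro mult_mono) auto
      have x: "2 * ?mu * X j b \<le> 4 * la * (D * M)" if "j \<in> S" for j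
      proof -
        have "X j b \<le> cmod (\<Sum>i<B. W b i * cnj (\<xi> j b i))" unfolding X_def by (rule complex_Re_le_cmod)
        also have "\<dots> \<le> sqrt (bn B W b) * sqrt (bn B (\<xi> j) b)" by (rule cmod_sum_cnj_le)
        also have "\<dots> \<le> D * M" using W M[OF that b] D real_le_lsqrt by (intro mult_mono) auto
        finally have "2 * ?mu * X j b \<le> 2 * ?mu * (D * M)" using mub by (intro mult_left_mono) auto
        also have "\<dots> \<le> 2 * (2 * la) * (D * M)" using mub D by (intro mult_right_mono mult_left_mono) auto
        finally show ?thesis by simp
      qed
      have X0: "(\<Sum>j\<in>S. p j * X j b) = 0"
      proof -
        have "(\<Sum>j\<in>S. \<Sum>i<B. W b i * cnj (complex_of_real (p j) * \<xi> j b i)) =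
            (\<Sum>i<B. W b i * cnj (\<Sum>j\<in>S. complex_of_real (p j) * \<xi> j b i))"
          unfolding cnj_sum sum_distrib_left by (rule sum.swap)
        then have "Re (\<Sum>j\<in>S. \<Sum>i<B. W b i * cnj (complex_of_real (p j) * \<xi> j b i)) = 0"
          using mean b by (simp del: cnj_sum)
        moreover have "(\<Sum>j\<in>S. p j * X j b) = Re (\<Sum>j\<in>S. \<Sum>i<B. W b i * cnj (complex_of_real (p j) * \<xi> j b i))"
          unfolding X_def Re_sum sum_distrib_left by (intro sum.cong refl) (simp add: algebra_simps)
        ultimately show ?thesis by simp
      qed
      have "(\<Sum>j\<in>S. p j * exp (?mu * (bn B W b + 2 * X j b + bn B (\<xi> j) b)))
          \<le> exp (3 * ?mu * t2 + (?mu + 8 * ?mu\<^sup>2 * s2) * bn B W b)"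
      proof (rule exp_moment_step[OF fin p])
        show "(\<Sum>j\<in>S. p j * X j b) = 0" by (rule X0)
        show "(\<Sum>j\<in>S. p j * (X j b)\<^sup>2) \<le> s2 * bn B W b" unfolding X_def by (rule s2[OF b])
        show "(\<Sum>j\<in>S. p j * bn B (\<xi> j) b) \<le> t2" by (rule t2(1)[OF b])
        show "2 * ?mu * X j b + ?mu * bn B (\<xi> j) b \<le> 1" if "j \<in> S" for j
          using x[OF that] y[OF that] le1 by linarith
        show "?mu * bn B (\<xi> j) b \<le> 1" if "j \<in> S" for j
        proof -
          have "0 \<le> 4 * la * (D * M)" using la D by simp
          then show ?thesis using y[OF that] le1 by linarith
        qed
      qed (use mub in auto)
      also have "\<dots> \<le> exp (6 * la * t2 + mu k * bn B W b)"
      proof -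
        have "3 * ?mu * t2 \<le> 3 * (2 * la) * t2" using mub t2(2) by (intro mult_right_mono) auto
        moreover have "(?mu + 8 * ?mu\<^sup>2 * s2) * bn B W b \<le> mu k * bn B W b" using muk by (intro mult_right_mono) auto
        ultimately have "3 * ?mu * t2 + (?mu + 8 * ?mu\<^sup>2 * s2) * bn B W b \<le> 6 * la * t2 + mu k * bn B W b"
          by linarith
        then show ?thesis by (simp only: exp_le_cancel_iff)
      qed
      finally have *: "(\<Sum>j\<in>S. p j * exp (?mu * (bn B W b + 2 * X j b + bn B (\<xi> j) b))) \<le> exp (6 * la * t2 + mu k * bn B W b)" .
      have "(\<Sum>j\<in>S. p j * exp (?mu * (bn B W b + 2 * X j b + bn B (\<xi> j) b) - 6 * la * t2 * real (Suc k))) =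
          exp (- 6 * la * t2 * real (Suc k)) * (\<Sum>j\<in>S. p j * exp (?mu * (bn B W b + 2 * X j b + bn B (\<xi> j) b)))"
        unfolding sum_distrib_left by (intro sum.cong refl) (simp add: exp_add[symmetric] mult.left_commute[of "p _"])
      also have "\<dots> \<le> exp (- 6 * la * t2 * real (Suc k)) * exp (6 * la * t2 + mu k * bn B W b)"
        using * by (intro mult_left_mono) auto
      also have "\<dots> = exp (mu k * bn B W b - 6 * la * t2 * real k)"
        by (simp add: exp_add[symmetric] algebra_simps)
      finally show ?thesis .
    qed
    \<comment> \<open>The value that the potential takes if sample \<open>j\<close> is
      appended.\<close>
    define Pj where "Pj = (\<lambda>j. \<Sum>b<m. exp (?mu * (bn B W b + 2 * X j b + bn B (\<xi> j) b) - 6 * la * t2 * real (Suc k)))"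
    have "(\<Sum>j\<in>S. p j * Pj j) = (\<Sum>b<m. \<Sum>j\<in>S. p j * exp (?mu * (bn B W b + 2 * X j b + bn B (\<xi> j) b) - 6 * la * t2 * real (Suc k)))"
      unfolding Pj_def sum_distrib_left by (rule sum.swap)
    also have "\<dots> \<le> Pot J k" unfolding Pot_def W_def[symmetric] by (intro sum_mono block) simp
    finally have "(\<Sum>j\<in>S. p j * Pj j) \<le> real m" using J(2) by linarith
    then obtain j where j: "j \<in> S" "Pj j \<le> real m" using ex_le_weighted_sum[OF fin p] by blast
    have V': "V (J(k := j)) (Suc k) = (\<lambda>b i. W b i + \<xi> j b i)" by (simp add: V_def W_def fun_eq_iff)
    have "Pot (J(k := j)) (Suc k) = Pj j"
      unfolding Pot_def Pj_def V' bn_add X_def ..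
    then have "Pot (J(k := j)) (Suc k) \<le> real m" using j by simp
    moreover have "\<forall>t<Suc k. (J(k := j)) t \<in> S" using J(1) j(1) by (simp add: less_Suc_eq)
    ultimately show ?case by blast
  qed
  from this[OF order_refl] obtain J where "\<forall>t<n. J t \<in> S" "Pot J n \<le> real m" by blast
  then show ?thesis using small[of J n] unfolding V_def by blast
qed

section \<open>Nets for sparse vectors\<close>

text \<open>The set T_k with vectors as functions that vanish from \<open>d\<close> on; sums over
  supports then need no dimension bookkeeping. The translation to vectors is
  \<open>vfun\<close>.\<close>

definition sparse_ball :: "nat \<Rightarrow> nat \<Rightarrow> (nat \<Rightarrow> complex) set" where
  "sparse_ball d k = {x. (\<forall>j. x j \<noteq> 0 \<longrightarrow> j < d) \<and> card {j. x j \<noteq> 0} \<le> k \<and> (\<Sum>j<d. (cmod (x j))\<^sup>2) \<le> 1}"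

definition app :: "nat \<Rightarrow> (nat \<Rightarrow> nat \<Rightarrow> nat \<Rightarrow> complex) \<Rightarrow> (nat \<Rightarrow> complex) \<Rightarrow> nat \<Rightarrow> nat \<Rightarrow> complex" where
  "app d a x b i = (\<Sum>j<d. a b i j * x j)"

text \<open>Centres may lie outside \<open>V\<close>, as images of rounded vectors do;
  \<open>covers_selection\<close> moves them into \<open>V\<close>.\<close>

definition covers :: "nat \<Rightarrow> nat \<Rightarrow> (nat \<Rightarrow> nat \<Rightarrow> complex) set \<Rightarrow> nat \<Rightarrow> real \<Rightarrow> bool" where
  "covers m B V N u \<longleftrightarrow> (\<exists>C. finite C \<and> card C \<le> N \<and> (\<forall>v\<in>V. \<exists>c\<in>C. near m B u v c))"

text \<open>A centre is determined by \<open>n\<close> triples, each an index and two integers,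
  which gives the count.\<close>

lemma covers_lattice:
  fixes h :: real and r :: nat
  assumes "\<And>v. v \<in> V \<Longrightarrow> \<exists>J P Q. (\<forall>t<n. J t < d \<and> \<bar>P t\<bar> \<le> int r \<and> \<bar>Q t\<bar> \<le> int r) \<and>
    near m B u v (\<lambda>b i. complex_of_real h * (\<Sum>t<n. a b i (J t) * Complex (real_of_int (P t)) (real_of_int (Q t))))"
  shows "covers m B V ((d * (2 * r + 1)\<^sup>2) ^ n) u"
proof -
  define G where "G = {..<d} \<times> {- int r..int r} \<times> {- int r..int r}"
  define cen where "cen = (\<lambda>xs b i. complex_of_real h * (\<Sum>t<n. a b i (fst (xs ! t)) *
      Complex (real_of_int (fst (snd (xs ! t)))) (real_of_int (snd (snd (xs ! t))))))"
  define Ls where "Ls = {xs. set xs \<subseteq> G \<and> length xs = n}"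
  have finG: "finite G" by (simp add: G_def)
  have cardG: "card G = d * (2 * r + 1)\<^sup>2" by (simp add: G_def card_cartesian_product power2_eq_square nat_add_distrib nat_mult_distrib)
  have Ls: "finite Ls" "card Ls = (d * (2 * r + 1)\<^sup>2) ^ n"
    unfolding Ls_def using finite_lists_length_eq[OF finG] card_lists_length_eq[OF finG] by (simp_all add: cardG)
  show ?thesis unfolding covers_def
  proof (intro exI[of _ "cen ` Ls"] conjI ballI)
    show "finite (cen ` Ls)" using Ls by simp
    show "card (cen ` Ls) \<le> (d * (2 * r + 1)\<^sup>2) ^ n" using card_image_le[OF Ls(1), of cen] Ls(2) by simp
    fix v assume "v \<in> V"
    then obtain J P Q where J: "\<forall>t<n. J t < d \<and> \<bar>P t\<bar> \<le> int r \<and> \<bar>Q t\<bar> \<le> int r"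
      and near: "near m B u v (\<lambda>b i. complex_of_real h * (\<Sum>t<n. a b i (J t) * Complex (real_of_int (P t)) (real_of_int (Q t))))"
      using assms by blast
    define xs where "xs = map (\<lambda>t. (J t, P t, Q t)) [0..<n]"
    have "xs \<in> Ls" using J by (auto simp: Ls_def xs_def G_def abs_le_iff)
    moreover have "cen xs = (\<lambda>b i. complex_of_real h * (\<Sum>t<n. a b i (J t) * Complex (real_of_int (P t)) (real_of_int (Q t))))"
      by (simp add: cen_def xs_def)
    ultimately show "\<exists>c\<in>cen ` Ls. near m B u v c" using near by (metis imageI)
  qed
qed

lemma floor_complex:
  fixes w :: complex and r :: nat
  assumes "cmod w \<le> real r"
  shows "\<bar>\<lfloor>Re w\<rfloor>\<bar> \<le> int r" "\<bar>\<lfloor>Im w\<rfloor>\<bar> \<le> int r"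
    "cmod (w - Complex (real_of_int \<lfloor>Re w\<rfloor>) (real_of_int \<lfloor>Im w\<rfloor>)) \<le> 2"
proof -
  have "\<bar>Re w\<bar> \<le> real r" "\<bar>Im w\<bar> \<le> real r"
    using abs_Re_le_cmod[of w] abs_Im_le_cmod[of w] assms by linarith+
  then have "- real r \<le> Re w" "Re w \<le> real r" "- real r \<le> Im w" "Im w \<le> real r" by linarith+
  then show "\<bar>\<lfloor>Re w\<rfloor>\<bar> \<le> int r" "\<bar>\<lfloor>Im w\<rfloor>\<bar> \<le> int r" by linarith+
  have "\<bar>Re w - real_of_int \<lfloor>Re w\<rfloor>\<bar> \<le> 1" "\<bar>Im w - real_of_int \<lfloor>Im w\<rfloor>\<bar> \<le> 1" by linarith+
  then show "cmod (w - Complex (real_of_int \<lfloor>Re w\<rfloor>) (real_of_int \<lfloor>Im w\<rfloor>)) \<le> 2"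
    using cmod_le[of "w - Complex (real_of_int \<lfloor>Re w\<rfloor>) (real_of_int \<lfloor>Im w\<rfloor>)"] by simp
qed

lemma sqrt_bn_le_entries:
  assumes "\<And>i. i < B \<Longrightarrow> cmod (v b i) \<le> c" "0 \<le> c"
  shows "sqrt (bn B v b) \<le> c * sqrt (real B)"
proof -
  have "bn B v b \<le> (\<Sum>i<B. c\<^sup>2)"
    unfolding bn_def using assms by (intro sum_mono power_mono) auto
  then have "sqrt (bn B v b) \<le> sqrt (c\<^sup>2 * real B)" by (simp add: mult.commute)
  then show ?thesis using assms(2) by (simp add: real_sqrt_mult)
qed

lemma sqrt_bn_cmult: "sqrt (bn B (\<lambda>b i. complex_of_real h * v b i) b) = \<bar>h\<bar> * sqrt (bn B v b)"
  unfolding sqrt_bn by (simp add: norm_mult L2_set_right_distrib)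

lemma sparse_ball_support:
  assumes "x \<in> sparse_ball d k"
  shows "finite {j. x j \<noteq> 0}" "{j. x j \<noteq> 0} \<subseteq> {..<d}" "card {j. x j \<noteq> 0} \<le> min k d"
proof -
  show *: "{j. x j \<noteq> 0} \<subseteq> {..<d}" using assms by (auto simp: sparse_ball_def)
  then show "finite {j. x j \<noteq> 0}" by (rule finite_subset) simp
  show "card {j. x j \<noteq> 0} \<le> min k d"
    using card_mono[OF _ *] assms by (simp add: sparse_ball_def)
qed

lemma sparse_ball_coord:
  assumes "x \<in> sparse_ball d k" shows "cmod (x j) \<le> 1"
proof (cases "j < d")
  case True
  have "(cmod (x j))\<^sup>2 \<le> (\<Sum>j<d. (cmod (x j))\<^sup>2)" using True by (intro member_le_sum) auto
  also have "\<dots> \<le> 1" using assms by (simp add: sparse_ball_def)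
  finally show ?thesis by (simp add: power2_le_imp_le power_le_one_iff abs_square_le_1)
next
  case False
  then have "x j = 0" using sparse_ball_support(2)[OF assms] by auto
  then show ?thesis by simp
qed

lemma app_eq_sum_on:
  assumes "{j. x j \<noteq> 0} \<subseteq> S" "S \<subseteq> {..<d}"
  shows "app d a x b i = (\<Sum>j\<in>S. a b i j * x j)"
  unfolding app_def using assms by (intro sum.mono_neutral_right) auto

lemma sum_norm_le_sqrt_card:
  assumes "finite S" "(\<Sum>j\<in>S. (cmod (x j))\<^sup>2) \<le> 1"
  shows "(\<Sum>j\<in>S. cmod (x j)) \<le> sqrt (real (card S))"
proof -
  have "(\<Sum>j\<in>S. \<bar>cmod (x j)\<bar> * \<bar>1\<bar>) \<le> L2_set (\<lambda>j. cmod (x j)) S * L2_set (\<lambda>j. 1) S"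
    by (rule L2_set_mult_ineq)
  also have "\<dots> \<le> 1 * sqrt (real (card S))"
    using assms by (intro mult_mono) (auto simp: L2_set_def sum_nonneg)
  finally show ?thesis by simp
qed

lemma app_entry_le:
  assumes "x \<in> sparse_ball d k" "\<And>j. j < d \<Longrightarrow> cmod (a b i j) \<le> 1"
  shows "cmod (app d a x b i) \<le> sqrt (real (min k d))"
proof -
  let ?S = "{j. x j \<noteq> 0}"
  note S = sparse_ball_support[OF assms(1)]
  have "cmod (app d a x b i) \<le> (\<Sum>j\<in>?S. cmod (a b i j) * cmod (x j))"
    unfolding app_eq_sum_on[OF order_refl S(2)] by (rule order_trans[OF norm_sum]) (simp add: norm_mult)
  also have "\<dots> \<le> (\<Sum>j\<in>?S. 1 * cmod (x j))"
    using assms(2) S(2) by (intro sum_mono mult_right_mono) auto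
  also have "\<dots> \<le> sqrt (real (card ?S))"
  proof -
    have "(\<Sum>j\<in>?S. (cmod (x j))\<^sup>2) \<le> (\<Sum>j<d. (cmod (x j))\<^sup>2)" using S by (intro sum_mono2) auto
    also have "\<dots> \<le> 1" using assms(1) by (simp add: sparse_ball_def)
    finally show ?thesis using sum_norm_le_sqrt_card[OF S(1)] by simp
  qed
  also have "\<dots> \<le> sqrt (real (min k d))" using S(3) by (simp only: real_sqrt_le_iff of_nat_le_iff)
  finally show ?thesis .
qed

text \<open>Fine scales. Rounding each of at most \<open>min k d\<close> coordinates to mesh
  \<open>1 / (min k d * 4 ^ e)\<close> changes a row value by at most \<open>2 / 4 ^ e\<close>,
  because the entries have modulus at most 1. With \<open>min k d\<close> in place of
  \<open>k\<close> the integers are at most \<open>d * 4 ^ e\<close>, so the count is governed by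
  \<open>d\<close> even if \<open>k\<close> exceeds \<open>d\<close>.\<close>

lemma covers_grid:
  assumes a: "\<And>b i j. b < m \<Longrightarrow> i < B \<Longrightarrow> j < d \<Longrightarrow> cmod (a b i j) \<le> 1" and k: "0 < k" "0 < d"
  shows "covers m B (app d a ` sparse_ball d k) ((d * (2 * (d * 4 ^ e) + 1)\<^sup>2) ^ min k d) (2 * sqrt (real B) / 4 ^ e)"
proof (rule covers_lattice[where h = "1 / (real (min k d) * 4 ^ e)" and a = a])
  let ?s = "min k d" and ?h = "1 / (real (min k d) * 4 ^ e)"
  fix v assume "v \<in> app d a ` sparse_ball d k"
  then obtain x where x: "x \<in> sparse_ball d k" and v: "v = app d a x" by blast
  let ?S = "{j. x j \<noteq> 0}"
  note S = sparse_ball_support[OF x]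
  have s: "real ?s > 0" using k by simp
  have h: "?h > 0" using s by simp
  obtain f where f: "bij_betw f {0..<card ?S} ?S" using ex_bij_betw_nat_finite[OF S(1)] by blast
  define w where "w = (\<lambda>j. x j / complex_of_real ?h)"
  have w: "cmod (w j) \<le> real (d * 4 ^ e)" for j
  proof -
    have "cmod (w j) = cmod (x j) / ?h" unfolding w_def norm_divide norm_of_real abs_of_pos[OF h] ..
    also have "\<dots> = cmod (x j) * (real ?s * 4 ^ e)" by simp
    also have "\<dots> \<le> 1 * (real d * 4 ^ e)" 
      using sparse_ball_coord[OF x] by (intro mult_mono mult_right_mono) auto
    finally show ?thesis by simp
  qed
  define g where "g = (\<lambda>j. Complex (real_of_int \<lfloor>Re (w j)\<rfloor>) (real_of_int \<lfloor>Im (w j)\<rfloor>))"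
  \<comment> \<open>The support is padded to exactly \<open>?s\<close> terms by zero multiples of
    column 0, which exists since \<open>0 < d\<close>.\<close>
  define J where "J = (\<lambda>t. if t < card ?S then f t else 0)"
  define P where "P = (\<lambda>t. if t < card ?S then \<lfloor>Re (w (f t))\<rfloor> else 0)"
  define Q where "Q = (\<lambda>t. if t < card ?S then \<lfloor>Im (w (f t))\<rfloor> else 0)"
  have fS: "f t \<in> ?S" if "t < card ?S" for t using bij_betwE[OF f] that by auto
  have J: "J t < d \<and> \<bar>P t\<bar> \<le> int (d * 4 ^ e) \<and> \<bar>Q t\<bar> \<le> int (d * 4 ^ e)" for t
    using floor_complex(1,2)[OF w] fS S(2) k(2) by (auto simp: J_def P_def Q_def)
  have cen: "(\<Sum>t<?s. a b i (J t) * Complex (real_of_int (P t)) (real_of_int (Q t))) = (\<Sum>j\<in>?S. a b i j * g j)" for b i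
  proof -
    have "(\<Sum>t<?s. a b i (J t) * Complex (real_of_int (P t)) (real_of_int (Q t))) =
        (\<Sum>t\<in>{0..<card ?S}. a b i (J t) * Complex (real_of_int (P t)) (real_of_int (Q t)))"
      using S(3) by (intro sum.mono_neutral_right) (auto simp: P_def Q_def complex_eq_iff)
    also have "\<dots> = (\<Sum>t\<in>{0..<card ?S}. a b i (f t) * g (f t))"
      by (intro sum.cong refl) (simp add: J_def P_def Q_def g_def)
    also have "\<dots> = (\<Sum>j\<in>?S. a b i j * g j)" using sum.reindex_bij_betw[OF f, of "\<lambda>j. a b i j * g j"] .
    finally show ?thesis .
  qed
  have "near m B (2 * sqrt (real B) / 4 ^ e) v (\<lambda>b i. complex_of_real ?h * (\<Sum>t<?s. a b i (J t) * Complex (real_of_int (P t)) (real_of_int (Q t))))"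
    unfolding near_def
  proof (intro allI impI)
    fix b assume b: "b < m"
    have "sqrt (bn B (\<lambda>b i. v b i - complex_of_real ?h * (\<Sum>t<?s. a b i (J t) * Complex (real_of_int (P t)) (real_of_int (Q t)))) b)
        \<le> (2 / 4 ^ e) * sqrt (real B)"
    proof (rule sqrt_bn_le_entries)
      fix i assume i: "i < B"
      have "complex_of_real ?h \<noteq> 0" using h by (simp only: of_real_eq_0_iff)
      then have "x j = complex_of_real ?h * w j" for j
        unfolding w_def times_divide_eq_right by (rule nonzero_mult_div_cancel_left[symmetric])
      then have "v b i - complex_of_real ?h * (\<Sum>j\<in>?S. a b i j * g j) = (\<Sum>j\<in>?S. complex_of_real ?h * (a b i j * (w j - g j)))"
        unfolding v app_eq_sum_on[OF order_refl S(2)] sum_distrib_left sum_subtractf[symmetric]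
        by (intro sum.cong refl) (simp add: algebra_simps)
      then have "cmod (v b i - complex_of_real ?h * (\<Sum>j\<in>?S. a b i j * g j)) \<le> (\<Sum>j\<in>?S. ?h * 2)"
      proof (simp only:, intro order_trans[OF norm_sum] sum_mono)
        fix j assume "j \<in> ?S"
        then have "cmod (a b i j) * cmod (w j - g j) \<le> 1 * 2"
          using floor_complex(3)[OF w, of j] a[OF b i] S(2) by (intro mult_mono) (auto simp: g_def)
        then have "?h * (cmod (a b i j) * cmod (w j - g j)) \<le> ?h * (1 * 2)" using h by (intro mult_left_mono) auto
        then show "cmod (complex_of_real ?h * (a b i j * (w j - g j))) \<le> ?h * 2"
          unfolding norm_mult norm_of_real abs_of_pos[OF h] by simp
      qed
      also have "\<dots> = real (card ?S) * (?h * 2)" by simp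
      also have "\<dots> \<le> real ?s * (?h * 2)" using S(3) h by (intro mult_right_mono) simp_all
      also have "\<dots> = 2 / 4 ^ e" using s by simp
      finally show "cmod (v b i - complex_of_real ?h * (\<Sum>t<?s. a b i (J t) * Complex (real_of_int (P t)) (real_of_int (Q t)))) \<le> 2 / 4 ^ e"
        unfolding cen .
    qed simp
    then show "sqrt (bn B (\<lambda>b i. v b i - complex_of_real ?h * (\<Sum>t<?s. a b i (J t) * Complex (real_of_int (P t)) (real_of_int (Q t)))) b)
        \<le> 2 * sqrt (real B) / 4 ^ e" by simp
  qed
  then show "\<exists>J P Q. (\<forall>t<?s. J t < d \<and> \<bar>P t\<bar> \<le> int (d * 4 ^ e) \<and> \<bar>Q t\<bar> \<le> int (d * 4 ^ e)) \<and>
    near m B (2 * sqrt (real B) / 4 ^ e) v (\<lambda>b i. complex_of_real ?h * (\<Sum>t<?s. a b i (J t) * Complex (real_of_int (P t)) (real_of_int (Q t))))"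
    using J by blast
qed

section \<open>Nets by sampling\<close>

lemma weighted_variance_le:
  fixes p f :: "'a \<Rightarrow> real"
  assumes "(\<Sum>j\<in>S. p j) = 1" "\<mu> = (\<Sum>j\<in>S. p j * f j)"
  shows "(\<Sum>j\<in>S. p j * (f j - \<mu>)\<^sup>2) \<le> (\<Sum>j\<in>S. p j * (f j)\<^sup>2)"
proof -
  have "(\<Sum>j\<in>S. p j * (f j - \<mu>)\<^sup>2) = (\<Sum>j\<in>S. p j * (f j)\<^sup>2) - 2 * \<mu> * (\<Sum>j\<in>S. p j * f j) + \<mu>\<^sup>2 * (\<Sum>j\<in>S. p j)"
    unfolding sum_distrib_left sum.distrib[symmetric] sum_subtractf[symmetric]
    by (intro sum.cong refl) (simp add: power2_eq_square algebra_simps)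
  also have "\<dots> = (\<Sum>j\<in>S. p j * (f j)\<^sup>2) - \<mu>\<^sup>2"
    unfolding assms(1) assms(2)[symmetric] by (simp add: power2_eq_square)
  finally show ?thesis by simp
qed

text \<open>The homogeneous form of the bound \<open>R\<close>, for a test vector of arbitrary
  norm.\<close>

lemma bn_app_scaled:
  assumes R: "\<And>y. y \<in> sparse_ball d k \<Longrightarrow> sqrt (bn B (app d a y) b) \<le> R"
    and y: "{j. y j \<noteq> 0} \<subseteq> S" "S \<subseteq> {..<d}" "card S \<le> k"
  shows "sqrt (bn B (app d a y) b) \<le> R * sqrt (\<Sum>j\<in>S. (cmod (y j))\<^sup>2)"
proof -
  let ?n = "sqrt (\<Sum>j\<in>S. (cmod (y j))\<^sup>2)"
  have finS: "finite S" using y(2) finite_subset by blast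
  show ?thesis
  proof (cases "?n = 0")
    case True
    then have "y j = 0" if "j \<in> S" for j using that finS by (simp add: sum_nonneg_eq_0_iff)
    then have "y = (\<lambda>j. 0)" using y(1) by blast
    then have "sqrt (bn B (app d a y) b) = 0" by (simp add: app_def bn_def)
    then show ?thesis using True by simp
  next
    case False
    then have n: "?n > 0" by (simp add: sum_nonneg less_le)
    define z where "z = (\<lambda>j. y j / complex_of_real ?n)"
    have "z \<in> sparse_ball d k"
      unfolding sparse_ball_def
    proof (intro CollectI conjI allI impI)
      have zS: "{j. z j \<noteq> 0} \<subseteq> S" using y(1) by (auto simp: z_def)
      then show "j < d" if "z j \<noteq> 0" for j using that y(2) by auto
      show "card {j. z j \<noteq> 0} \<le> k" using card_mono[OF finS zS] y(3) by simp
      have "(\<Sum>j<d. (cmod (z j))\<^sup>2) = (\<Sum>j\<in>S. (cmod (z j))\<^sup>2)"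
        using zS y(2) by (intro sum.mono_neutral_right) auto
      also have "\<dots> = (\<Sum>j\<in>S. (cmod (y j))\<^sup>2) / ?n\<^sup>2"
        unfolding z_def norm_divide norm_of_real power_divide power2_abs sum_divide_distrib ..
      also have "\<dots> = 1" using n by (simp add: sum_nonneg)
      finally show "(\<Sum>j<d. (cmod (z j))\<^sup>2) \<le> 1" by simp
    qed
    then have "sqrt (bn B (app d a z) b) \<le> R" by (rule R)
    moreover have "app d a y = (\<lambda>b i. complex_of_real ?n * app d a z b i)"
      using n by (simp add: app_def z_def sum_distrib_left fun_eq_iff)
    then have "sqrt (bn B (app d a y) b) = ?n * sqrt (bn B (app d a z) b)"
      using n by (simp only: sqrt_bn_cmult abs_of_pos)
    ultimately show ?thesis using n by (simp add: mult.commute)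
  qed
qed

text \<open>
  Sampling \<open>j\<close> with probability \<open>p j\<close> and weight \<open>x j / p j\<close> is unbiased. Mixing \<open>|x j|\<^sup>2\<close> with the uniform
  distribution bounds both the weights and the weak variance, although \<open>x\<close> need not be flat.
\<close>

lemma exists_weights:
  assumes x: "x \<in> sparse_ball d k" and k: "0 < k" "0 < d"
  obtains S p where "finite S" "{j. x j \<noteq> 0} \<subseteq> S" "S \<subseteq> {..<d}" "card S = min k d"
    "\<And>j. j \<in> S \<Longrightarrow> 0 < p j" "(\<Sum>j\<in>S. p j) = (1::real)"
    "\<And>j. j \<in> S \<Longrightarrow> (cmod (x j))\<^sup>2 \<le> 2 * p j" "\<And>j. j \<in> S \<Longrightarrow> cmod (x j) \<le> p j * sqrt (real (min k d))"
proof -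
  let ?s = "min k d"
  note supp = sparse_ball_support[OF x]
  obtain S where S: "{j. x j \<noteq> 0} \<subseteq> S" "S \<subseteq> {..<d}" "card S = ?s"
    using exists_subset_between[of "{j. x j \<noteq> 0}" ?s "{..<d}"] supp by auto
  have finS: "finite S" using S(2) finite_subset by blast
  have s: "real ?s > 0" using k by simp
  define N2 where "N2 = (\<Sum>j\<in>S. (cmod (x j))\<^sup>2)"
  have "N2 \<le> (\<Sum>j<d. (cmod (x j))\<^sup>2)" unfolding N2_def using S(2) by (intro sum_mono2) auto
  then have N2: "N2 \<le> 1" using x by (simp add: sparse_ball_def)
  \<comment> \<open>The uniform share that completes half of \<open>|x j|^2\<close> to total mass 1;
    it is at least \<open>1 / (2 * ?s)\<close> because \<open>N2 \<le> 1\<close>.\<close>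
  define q where "q = (1 - N2 / 2) / real ?s"
  define p where "p = (\<lambda>j. (cmod (x j))\<^sup>2 / 2 + q)"
  have q: "q \<ge> 1 / (2 * real ?s)"
  proof -
    have "(1 / 2) / real ?s \<le> q" unfolding q_def using N2 s by (intro divide_right_mono) auto
    then show ?thesis by simp
  qed
  have q0: "q > 0" using q s by (meson less_le_trans zero_less_divide_1_iff mult_pos_pos zero_less_numeral)
  show ?thesis
  proof (rule that[OF finS S])
    show "0 < p j" for j using q0 by (simp add: p_def add_nonneg_pos)
    have "(\<Sum>j\<in>S. p j) = N2 / 2 + real ?s * q"
      by (simp add: p_def N2_def sum.distrib sum_divide_distrib S(3))
    then show "(\<Sum>j\<in>S. p j) = 1" using s by (simp add: q_def)
    show "(cmod (x j))\<^sup>2 \<le> 2 * p j" for j using q0 by (simp add: p_def)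
    show "cmod (x j) \<le> p j * sqrt (real ?s)" for j
    proof -
      define r where "r = sqrt (real ?s)"
      have r: "r > 0" "r\<^sup>2 = real ?s" using s by (auto simp: r_def)
      \<comment> \<open>The inequality of arithmetic and geometric mean for \<open>|x j|\<close> and
        \<open>1 / r\<close>: the two parts of \<open>p j\<close> together dominate
        \<open>|x j| / r\<close>.\<close>
      have "0 \<le> (cmod (x j) - 1 / r)\<^sup>2" by simp
      then have "2 * (cmod (x j) / r) \<le> (cmod (x j))\<^sup>2 + 1 / r\<^sup>2"
        by (simp add: power2_diff power_divide)
      also have "\<dots> \<le> 2 * p j" using q unfolding p_def r(2) by simp
      finally have "cmod (x j) / r \<le> p j" by simp
      then show ?thesis unfolding r_def[symmetric] using r(1) by (simp add: divide_le_eq)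
    qed
  qed
qed

text \<open>Maurey's empirical method in all \<open>m\<close> blocks at once. The image of
  \<open>x\<close> is the mean of the atoms \<open>w j * a b i j\<close>; the greedy selection finds
  \<open>n\<close> of them whose average is close in every block, and rounding the weights makes the
  net finite. The constant 19 is 17, from \<open>sqrt 280\<close>, for sampling plus 2 for
  rounding.\<close>

lemma covers_sampling:
  fixes R l :: real
  assumes a: "\<And>b i j. b < m \<Longrightarrow> i < B \<Longrightarrow> j < d \<Longrightarrow> cmod (a b i j) \<le> 1"
    and pos: "0 < k" "0 < d" "0 < m" "0 < B"
    and R: "\<And>y b. y \<in> sparse_ball d k \<Longrightarrow> b < m \<Longrightarrow> sqrt (bn B (app d a y) b) \<le> R"
    and l: "1 \<le> l" "ln (real m) \<le> l" "R\<^sup>2 * l\<^sup>2 \<le> 4 * real k * real B"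
    and n: "l\<^sup>2 \<le> real n" "n \<le> k"
  shows "covers m B (app d a ` sparse_ball d k) ((d * (2 * d + 1)\<^sup>2) ^ n) (19 * sqrt (real k * real B / real n))"
proof (rule covers_lattice[where h = "1 / real n" and a = a])
  fix v assume "v \<in> app d a ` sparse_ball d k"
  then obtain x where x: "x \<in> sparse_ball d k" and v: "v = app d a x" by blast
  let ?s = "min k d"
  obtain S p where S: "finite S" "{j. x j \<noteq> 0} \<subseteq> S" "S \<subseteq> {..<d}" "card S = ?s"
    and p: "\<And>j. j \<in> S \<Longrightarrow> 0 < p j" "(\<Sum>j\<in>S. p j) = (1::real)"
    and px: "\<And>j. j \<in> S \<Longrightarrow> (cmod (x j))\<^sup>2 \<le> 2 * p j" "\<And>j. j \<in> S \<Longrightarrow> cmod (x j) \<le> p j * sqrt (real ?s)"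
    using exists_weights[OF x pos(1,2)] by blast
  have n1: "1 \<le> real n" using n(1) l(1) by (meson one_le_power order_trans)
  then have n0: "0 < n" by simp
  define K where "K = real k * real B"
  have K: "K > 0" using pos by (simp add: K_def)
  define w where "w = (\<lambda>j. x j / complex_of_real (p j))"
  define atm where "atm = (\<lambda>j b i. w j * a b i j)"
  define xi where "xi = (\<lambda>j b i. atm j b i - app d a x b i)"
  have wp: "complex_of_real (p j) * w j = x j" if "j \<in> S" for j using p(1)[OF that] by (simp add: w_def)
  have w_le: "cmod (w j) \<le> sqrt (real ?s)" if "j \<in> S" for j
    using px(2)[OF that] p(1)[OF that] by (simp add: w_def norm_divide divide_le_eq mult.commute)
  have wd: "cmod (w j) \<le> real d" if "j \<in> S" for j
  proof -
    have "sqrt (real ?s) \<le> sqrt ((real d)\<^sup>2)"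
      using pos(2) by (intro real_sqrt_le_mono) (simp add: power2_eq_square min_le_iff_disj le_square flip: of_nat_mult)
    then show ?thesis using w_le[OF that] by simp
  qed
  have wp2: "p j * (cmod (w j))\<^sup>2 \<le> 2" if "j \<in> S" for j
    using px(1)[OF that] p(1)[OF that]
    by (simp add: w_def norm_divide power_divide power2_eq_square field_simps)
  have appx: "app d a x b i = (\<Sum>j\<in>S. complex_of_real (p j) * atm j b i)" for b i
    unfolding app_eq_sum_on[OF S(2,3)]
    by (intro sum.cong refl) (simp add: atm_def wp[symmetric] mult_ac)
  have p1: "(\<Sum>j\<in>S. complex_of_real (p j)) = 1" using p(2) by (metis of_real_1 of_real_sum)
  define M where "M = 2 * sqrt K"
  \<comment> \<open>A balance with the next line: \<open>l / la\<close> is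
    \<open>256 * n * K\<close>, the strong variance adds \<open>6 * M^2 * n = 24 * n * K\<close>,
    and the sum is \<open>D^2\<close>.\<close>
  define D where "D = sqrt (280 * real n * K)"
  define la where "la = l / (256 * real n * K)"
  have M2: "M\<^sup>2 = 4 * K" using K by (simp add: M_def power_mult_distrib)
  have D2: "D\<^sup>2 = 280 * real n * K" using K by (simp add: D_def)
  have la: "la > 0" using l(1) n0 K by (simp add: la_def)
  have xiM: "bn B (xi j) b \<le> M\<^sup>2" if j: "j \<in> S" and b: "b < m" for j b
  proof -
    have "sqrt (bn B (xi j) b) \<le> (2 * sqrt (real ?s)) * sqrt (real B)"
    proof (rule sqrt_bn_le_entries)
      fix i assume i: "i < B"
      have "cmod (atm j b i) \<le> sqrt (real ?s) * 1" unfolding atm_def norm_mult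
        using w_le[OF j] a[OF b i] j S(3) by (intro mult_mono) auto
      moreover have "cmod (app d a x b i) \<le> sqrt (real ?s)" by (rule app_entry_le[where k = k]) (use x a[OF b i] in auto)
      ultimately show "cmod (xi j b i) \<le> 2 * sqrt (real ?s)"
        unfolding xi_def using norm_triangle_ineq4[of "atm j b i" "app d a x b i"] by linarith
    qed simp
    also have "\<dots> \<le> (2 * sqrt (real k)) * sqrt (real B)" by (intro mult_right_mono mult_left_mono) auto
    also have "\<dots> = M" by (simp add: M_def K_def real_sqrt_mult)
    finally show ?thesis by (rule sqrt_le_D)
  qed
  \<comment> \<open>A sample may have squared block norm of order \<open>K\<close>, but in a fixed
    direction \<open>u\<close> the second moment is governed by the operator bound
    \<open>R\<close>.\<close>
  have weak: "(\<Sum>j\<in>S. p j * (Re (\<Sum>i<B. u b i * cnj (xi j b i)))\<^sup>2) \<le> (2 * R\<^sup>2) * bn B u b" if b: "b < m" for u b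
  proof -
    define c where "c = (\<lambda>j. if j \<in> S then \<Sum>i<B. u b i * cnj (a b i j) else 0)"
    define f where "f = (\<lambda>j. Re (cnj (w j) * c j))"
    define \<mu> where "\<mu> = (\<Sum>j\<in>S. p j * f j)"
    have fat: "f j = Re (\<Sum>i<B. u b i * cnj (atm j b i))" if "j \<in> S" for j
      unfolding f_def c_def atm_def using that by (simp add: sum_distrib_left mult_ac)
    have mu: "\<mu> = Re (\<Sum>i<B. u b i * cnj (app d a x b i))"
    proof -
      have "(\<Sum>i<B. u b i * cnj (app d a x b i)) = (\<Sum>j\<in>S. complex_of_real (p j) * (\<Sum>i<B. u b i * cnj (atm j b i)))"
        unfolding appx cnj_sum sum_distrib_left by (subst sum.swap) (simp add: mult_ac)
      then have "Re (\<Sum>i<B. u b i * cnj (app d a x b i)) = (\<Sum>j\<in>S. p j * Re (\<Sum>i<B. u b i * cnj (atm j b i)))"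
        by (simp del: complex_cnj_mult)
      then show ?thesis using fat by (simp add: \<mu>_def)
    qed
    have "(\<Sum>j\<in>S. p j * (Re (\<Sum>i<B. u b i * cnj (xi j b i)))\<^sup>2) = (\<Sum>j\<in>S. p j * (f j - \<mu>)\<^sup>2)"
      by (intro sum.cong refl) (simp add: fat mu xi_def right_diff_distrib sum_subtractf)
    also have "\<dots> \<le> (\<Sum>j\<in>S. p j * (f j)\<^sup>2)" by (rule weighted_variance_le[OF p(2) \<mu>_def])
    also have "\<dots> \<le> (\<Sum>j\<in>S. 2 * (cmod (c j))\<^sup>2)"
    proof (intro sum_mono)
      fix j assume j: "j \<in> S"
      have "\<bar>f j\<bar> \<le> cmod (w j) * cmod (c j)"
        unfolding f_def using abs_Re_le_cmod[of "cnj (w j) * c j"] by (simp add: norm_mult)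
      then have "\<bar>f j\<bar>\<^sup>2 \<le> (cmod (w j) * cmod (c j))\<^sup>2" by (rule power_mono) simp
      then have "p j * (f j)\<^sup>2 \<le> p j * ((cmod (w j))\<^sup>2 * (cmod (c j))\<^sup>2)"
        using p(1)[OF j] by (intro mult_left_mono) (simp_all add: power_mult_distrib)
      also have "\<dots> = (p j * (cmod (w j))\<^sup>2) * (cmod (c j))\<^sup>2" by simp
      also have "\<dots> \<le> 2 * (cmod (c j))\<^sup>2" using wp2[OF j] by (intro mult_right_mono) auto
      finally show "p j * (f j)\<^sup>2 \<le> 2 * (cmod (c j))\<^sup>2" .
    qed
    also have "\<dots> \<le> 2 * (R\<^sup>2 * bn B u b)"
    proof -
      define C where "C = (\<Sum>j\<in>S. (cmod (c j))\<^sup>2)"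
      have C0: "C \<ge> 0" by (simp add: C_def sum_nonneg)
      have cS: "{j. c j \<noteq> 0} \<subseteq> S" by (auto simp: c_def)
      \<comment> \<open>Duality: the vector \<open>c\<close> of inner products serves as test
        vector. Its image pairs with \<open>u\<close> to the sum \<open>C\<close> of its squares,
        while \<open>R\<close> bounds the norm of that image.\<close>
      have "(\<Sum>i<B. u b i * cnj (app d a c b i)) = (\<Sum>j\<in>S. cnj (c j) * (\<Sum>i<B. u b i * cnj (a b i j)))"
        unfolding app_eq_sum_on[OF cS S(3)] cnj_sum sum_distrib_left by (subst sum.swap) (simp add: mult_ac)
      also have "\<dots> = (\<Sum>j\<in>S. complex_of_real ((cmod (c j))\<^sup>2))"
        by (intro sum.cong refl) (simp only: c_def if_True complex_norm_square mult.commute)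
      also have "\<dots> = complex_of_real C" by (simp add: C_def)
      finally have "cmod (complex_of_real C) \<le> sqrt (bn B u b) * sqrt (bn B (app d a c) b)"
        using cmod_sum_cnj_le[of u b "app d a c" B] by simp
      also have "\<dots> \<le> sqrt (bn B u b) * (R * sqrt C)"
        unfolding C_def using S(4) by (intro mult_left_mono bn_app_scaled[where k = k] cS S(3) R b) auto
      finally have *: "C \<le> sqrt (bn B u b) * (R * sqrt C)" using C0 by simp
      have "C \<le> R\<^sup>2 * bn B u b"
      proof (cases "C = 0")
        case False
        then have "sqrt C > 0" using C0 by simp
        moreover have "sqrt C * sqrt C \<le> (sqrt (bn B u b) * R) * sqrt C" using * C0 by (simp add: mult_ac)
        ultimately have "sqrt C \<le> sqrt (bn B u b) * R" by (simp only: mult_le_cancel_right_pos)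
        then have "(sqrt C)\<^sup>2 \<le> (sqrt (bn B u b) * R)\<^sup>2" using C0 by (intro power_mono) auto
        then show ?thesis using C0 by (simp add: power_mult_distrib mult.commute)
      qed simp
      then show ?thesis by (simp add: C_def sum_distrib_left[symmetric])
    qed
    finally show ?thesis by simp
  qed
  have "\<exists>J. (\<forall>t<n. J t \<in> S) \<and> (\<forall>b<m. bn B (\<lambda>b i. \<Sum>t<n. xi (J t) b i) b \<le> D\<^sup>2)"
  proof (rule greedy_selection[where p = p and M = M and la = la and l = l and ?t2.0 = "M\<^sup>2" and ?s2.0 = "2 * R\<^sup>2"])
    show "finite S" "(\<Sum>j\<in>S. p j) = 1" "0 < la" "0 < n" "0 < m" "ln (real m) \<le> l" by fact+
    show "0 \<le> p j" if "j \<in> S" for j using p(1)[OF that] by simp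
    show "(\<Sum>j\<in>S. complex_of_real (p j) * xi j b i) = 0" for b i
      unfolding xi_def right_diff_distrib sum_subtractf sum_distrib_right[symmetric] p1 by (simp add: appx)
    show "bn B (xi j) b \<le> M\<^sup>2" if "j \<in> S" "b < m" for j b using that by (rule xiM)
    show "(\<Sum>j\<in>S. p j * bn B (xi j) b) \<le> M\<^sup>2" if b: "b < m" for b
    proof -
      have "(\<Sum>j\<in>S. p j * bn B (xi j) b) \<le> (\<Sum>j\<in>S. p j * M\<^sup>2)"
        using xiM[OF _ b] p(1) by (intro sum_mono mult_left_mono) (auto intro: less_imp_le)
      then show ?thesis using p(2) by (simp add: sum_distrib_right[symmetric])
    qed
    show "(\<Sum>j\<in>S. p j * (Re (\<Sum>i<B. u b i * cnj (xi j b i)))\<^sup>2) \<le> (2 * R\<^sup>2) * bn B u b" if "b < m" for u b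
      using that by (rule weak)
    show "0 \<le> M\<^sup>2" "0 \<le> D" "0 \<le> M" "0 \<le> 2 * R\<^sup>2" using K by (auto simp: D_def M_def)
    show "l + 6 * la * M\<^sup>2 * real n \<le> la * D\<^sup>2"
      unfolding M2 D2 la_def using n0 K by (simp add: field_simps)
    have "l * R\<^sup>2 \<le> l\<^sup>2 * R\<^sup>2"
      using l(1) by (intro mult_right_mono) (simp_all add: power2_eq_square)
    also have "\<dots> \<le> 4 * K" using l(3) by (simp add: K_def mult.commute)
    finally show "32 * la * (2 * R\<^sup>2) * real n \<le> 1"
      unfolding la_def using n0 K by (simp add: divide_le_eq)
    show "4 * la * (D * M) + 2 * la * M\<^sup>2 \<le> 1"
    proof -
      define r where "r = sqrt (real n)"
      have r: "r > 0" "r\<^sup>2 = real n" using n0 by (auto simp: r_def)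
      \<comment> \<open>Here the threshold \<open>l^2 \<le> n\<close> matters:
        \<open>la * D * M\<close> is of order \<open>l / sqrt n\<close>.\<close>
      have lr: "l \<le> r" using n(1) l(1) by (simp add: r_def real_le_rsqrt)
      have "l * 1 \<le> r * r" using lr l(1) by (intro mult_mono) auto
      then have ln': "l \<le> r\<^sup>2" by (simp add: power2_eq_square)
      have sK: "sqrt K > 0" "(sqrt K)\<^sup>2 = K" using K by auto
      have s280: "sqrt 280 \<le> 17" by (rule real_le_lsqrt) auto
      have "D = sqrt 280 * r * sqrt K" by (simp add: D_def r_def real_sqrt_mult)
      then have "D \<le> 17 * r * sqrt K" using s280 r sK by (auto intro!: mult_right_mono)
      then have "D * M \<le> (17 * r * sqrt K) * M" using sK by (intro mult_right_mono) (simp_all add: M_def)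
      also have "\<dots> = 34 * r * (sqrt K)\<^sup>2" by (simp add: M_def power2_eq_square)
      finally have DM: "D * M \<le> 34 * r * K" using sK by simp
      have "4 * la * (D * M) \<le> 4 * la * (34 * r * K)" using la DM by (intro mult_left_mono) auto
      also have "\<dots> = (136 / 256) * (l / r)" unfolding la_def r(2)[symmetric] using r(1) K by (simp add: power2_eq_square)
      also have "\<dots> \<le> (136 / 256) * 1" using lr r by (intro mult_left_mono) auto
      finally have 1: "4 * la * (D * M) \<le> 136 / 256" by simp
      have "2 * la * M\<^sup>2 = (8 / 256) * (l / r\<^sup>2)" unfolding la_def M2 r(2)[symmetric] using r(1) K by simp
      also have "\<dots> \<le> (8 / 256) * 1" using ln' r(1) by (intro mult_left_mono) (simp_all add: divide_le_eq)
      finally show ?thesis using 1 by simp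
    qed
  qed
  then obtain J where J: "\<And>t. t < n \<Longrightarrow> J t \<in> S" and Jb: "\<And>b. b < m \<Longrightarrow> bn B (\<lambda>b i. \<Sum>t<n. xi (J t) b i) b \<le> D\<^sup>2"
    by blast
  define g where "g = (\<lambda>j. Complex (real_of_int \<lfloor>Re (w j)\<rfloor>) (real_of_int \<lfloor>Im (w j)\<rfloor>))"
  define hn where "hn = 1 / real n"
  have hn: "hn > 0" "hn * real n = 1" using n0 by (auto simp: hn_def)
  have "near m B (19 * sqrt (real k * real B / real n)) v
      (\<lambda>b i. complex_of_real hn * (\<Sum>t<n. a b i (J t) * g (J t)))"
    unfolding near_def
  proof (intro allI impI)
    fix b assume b: "b < m"
    define V where "V = (\<lambda>b i. \<Sum>t<n. xi (J t) b i)"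
    define W where "W = (\<lambda>b i. complex_of_real hn * (\<Sum>t<n. a b i (J t) * (w (J t) - g (J t))))"
    have hn1: "complex_of_real hn * of_nat n = 1" using hn(2) by (metis of_real_1 of_real_mult of_real_of_nat_eq)
    have eq: "v b i - complex_of_real hn * (\<Sum>t<n. a b i (J t) * g (J t)) = complex_of_real (- hn) * V b i + W b i" for i b
    proof -
      have *: "(\<Sum>t<n. atm (J t) b i) = V b i + of_nat n * v b i"
        by (simp add: V_def xi_def sum_subtractf v)
      have "complex_of_real (- hn) * V b i = (complex_of_real hn * of_nat n) * v b i - complex_of_real hn * (\<Sum>t<n. atm (J t) b i)"
        unfolding * by (simp add: algebra_simps)
      then show ?thesis unfolding hn1 W_def atm_def
        by (simp add: right_diff_distrib sum_subtractf mult.commute)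
    qed
    have sV: "sqrt (bn B V b) \<le> 17 * sqrt (real n * K)"
    proof -
      have "sqrt (bn B V b) \<le> sqrt (17\<^sup>2 * (real n * K))" using Jb[OF b] K unfolding D2 V_def
        by (intro real_sqrt_le_mono) (auto elim: order_trans)
      then show ?thesis unfolding real_sqrt_mult by simp
    qed
    have "sqrt (bn B (\<lambda>b i. v b i - complex_of_real hn * (\<Sum>t<n. a b i (J t) * g (J t))) b)
        \<le> sqrt (bn B (\<lambda>b i. complex_of_real (- hn) * V b i) b) + sqrt (bn B W b)"
      unfolding eq by (rule sqrt_bn_add)
    moreover have "sqrt (bn B (\<lambda>b i. complex_of_real (- hn) * V b i) b) \<le> 17 * sqrt (K / real n)"
    proof -
      have "sqrt (K / real n) = sqrt (hn\<^sup>2 * (real n * K))" using n0 by (simp add: hn_def power2_eq_square)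
      then have *: "hn * sqrt (real n * K) = sqrt (K / real n)" using hn unfolding real_sqrt_mult by simp
      have "sqrt (bn B (\<lambda>b i. complex_of_real (- hn) * V b i) b) = hn * sqrt (bn B V b)"
        unfolding sqrt_bn_cmult using hn by simp
      also have "\<dots> \<le> hn * (17 * sqrt (real n * K))" using sV hn by (intro mult_left_mono) auto
      also have "\<dots> = 17 * sqrt (K / real n)" unfolding *[symmetric] by simp
      finally show ?thesis .
    qed
    moreover have "sqrt (bn B W b) \<le> 2 * sqrt (K / real n)"
    proof -
      have "sqrt (bn B W b) \<le> 2 * sqrt (real B)"
      proof (rule sqrt_bn_le_entries)
        fix i assume i: "i < B"
        have "cmod (\<Sum>t<n. a b i (J t) * (w (J t) - g (J t))) \<le> (\<Sum>t<n. 2)"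
        proof (intro order_trans[OF norm_sum] sum_mono)
          fix t assume "t \<in> {..<n}"
          then have "J t \<in> S" using J by simp
          then have "cmod (a b i (J t)) * cmod (w (J t) - g (J t)) \<le> 1 * 2"
            using a[OF b i] S(3) floor_complex(3)[OF wd] by (intro mult_mono) (auto simp: g_def)
          then show "cmod (a b i (J t) * (w (J t) - g (J t))) \<le> 2" by (simp add: norm_mult)
        qed
        then have "hn * cmod (\<Sum>t<n. a b i (J t) * (w (J t) - g (J t))) \<le> hn * (real n * 2)"
          using hn by (intro mult_left_mono) auto
        also have "\<dots> = 2" using hn(2) by simp
        finally show "cmod (W b i) \<le> 2" unfolding W_def norm_mult norm_of_real abs_of_pos[OF hn(1)] .
      qed simp
      \<comment> \<open>By \<open>n \<le> k\<close> the rounding error is at most of the order of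
        the sampling error.\<close>
      moreover have "sqrt (real B) \<le> sqrt (K / real n)"
        using n(2) n0 by (intro real_sqrt_le_mono) (simp add: K_def le_divide_eq mult.commute mult_left_mono)
      ultimately show ?thesis by linarith
    qed
    ultimately show "sqrt (bn B (\<lambda>b i. v b i - complex_of_real hn * (\<Sum>t<n. a b i (J t) * g (J t))) b)
        \<le> 19 * sqrt (real k * real B / real n)" unfolding K_def by linarith
  qed
  moreover have "J t < d \<and> \<bar>\<lfloor>Re (w (J t))\<rfloor>\<bar> \<le> int d \<and> \<bar>\<lfloor>Im (w (J t))\<rfloor>\<bar> \<le> int d" if "t < n" for t
    using floor_complex(1,2)[OF wd[OF J[OF that]]] J[OF that] S(3) by auto
  ultimately show "\<exists>J P Q. (\<forall>t<n. J t < d \<and> \<bar>P t\<bar> \<le> int d \<and> \<bar>Q t\<bar> \<le> int d) \<and>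
      near m B (19 * sqrt (real k * real B / real n)) v
      (\<lambda>b i. complex_of_real (1 / real n) * (\<Sum>t<n. a b i (J t) * Complex (real_of_int (P t)) (real_of_int (Q t))))"
    unfolding hn_def g_def by (intro exI[of _ J] exI[of _ "\<lambda>t. \<lfloor>Re (w (J t))\<rfloor>"] exI[of _ "\<lambda>t. \<lfloor>Im (w (J t))\<rfloor>"]) blast
qed

section \<open>Internal nets and their cardinality\<close>

lemma covers_mono: "covers m B V N u \<Longrightarrow> W \<subseteq> V \<Longrightarrow> covers m B W N u"
  unfolding covers_def by blast

text \<open>For each used centre one point of \<open>V\<close> assigned to it is chosen. Every other
  point assigned to that centre lies within \<open>u\<close> of it as well, hence the radius
  \<open>2 * u\<close>.\<close>

lemma covers_selection:
  assumes "covers m B V N u"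
  shows "\<exists>\<pi>. (\<forall>v\<in>V. \<pi> v \<in> V \<and> near m B (2 * u) v (\<pi> v)) \<and> finite (\<pi> ` V) \<and> card (\<pi> ` V) \<le> N"
proof -
  obtain C where C: "finite C" "card C \<le> N" "\<forall>v\<in>V. \<exists>c\<in>C. near m B u v c" using assms by (auto simp: covers_def)
  obtain c where c: "\<And>v. v \<in> V \<Longrightarrow> c v \<in> C \<and> near m B u v (c v)" using C(3) by metis
  define r where "r = (\<lambda>z. SOME w. w \<in> V \<and> c w = z)"
  have r: "r (c v) \<in> V \<and> c (r (c v)) = c v" if "v \<in> V" for v
    unfolding r_def by (rule someI[of _ v]) (use that in simp)
  have cV: "c ` V \<subseteq> C" using c by blast
  then have fin: "finite (c ` V)" using C(1) finite_subset by blast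
  show ?thesis
  proof (intro exI[of _ "\<lambda>v. r (c v)"] conjI ballI)
    fix v assume v: "v \<in> V"
    show "r (c v) \<in> V" using r[OF v] by simp
    have "near m B u (c v) (r (c v))" using c[of "r (c v)"] r[OF v] near_commute[of m B u "r (c v)" "c v"] by simp
    then have "near m B (u + u) v (r (c v))" using near_trans[of m B u v "c v" u "r (c v)"] c[OF v] by simp
    then show "near m B (2 * u) v (r (c v))" by simp
  next
    have eq: "(\<lambda>v. r (c v)) ` V = r ` (c ` V)" by (simp add: image_image)
    show "finite ((\<lambda>v. r (c v)) ` V)" unfolding eq using fin by simp
    have "card (r ` (c ` V)) \<le> card (c ` V)" by (rule card_image_le[OF fin])
    also have "\<dots> \<le> card C" by (rule card_mono[OF C(1) cV])
    finally show "card ((\<lambda>v. r (c v)) ` V) \<le> N" unfolding eq using C(2) by simp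
  qed
qed

lemma near_refl: "0 \<le> u \<Longrightarrow> near m B u v v"
  by (simp add: near_def bn_def)

text \<open>The cost of one link: \<open>U\<close> is the distance and \<open>X\<close> the entropy
  in units of \<open>ln d\<close>. If the squared distance is of order \<open>K / n\<close> and the
  entropy of order \<open>n\<close>, the product does not depend on \<open>n\<close>; hence all
  sampling levels cost the same.\<close>

lemma mult_sqrt_le:
  fixes U X K n c q :: real
  assumes "0 < n" "U \<le> c * sqrt (K / n)" "X \<le> q\<^sup>2 * n" "0 \<le> c" "0 \<le> q" "0 \<le> K" "0 \<le> X"
  shows "U * sqrt X \<le> c * q * sqrt K"
proof -
  have "sqrt X \<le> sqrt (q\<^sup>2 * n)" using assms(3) by (rule real_sqrt_le_mono)
  also have "\<dots> = q * sqrt n" using assms(5) by (simp add: real_sqrt_mult)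
  finally have *: "sqrt X \<le> q * sqrt n" .
  have "U * sqrt X \<le> (c * sqrt (K / n)) * sqrt X" using assms by (intro mult_right_mono) auto
  also have "\<dots> \<le> (c * sqrt (K / n)) * (q * sqrt n)" using assms * by (intro mult_left_mono) auto
  also have "\<dots> = c * q * sqrt K" using assms(1) by (simp add: real_sqrt_divide)
  finally show ?thesis .
qed

text \<open>All factors are bounded by powers of \<open>d\<close> because
  \<open>4 \<le> d^2\<close>; the exponent \<open>7 + 4 * e\<close> is
  \<open>1 + 2 * (2 * e + 3)\<close>.\<close>

lemma ln_net_size:
  assumes d: "2 \<le> d"
  shows "ln (real ((d * (2 * (d * 4 ^ e) + 1)\<^sup>2) ^ n)) \<le> real (7 + 4 * e) * real n * ln (real d)"
    and "0 < (d * (2 * (d * 4 ^ e) + 1)\<^sup>2) ^ n"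
proof -
  have four: "4 \<le> d\<^sup>2" using power_mono[OF d, of 2] by simp
  have one: "1 \<le> d * 4 ^ e" using d by simp
  have "2 * (d * 4 ^ e) + 1 \<le> 4 * (d * 4 ^ e)" using one by simp
  also have "\<dots> = d * 4 ^ Suc e" by simp
  also have "\<dots> \<le> d * (d\<^sup>2) ^ Suc e" by (intro mult_left_mono power_mono four) auto
  also have "\<dots> = d ^ (2 * e + 3)" by (simp add: power_mult[symmetric] power_add[symmetric] numeral_3_eq_3)
  finally have "(2 * (d * 4 ^ e) + 1)\<^sup>2 \<le> (d ^ (2 * e + 3))\<^sup>2" by (rule power_mono) simp
  then have "d * (2 * (d * 4 ^ e) + 1)\<^sup>2 \<le> d * (d ^ (2 * e + 3))\<^sup>2" by (rule mult_left_mono) simp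
  also have "\<dots> = d ^ (7 + 4 * e)" by (simp add: power_mult[symmetric] flip: power_Suc)
  finally have "(d * (2 * (d * 4 ^ e) + 1)\<^sup>2) ^ n \<le> (d ^ (7 + 4 * e)) ^ n" by (rule power_mono) simp
  also have "\<dots> = d ^ ((7 + 4 * e) * n)" by (simp add: power_mult)
  finally have "(d * (2 * (d * 4 ^ e) + 1)\<^sup>2) ^ n \<le> d ^ ((7 + 4 * e) * n)" .
  then have le: "real ((d * (2 * (d * 4 ^ e) + 1)\<^sup>2) ^ n) \<le> real (d ^ ((7 + 4 * e) * n))"
    by (simp only: of_nat_le_iff)
  show pos: "0 < (d * (2 * (d * 4 ^ e) + 1)\<^sup>2) ^ n" using d by simp
  then have pos': "0 < real ((d * (2 * (d * 4 ^ e) + 1)\<^sup>2) ^ n)" by (simp only: of_nat_0_less_iff)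
  have "ln (real ((d * (2 * (d * 4 ^ e) + 1)\<^sup>2) ^ n)) \<le> ln (real (d ^ ((7 + 4 * e) * n)))"
    by (rule ln_le_cancel_iff[THEN iffD2, OF pos' less_le_trans[OF pos' le] le])
  also have "\<dots> = real ((7 + 4 * e) * n) * ln (real d)" using d by (simp only: of_nat_power) (simp add: ln_realpow)
  finally show "ln (real ((d * (2 * (d * 4 ^ e) + 1)\<^sup>2) ^ n)) \<le> real (7 + 4 * e) * real n * ln (real d)" by simp
qed

section \<open>Chaining over sparse vectors\<close>

text \<open>The resolution \<open>\<delta>\<close> is arbitrary because the lattice levels
  contribute a geometric series: their number depends on \<open>\<delta>\<close>, the bound for
  \<open>G\<close> does not. The pair \<open>R\<close>, \<open>l\<close> abstracts from (iii) and
  (iv), so that small \<open>m\<close> can be treated with other values.\<close>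

lemma chaining_sparse_ball:
  fixes R l E :: real
  assumes a: "\<And>b i j. b < m \<Longrightarrow> i < B \<Longrightarrow> j < d \<Longrightarrow> cmod (a b i j) \<le> 1"
    and pos: "0 < k" "2 \<le> d" "0 < m" "2 \<le> B"
    and R: "\<And>y b. y \<in> sparse_ball d k \<Longrightarrow> b < m \<Longrightarrow> sqrt (bn B (app d a y) b) \<le> R" "0 \<le> R"
    and l: "1 \<le> l" "ln (real m) \<le> l" "R * l \<le> 2 * sqrt (real k * real B)"
    and E: "\<And>x. x \<in> sparse_ball d k \<Longrightarrow> tot m B (app d a x) \<le> E"
    and \<delta>: "0 < \<delta>"
  shows "\<exists>V G. finite V \<and> V \<noteq> {} \<and> V \<subseteq> app d a ` sparse_ball d k \<and>
    (\<forall>v\<in>app d a ` sparse_ball d k. \<exists>w\<in>V. near m B \<delta> v w) \<and>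
    0 \<le> G \<and> G \<le> 51200 * (sqrt (real k * real B) * sqrt (ln (real d)) * ln (real (B * k))) \<and>
    avg (sgns m B) (\<lambda>\<sigma>. MAX v\<in>V. \<bar>sqn m B \<sigma> v - tot m B v\<bar>) \<le> G\<^sup>2 + G * sqrt E"
proof -
  define K where "K = real k * real B"
  define s where "s = min k d"
  define T where "T = app d a ` sparse_ball d k"
  define n0 where "n0 = nat \<lceil>l\<^sup>2\<rceil>"
  have K: "K > 0" using pos by (simp add: K_def)
  have sK: "sqrt K > 0" using K by simp
  have l2: "1 \<le> l\<^sup>2" using l(1) by (rule one_le_power)
  have n0: "l\<^sup>2 \<le> real n0" "real n0 \<le> 2 * l\<^sup>2" "1 \<le> n0"
    using l2 unfolding n0_def by linarith+
  have s: "1 \<le> s" "s \<le> k" using pos by (auto simp: s_def)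
  have lnd: "ln (real d) > 0" "ln 2 \<le> ln (real d)" using pos(2) by auto
  have Rl: "R * l \<le> 2 * sqrt K" using l(3) by (simp add: K_def)
  have R2: "R\<^sup>2 * l\<^sup>2 \<le> 4 * real k * real B"
  proof -
    have "(R * l)\<^sup>2 \<le> (2 * sqrt K)\<^sup>2" using Rl R(2) l(1) by (intro power_mono) auto
    then show ?thesis using K by (simp add: power_mult_distrib K_def mult.assoc)
  qed
  have exJ: "\<exists>j. k < n0 * 2 ^ j"
  proof (intro exI)
    have "k < 2 ^ k" by (rule less_exp)
    also have "\<dots> \<le> n0 * 2 ^ k" using n0(3) by simp
    finally show "k < n0 * 2 ^ k" .
  qed
  \<comment> \<open>Level 0 is the zero vector, levels \<open>1..J1\<close> average \<open>n0 2^(j - 1)\<close> samples, later levels are lattices.\<close>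
  define J1 where "J1 = (LEAST j. k < n0 * 2 ^ j)"
  have J1: "k < n0 * 2 ^ J1" unfolding J1_def by (rule LeastI_ex[OF exJ])
  have J1': "n0 * 2 ^ j \<le> k" if "j < J1" for j using not_less_Least[of j "\<lambda>j. k < n0 * 2 ^ j"] that by (simp add: J1_def)
  \<comment> \<open>The last lattice has radius \<open>2 * sqrt B / 4 ^ e0\<close>, and selection
    doubles it.\<close>
  obtain e0 where e0: "(1 / 4 :: real) ^ e0 < \<delta> / (4 * sqrt (real B))"
    using real_arch_pow_inv[of "\<delta> / (4 * sqrt (real B))" "1 / 4"] \<delta> pos by auto
  define J where "J = J1 + 1 + e0"
  define Nc where "Nc = (\<lambda>j. if j \<le> J1 then (d * (2 * (d * 4 ^ 0) + 1)\<^sup>2) ^ (n0 * 2 ^ (j - 1))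
    else (d * (2 * (d * 4 ^ (j - J1 - 1)) + 1)\<^sup>2) ^ s)"
  define uc where "uc = (\<lambda>j. if j \<le> J1 then 19 * sqrt (K / real (n0 * 2 ^ (j - 1)))
    else 2 * sqrt (real B) / 4 ^ (j - J1 - 1))"
  \<comment> \<open>The factor 2 in \<open>N\<close> leaves room for the zero vector that is added
    to \<open>V\<close>; the one in \<open>u\<close> comes from \<open>covers_selection\<close>.
    Level 0 is one point, with the diameter bound \<open>R\<close>.\<close>
  define N where "N = (\<lambda>j. if j = 0 then 1 else 2 * Nc j)"
  define u where "u = (\<lambda>j. if j = 0 then R else 2 * uc j)"
  have cov: "covers m B T (Nc j) (uc j)" if "1 \<le> j" for j
  proof (cases "j \<le> J1")
    case True
    have "n0 * 2 ^ (j - 1) \<le> k" using True that by (intro J1') simp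
    moreover have "l\<^sup>2 \<le> real (n0 * 2 ^ (j - 1))"
    proof -
      have "real n0 * 1 \<le> real n0 * 2 ^ (j - 1)" by (intro mult_left_mono) auto
      then show ?thesis using n0(1) by simp
    qed
    ultimately have "covers m B T ((d * (2 * d + 1)\<^sup>2) ^ (n0 * 2 ^ (j - 1))) (19 * sqrt (real k * real B / real (n0 * 2 ^ (j - 1))))"
      unfolding T_def using pos R by (intro covers_sampling[where l = l and R = R] a l R2) auto
    then show ?thesis using True by (simp add: Nc_def uc_def K_def)
  next
    case False
    have "covers m B T ((d * (2 * (d * 4 ^ (j - J1 - 1)) + 1)\<^sup>2) ^ min k d) (2 * sqrt (real B) / 4 ^ (j - J1 - 1))"
      unfolding T_def using pos by (intro covers_grid a) auto
    then show ?thesis using False by (simp add: Nc_def uc_def s_def)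
  qed
  have Nc_pos: "0 < Nc j" for j unfolding Nc_def using ln_net_size(2)[OF pos(2)] by simp
  have uc_nonneg: "0 \<le> uc j" for j using K by (simp add: uc_def)
  have zero: "(\<lambda>b i. 0) \<in> T"
  proof -
    have "(\<lambda>j. 0) \<in> sparse_ball d k" by (simp add: sparse_ball_def)
    moreover have "app d a (\<lambda>j. 0) = (\<lambda>b i. 0)" by (simp add: app_def fun_eq_iff)
    ultimately show ?thesis unfolding T_def by (metis imageI)
  qed
  have J: "1 \<le> J" "\<not> J \<le> J1" by (auto simp: J_def)
  obtain r where r: "\<And>v. v \<in> T \<Longrightarrow> r v \<in> T \<and> near m B (2 * uc J) v (r v)" "finite (r ` T)" "card (r ` T) \<le> Nc J"
    using covers_selection[OF cov[OF J(1)]] by blast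
  \<comment> \<open>The chain starts at zero, which therefore has to belong to the index
    set.\<close>
  define V where "V = insert (\<lambda>b i. 0) (r ` T)"
  have VT: "V \<subseteq> T" using r(1) zero by (auto simp: V_def)
  have finV: "finite V" using r(2) by (simp add: V_def)
  have cardV: "card V \<le> 2 * Nc J"
  proof -
    have "card V \<le> Suc (card (r ` T))" unfolding V_def using r(2) by (simp add: card_insert_if)
    then show ?thesis using r(3) Nc_pos[of J] by linarith
  qed
  have "\<exists>\<pi>. (\<forall>v\<in>V. \<pi> v \<in> V \<and> near m B (2 * uc j) v (\<pi> v)) \<and> finite (\<pi> ` V) \<and> card (\<pi> ` V) \<le> Nc j"
    if "1 \<le> j" for j by (rule covers_selection[OF covers_mono[OF cov[OF that] VT]])
  then obtain \<rho> where \<rho>: "\<And>j v. 1 \<le> j \<Longrightarrow> v \<in> V \<Longrightarrow> \<rho> j v \<in> V \<and> near m B (2 * uc j) v (\<rho> j v)"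
      "\<And>j. 1 \<le> j \<Longrightarrow> card (\<rho> j ` V) \<le> Nc j"
    by metis
  \<comment> \<open>The identity is possible at level \<open>J\<close> because \<open>V\<close> was
    itself selected from the finest net.\<close>
  define \<pi> where "\<pi> = (\<lambda>j. if j = 0 then (\<lambda>v b i. 0) else if j = J then (\<lambda>v. v) else \<rho> j)"
  define G where "G = 16 * (\<Sum>j<J. (u j + u (Suc j)) * sqrt (ln (2 * real (N j * N (Suc j)))))"
  have u_nonneg: "0 \<le> u j" for j using R(2) uc_nonneg by (simp add: u_def)
  have main: "avg (sgns m B) (\<lambda>\<sigma>. MAX v\<in>V. \<bar>sqn m B \<sigma> v - tot m B v\<bar>) \<le> G\<^sup>2 + G * sqrt E"
  proof (rule chaining[where \<pi> = \<pi> and J = J and N = N and u = u])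
    show "finite V" "V \<noteq> {}" using finV by (auto simp: V_def)
    show "\<pi> 0 v = (\<lambda>b i. 0)" for v by (simp add: \<pi>_def)
    show "\<pi> J v = v" for v using J by (simp add: \<pi>_def)
    show "\<pi> j v \<in> V" if "v \<in> V" for v j using that \<rho>(1)[of j v] by (auto simp: \<pi>_def V_def)
    show "0 \<le> u j" for j by (rule u_nonneg)
    show "tot m B v \<le> E" if "v \<in> V" for v using that VT E by (auto simp: T_def)
    show "G = 16 * (\<Sum>j<J. (u j + u (Suc j)) * sqrt (ln (2 * real (N j * N (Suc j)))))" by (simp add: G_def)
    show "card (\<pi> j ` V) \<le> N j" if "j \<le> J" for j
    proof -
      consider "j = 0" | "j = J" "j \<noteq> 0" | "1 \<le> j" "j \<noteq> J" by linarith
      then show ?thesis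
      proof cases
        case 1
        have "\<pi> 0 ` V \<subseteq> {\<lambda>b i. 0}" by (auto simp: \<pi>_def)
        then have "card (\<pi> 0 ` V) \<le> card {\<lambda>(b::nat) (i::nat). 0 :: complex}" by (rule card_mono[rotated]) simp
        then show ?thesis using 1 by (simp add: N_def)
      next
        case 2
        then show ?thesis using cardV by (simp add: \<pi>_def N_def)
      next
        case 3
        then show ?thesis using \<rho>(2)[of j] by (simp add: \<pi>_def N_def)
      qed
    qed
    show "near m B (u j) v (\<pi> j v)" if v: "v \<in> V" and "j \<le> J" for v j
    proof -
      consider "j = 0" | "j = J" "j \<noteq> 0" | "1 \<le> j" "j \<noteq> J" by linarith
      then show ?thesis
      proof cases
        case 1
        obtain x where x: "x \<in> sparse_ball d k" "v = app d a x" using v VT by (auto simp: T_def)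
        show ?thesis unfolding near_def using R(1)[OF x(1)] 1 by (simp add: x(2) \<pi>_def u_def)
      next
        case 2
        then show ?thesis using near_refl[OF u_nonneg, of m B j v] by (simp add: \<pi>_def)
      next
        case 3
        then show ?thesis using \<rho>(1)[of j v] v by (simp add: \<pi>_def u_def)
      qed
    qed
  qed
  have cover: "\<exists>w\<in>V. near m B \<delta> v w" if v: "v \<in> T" for v
  proof (intro bexI[of _ "r v"])
    show "r v \<in> V" using v by (simp add: V_def)
    have "uc J = 2 * sqrt (real B) * (1 / 4) ^ e0" by (simp add: uc_def J_def power_divide)
    moreover have "(1 / 4) ^ e0 * (4 * sqrt (real B)) < \<delta>" using e0 pos by (simp add: less_divide_eq)
    ultimately have "2 * uc J \<le> \<delta>" by (simp add: mult_ac)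
    then show "near m B \<delta> v (r v)" using r(1)[OF v] unfolding near_def by (meson order_trans)
  qed
  \<comment> \<open>\<open>N j\<close> is at most \<open>d\<close> to the power \<open>ex j\<close>;
    the 8 is the 7 of \<open>ln_net_size\<close> plus 1 for the factor 2 in
    \<open>N\<close>.\<close>
  define ex where "ex = (\<lambda>j. if j = 0 then 0 else if j \<le> J1 then 8 * real (n0 * 2 ^ (j - 1)) else real (8 + 4 * (j - J1 - 1)) * real s)"
  have lnN: "ln (real (N j)) \<le> ex j * ln (real d)" "0 < N j" "0 \<le> ex j" for j
  proof -
    show "0 < N j" using Nc_pos[of j] by (simp add: N_def)
    show "0 \<le> ex j" by (simp add: ex_def)
    show "ln (real (N j)) \<le> ex j * ln (real d)"
    proof (cases "j = 0")
      case False
      define q where "q = (if j \<le> J1 then n0 * 2 ^ (j - 1) else s)"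
      define e where "e = (if j \<le> J1 then 0 else j - J1 - 1)"
      have q1: "1 \<le> real q" using n0(3) s by (simp add: q_def)
      have Ncq: "Nc j = (d * (2 * (d * 4 ^ e) + 1)\<^sup>2) ^ q" by (simp add: Nc_def q_def e_def)
      have "ln (real (N j)) = ln 2 + ln (real (Nc j))" using False Nc_pos[of j] by (simp add: N_def ln_mult)
      also have "ln 2 + ln (real (Nc j)) \<le> real q * ln (real d) + real (7 + 4 * e) * real q * ln (real d)"
      proof (rule add_mono)
        have "1 * ln (real d) \<le> real q * ln (real d)" using lnd q1 by (intro mult_right_mono) auto
        then show "ln 2 \<le> real q * ln (real d)" using lnd by linarith
        show "ln (real (Nc j)) \<le> real (7 + 4 * e) * real q * ln (real d)" unfolding Ncq by (rule ln_net_size(1)[OF pos(2)])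
      qed
      also have "\<dots> = (8 + 4 * real e) * real q * ln (real d)" by (simp add: algebra_simps)
      also have "(8 + 4 * real e) * real q = ex j" using False by (simp add: ex_def q_def e_def)
      finally show ?thesis .
    qed (simp add: N_def ex_def)
  qed
  define X where "X = (\<lambda>j. 1 + ex j + ex (Suc j))"
  have X0: "0 \<le> X j" for j using lnN(3) by (simp add: X_def)
  \<comment> \<open>The weight of link \<open>j\<close>: constant up to the first lattice, then
    geometric, because at lattice level \<open>e\<close> the distance is of order
    \<open>1 / 4 ^ e\<close> while the root of the entropy grows at most like
    \<open>2 ^ e\<close>.\<close>
  define g where "g = (\<lambda>j. if j \<le> J1 then 1 else (1 / 2 :: real) ^ (j - J1 - 1))"
  \<comment> \<open>Replaces sampling below \<open>n0\<close>: the entropy is of order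
    \<open>n0\<close>, hence of order \<open>l^2\<close>, and \<open>R * l \<le> 2 * sqrt K\<close>.
    The 5 comes from \<open>9 * n0 \<le> 18 * l^2\<close>.\<close>
  have RX: "R * sqrt x \<le> 10 * sqrt K" if "0 \<le> x" "x \<le> 9 * real n0" for x
  proof -
    have "sqrt x \<le> 5 * l" using that n0(2) l(1) by (intro real_le_lsqrt) (auto simp: power_mult_distrib)
    then have "R * sqrt x \<le> R * (5 * l)" using R(2) by (rule mult_left_mono)
    then show ?thesis using Rl by linarith
  qed
  have sB: "sqrt (real B) = sqrt (K / real k)" using pos by (simp add: K_def)
  have sB_le: "sqrt (real B) \<le> sqrt (K / real n)" if "0 < n" "n \<le> k" for n
    using that by (intro real_sqrt_le_mono) (simp add: K_def le_divide_eq mult.commute mult_left_mono)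
  have step: "(u j + u (Suc j)) * sqrt (X j) \<le> 400 * sqrt K * g j" for j
  proof -
    \<comment> \<open>The links in order: zero to the first sampling level, zero directly to a
      lattice, between sampling levels, sampling to lattice, between lattices.\<close>
    consider "j = 0" "1 \<le> J1" | "j = 0" "J1 = 0" | "1 \<le> j" "j < J1" | "1 \<le> j" "j = J1" | "J1 < j" by linarith
    then show ?thesis
    proof cases
      case 1
      have "X j \<le> 9 * real n0" using 1 n0(3) by (simp add: X_def ex_def)
      then have "R * sqrt (X j) \<le> 10 * sqrt K" by (rule RX[OF X0])
      moreover have "(38 * sqrt (K / real n0)) * sqrt (X j) \<le> 38 * 3 * sqrt K"
        using \<open>X j \<le> 9 * real n0\<close> X0 n0(3) K by (intro mult_sqrt_le[where n = "real n0"]) auto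
      ultimately have "(R + 38 * sqrt (K / real n0)) * sqrt (X j) \<le> 400 * sqrt K"
        using sK unfolding distrib_right by linarith
      then show ?thesis using 1 by (simp add: u_def uc_def g_def)
    next
      case 2
      have kn: "k < n0" using J1 2 by simp
      have Xk: "X j \<le> 9 * real k" using 2 s by (simp add: X_def ex_def)
      then have "X j \<le> 9 * real n0" using kn by linarith
      then have "R * sqrt (X j) \<le> 10 * sqrt K" by (rule RX[OF X0])
      moreover have "(4 * sqrt (real B)) * sqrt (X j) \<le> 4 * 3 * sqrt K"
        unfolding sB using Xk X0 pos K by (intro mult_sqrt_le[where n = "real k"]) auto
      ultimately have "(R + 4 * sqrt (real B)) * sqrt (X j) \<le> 400 * sqrt K"
        using sK unfolding distrib_right by linarith
      then show ?thesis using 2 by (simp add: u_def uc_def g_def)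
    next
      case 3
      define n where "n = n0 * 2 ^ (j - 1)"
      have n: "1 \<le> n" using n0(3) by (simp add: n_def)
      have n2: "n0 * 2 ^ j = 2 * n" using 3 by (cases j) (simp_all add: n_def)
      have ucs: "uc j = 19 * sqrt (K / real n)" "uc (Suc j) = 19 * sqrt (K / real (2 * n))"
        and exs: "ex j = 8 * real n" "ex (Suc j) = 8 * real (2 * n)"
        using 3 by (simp_all only: uc_def ex_def diff_Suc_1 n2 n_def[symmetric]) simp_all
      have "X j \<le> 25 * real n" using n by (simp add: X_def exs)
      moreover have "sqrt (K / real (2 * n)) \<le> sqrt (K / real n)" using K n by (intro real_sqrt_le_mono divide_left_mono) auto
      then have "u j + u (Suc j) \<le> 76 * sqrt (K / real n)" using 3 by (simp add: u_def ucs)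
      ultimately have "(u j + u (Suc j)) * sqrt (X j) \<le> 76 * 5 * sqrt K"
        using X0 n K by (intro mult_sqrt_le[where n = "real n"]) auto
      moreover have "400 * sqrt K * g j = 400 * sqrt K" using 3 by (simp add: g_def)
      ultimately show ?thesis using sK by linarith
    next
      case 4
      have c: "j \<noteq> 0" "j \<le> J1" "\<not> Suc j \<le> J1" "Suc j - J1 - 1 = 0" using 4 by auto
      define n where "n = n0 * 2 ^ (j - 1)"
      have n: "1 \<le> n" using n0(3) by (simp add: n_def)
      have "(2::nat) ^ j = 2 * 2 ^ (j - 1)" using c(1) by (subst power_eq_if) simp
      then have k2: "k < 2 * n" using J1 unfolding 4(2)[symmetric] n_def by simp
      have nk: "n \<le> k" unfolding n_def using 4 by (intro J1') simp
      have ucs: "uc j = 19 * sqrt (K / real n)" "uc (Suc j) = 2 * sqrt (real B)"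
        and exs: "ex j = 8 * real n" "ex (Suc j) = 8 * real s"
        by (simp_all only: uc_def ex_def n_def[symmetric] c if_True if_False nat.distinct) simp_all
      have "real s \<le> 2 * real n" using k2 s(2) by simp
      then have "X j \<le> 25 * real n" using n by (simp add: X_def exs)
      moreover have "u j + u (Suc j) \<le> 42 * sqrt (K / real n)"
      proof -
        have "sqrt (real B) \<le> sqrt (K / real n)" by (rule sB_le) (use n nk in auto)
        moreover have "u j + u (Suc j) = 38 * sqrt (K / real n) + 4 * sqrt (real B)" using c(1) by (simp add: u_def ucs)
        ultimately show ?thesis by linarith
      qed
      ultimately have "(u j + u (Suc j)) * sqrt (X j) \<le> 42 * 5 * sqrt K"
        using X0 n K by (intro mult_sqrt_le[where n = "real n"]) auto
      moreover have "400 * sqrt K * g j = 400 * sqrt K" using c(2) by (simp add: g_def)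
      ultimately show ?thesis using sK by linarith
    next
      case 5
      define e where "e = j - J1 - 1"
      have e: "j = J1 + 1 + e" using 5 by (simp add: e_def)
      \<comment> \<open>The entropy grows linearly in \<open>e\<close>. Bernoulli's inequality
        trades this for \<open>4 ^ e\<close>, whose root \<open>2 ^ e\<close> is beaten by the
        distance.\<close>
      have four: "1 + 3 * real e \<le> 4 ^ e" using Bernoulli_inequality[of 3 e] by (simp add: mult.commute)
      have "X j = 1 + (20 + 8 * real e) * real s" by (simp add: X_def ex_def e algebra_simps)
      also have "\<dots> \<le> (21 + 8 * real e) * real s" using s(1) by (simp add: algebra_simps)
      also have "\<dots> \<le> (25 * 4 ^ e) * real k" using four s by (intro mult_mono) auto
      also have "\<dots> = (5 * 2 ^ e)\<^sup>2 * real k" by (simp add: power_mult_distrib power2_eq_square flip: power_mult_distrib)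
      finally have "X j \<le> (5 * 2 ^ e)\<^sup>2 * real k" .
      moreover have "u j + u (Suc j) \<le> 5 / 4 ^ e * sqrt (K / real k)"
        by (simp add: u_def uc_def e sB[symmetric] field_simps)
      ultimately have "(u j + u (Suc j)) * sqrt (X j) \<le> (5 / 4 ^ e) * (5 * 2 ^ e) * sqrt K"
        using X0 pos K by (intro mult_sqrt_le[where n = "real k"]) auto
      also have "(5 / 4 ^ e) * (5 * 2 ^ e) = 25 * (1 / 2 :: real) ^ e"
      proof -
        have "(4::real) ^ e = 2 ^ e * 2 ^ e" by (simp flip: power_mult_distrib)
        then show ?thesis by (simp add: power_divide)
      qed
      also have "25 * (1 / 2) ^ e * sqrt K \<le> 400 * sqrt K * (1 / 2) ^ e" using sK by simp
      finally show ?thesis by (simp add: g_def e)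
    qed
  qed
  have sumg: "(\<Sum>j<J1 + 1 + e. g j) = real J1 + 3 - 2 * (1 / 2) ^ e" for e
  proof (induction e)
    case 0
    have "(\<Sum>j<J1 + 1. g j) = (\<Sum>j<J1 + 1. 1)" by (intro sum.cong refl) (simp add: g_def)
    then show ?case by simp
  next
    case (Suc e)
    then show ?case by (simp add: g_def)
  qed
  \<comment> \<open>The sample sizes double from \<open>n0 \<ge> 1\<close> up to \<open>k\<close>,
    so \<open>2 ^ J1 \<le> 2 * k \<le> B * k\<close>. As \<open>ln 2 \<ge> 1 / 2\<close>, this gives
    \<open>J1 \<le> 2 * ln (B * k)\<close>, and \<open>3 \<le> 6 * ln (B * k)\<close> since
    \<open>B * k \<ge> 2\<close>.\<close>
  have J1_le: "real J1 + 3 \<le> 8 * ln (real (B * k))"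
  proof -
    have Bk: "2 \<le> real (B * k)"
    proof -
      have "2 * 1 \<le> B * k" using pos by (intro mult_mono) auto
      then show ?thesis by linarith
    qed
    have "2 ^ J1 \<le> real (B * k)"
    proof (cases "J1 = 0")
      case False
      have "2 ^ J1 \<le> n0 * 2 ^ J1" using n0(3) by simp
      also have "\<dots> = 2 * (n0 * 2 ^ (J1 - 1))" using False by (cases J1) simp_all
      also have "\<dots> \<le> 2 * k" using False by (intro mult_left_mono J1') auto
      also have "\<dots> \<le> B * k" using pos(4) by simp
      finally have "real (2 ^ J1) \<le> real (B * k)" by (simp only: of_nat_le_iff)
      then show ?thesis by simp
    qed (use Bk in simp)
    then have "ln (2 ^ J1) \<le> ln (real (B * k))" using Bk by (subst ln_le_cancel_iff) auto
    then have 1: "real J1 * ln 2 \<le> ln (real (B * k))" by (simp add: ln_realpow)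
    have 2: "ln 2 \<le> ln (real (B * k))" using Bk by (subst ln_le_cancel_iff) auto
    have "exp (1 / 2) \<le> (2::real)" using exp_le_quadratic[of "1 / 2"] by (simp add: power2_eq_square)
    then have half: "1 / 2 \<le> ln (2::real)" by (subst ln_ge_iff) auto
    have "real J1 * (1 / 2) \<le> real J1 * ln 2" using half by (intro mult_left_mono) auto
    then show ?thesis using 1 2 half by linarith
  qed
  have "(\<Sum>j<J. (u j + u (Suc j)) * sqrt (ln (2 * real (N j * N (Suc j))))) \<le> (\<Sum>j<J. 400 * sqrt K * sqrt (ln (real d)) * g j)"
  proof (rule sum_mono)
    fix j
    have "ln (2 * real (N j * N (Suc j))) = ln 2 + ln (real (N j)) + ln (real (N (Suc j)))"
      using lnN(2)[of j] lnN(2)[of "Suc j"] by (simp add: ln_mult)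
    also have "\<dots> \<le> X j * ln (real d)"
      using lnd lnN(1)[of j] lnN(1)[of "Suc j"] by (simp add: X_def algebra_simps)
    finally have "sqrt (ln (2 * real (N j * N (Suc j)))) \<le> sqrt (X j) * sqrt (ln (real d))"
      unfolding real_sqrt_mult[symmetric] by (rule real_sqrt_le_mono)
    then have "(u j + u (Suc j)) * sqrt (ln (2 * real (N j * N (Suc j)))) \<le> (u j + u (Suc j)) * (sqrt (X j) * sqrt (ln (real d)))"
      using u_nonneg by (intro mult_left_mono) auto
    also have "\<dots> = ((u j + u (Suc j)) * sqrt (X j)) * sqrt (ln (real d))" by simp
    also have "\<dots> \<le> (400 * sqrt K * g j) * sqrt (ln (real d))" using step lnd by (intro mult_right_mono) auto
    finally show "(u j + u (Suc j)) * sqrt (ln (2 * real (N j * N (Suc j)))) \<le> 400 * sqrt K * sqrt (ln (real d)) * g j"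
      by (simp add: mult_ac)
  qed
  also have "\<dots> = 400 * sqrt K * sqrt (ln (real d)) * (real J1 + 3 - 2 * (1 / 2) ^ e0)"
    unfolding sum_distrib_left[symmetric] J_def sumg ..
  also have "\<dots> \<le> 400 * sqrt K * sqrt (ln (real d)) * (8 * ln (real (B * k)))"
    using J1_le sK lnd by (intro mult_left_mono) (auto intro: order_trans[rotated])
  \<comment> \<open>The constant is 16 * 400 * 8: the factor in \<open>G\<close>, the bound per
    link, and the count of links.\<close>
  finally have "G \<le> 51200 * (sqrt K * sqrt (ln (real d)) * ln (real (B * k)))"
    by (simp add: G_def)
  moreover have "0 \<le> G"
  proof -
    have "0 \<le> sqrt (ln (2 * real (N j * N (Suc j))))" for j
    proof -
      have "1 \<le> N j * N (Suc j)" using lnN(2)[of j] lnN(2)[of "Suc j"] by (simp add: Suc_le_eq)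
      then have "1 \<le> real (N j * N (Suc j))" by (simp only: real_of_nat_ge_one_iff)
      then show ?thesis by (intro real_sqrt_ge_zero ln_ge_zero) linarith
    qed
    then show ?thesis unfolding G_def using u_nonneg by (intro mult_nonneg_nonneg sum_nonneg) auto
  qed
  ultimately show ?thesis using main cover finV VT
    by (intro exI[of _ V] exI[of _ G]) (auto simp: K_def T_def V_def)
qed

section \<open>From the net to the whole ball\<close>

lemma sqrt_tot: "sqrt (tot m B v) = L2_set (\<lambda>b. sqrt (bn B v b)) {..<m}"
  by (simp add: tot_def L2_set_def)

lemma sqrt_tot_add: "sqrt (tot m B (\<lambda>b i. v b i + w b i)) \<le> sqrt (tot m B v) + sqrt (tot m B w)"
proof -
  have "sqrt (tot m B (\<lambda>b i. v b i + w b i)) \<le> L2_set (\<lambda>b. sqrt (bn B v b) + sqrt (bn B w b)) {..<m}"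
    unfolding sqrt_tot by (intro L2_set_mono sqrt_bn_add) simp
  also have "\<dots> \<le> sqrt (tot m B v) + sqrt (tot m B w)"
    unfolding sqrt_tot by (rule L2_set_triangle_ineq)
  finally show ?thesis .
qed

lemma sqrt_sqn_add_right: "sqrt (sqn m B c (\<lambda>b i. v b i + w b i)) \<le> sqrt (sqn m B c v) + sqrt (sqn m B c w)"
proof -
  have "phi B c (\<lambda>b i. v b i + w b i) b = phi B c v b + phi B c w b" for b
    by (simp add: phi_def sum.distrib algebra_simps)
  then have "sqrt (sqn m B c (\<lambda>b i. v b i + w b i)) \<le> L2_set (\<lambda>b. cmod (phi B c v b) + cmod (phi B c w b)) {..<m}"
    unfolding sqrt_sqn by (intro L2_set_mono) (simp_all add: norm_triangle_ineq)
  also have "\<dots> \<le> sqrt (sqn m B c v) + sqrt (sqn m B c w)"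
    unfolding sqrt_sqn by (rule L2_set_triangle_ineq)
  finally show ?thesis .
qed

text \<open>Cauchy-Schwarz within each block. The loss of the factor \<open>B\<close> is harmless:
  it enters only the discretisation error, which \<open>\<delta>\<close> makes small.\<close>

lemma sqn_le_tot:
  assumes s: "\<sigma> \<in> sgns m B"
  shows "sqn m B \<sigma> v \<le> real B * tot m B v"
proof -
  have "(cmod (phi B \<sigma> v b))\<^sup>2 \<le> real B * bn B v b" if b: "b < m" for b
  proof -
    have "cmod (phi B \<sigma> v b) \<le> (\<Sum>i<B. \<bar>1\<bar> * \<bar>cmod (v b i)\<bar>)"
      unfolding phi_def
    proof (intro order_trans[OF norm_sum] sum_mono)
      fix i assume "i \<in> {..<B}"
      then have "\<bar>\<sigma> (b, i)\<bar> = 1" using sgns_cases[OF s b, of i] by auto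
      then show "cmod (complex_of_real (\<sigma> (b, i)) * v b i) \<le> \<bar>1\<bar> * \<bar>cmod (v b i)\<bar>"
        by (simp add: norm_mult)
    qed
    also have "\<dots> \<le> L2_set (\<lambda>i. 1) {..<B} * L2_set (\<lambda>i. cmod (v b i)) {..<B}" by (rule L2_set_mult_ineq)
    also have "\<dots> = sqrt (real B) * sqrt (bn B v b)" unfolding sqrt_bn by (simp add: L2_set_def)
    finally have "(cmod (phi B \<sigma> v b))\<^sup>2 \<le> (sqrt (real B) * sqrt (bn B v b))\<^sup>2" by (rule power_mono) simp
    then show ?thesis by (simp add: power_mult_distrib)
  qed
  then show ?thesis unfolding sqn_def tot_def sum_distrib_left by (intro sum_mono) simp
qed

lemma sqn_one_block:
  assumes s: "\<sigma> \<in> sgns m 1"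
  shows "sqn m 1 \<sigma> v = tot m 1 v"
  unfolding sqn_def tot_def
proof (intro sum.cong refl)
  fix b assume "b \<in> {..<m}"
  then have "\<sigma> (b, 0) = -1 \<or> \<sigma> (b, 0) = 1" using sgns_cases[OF s, of b 0] by simp
  then show "(cmod (phi 1 \<sigma> v b))\<^sup>2 = bn 1 v b" by (auto simp: phi_def bn_def)
qed

lemma square_diff_le:
  fixes f g e M :: real
  assumes "f \<le> g + e" "g \<le> f + e" "0 \<le> f" "f \<le> M" "0 \<le> g" "g \<le> M" "0 \<le> e"
  shows "\<bar>f\<^sup>2 - g\<^sup>2\<bar> \<le> 2 * M * e"
proof -
  have "\<bar>f\<^sup>2 - g\<^sup>2\<bar> = \<bar>f - g\<bar> * (f + g)"
    using assms by (simp add: power2_eq_square square_diff_square_factored abs_mult)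
  also have "\<dots> \<le> e * (2 * M)" using assms by (intro mult_mono) auto
  finally show ?thesis by (simp add: mult_ac)
qed

text \<open>Both squared norms are Lipschitz on the ball, by the triangle inequality and
  \<open>square_diff_le\<close>. The constant depends on \<open>m\<close> and \<open>B\<close>,
  which the choice of \<open>\<delta>\<close> compensates.\<close>

lemma deviation_near:
  assumes s: "\<sigma> \<in> sgns m B" and near: "near m B \<delta> v w" "0 \<le> \<delta>" and B: "0 < B"
    and E: "tot m B v \<le> E" "tot m B w \<le> E"
  shows "\<bar>sqn m B \<sigma> v - tot m B v\<bar> \<le> \<bar>sqn m B \<sigma> w - tot m B w\<bar> + 4 * real B * sqrt (real m * E) * \<delta>"
proof -
  define z where "z = (\<lambda>b i. v b i - w b i)"
  define z' where "z' = (\<lambda>b i. w b i - v b i)"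
  have "0 \<le> E" using E(1) tot_nonneg[of m B v] by linarith
  have tz: "tot m B y \<le> real m * \<delta>\<^sup>2" if y: "y = z \<or> y = z'" for y
  proof -
    have "bn B y b \<le> \<delta>\<^sup>2" if "b < m" for b
      using near(1) near(1)[unfolded near_commute[of m B \<delta> v w]] y that unfolding near_def z_def z'_def
      by (auto intro!: sqrt_le_D)
    then have "tot m B y \<le> (\<Sum>b<m. \<delta>\<^sup>2)" unfolding tot_def by (intro sum_mono) simp
    then show ?thesis by simp
  qed
  define e where "e = sqrt (real m) * \<delta>"
  have e0: "0 \<le> e" using near by (simp add: e_def)
  have te: "sqrt (tot m B y) \<le> e" if "y = z \<or> y = z'" for y
  proof -
    have "sqrt (tot m B y) \<le> sqrt (real m * \<delta>\<^sup>2)" by (rule real_sqrt_le_mono[OF tz[OF that]])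
    then show ?thesis using near(2) by (simp add: e_def real_sqrt_mult)
  qed
  have se: "sqrt (sqn m B \<sigma> y) \<le> sqrt (real B) * sqrt (tot m B y)" for y
    unfolding real_sqrt_mult[symmetric] by (rule real_sqrt_le_mono[OF sqn_le_tot[OF s]])
  have vw: "v = (\<lambda>b i. w b i + z b i)" "w = (\<lambda>b i. v b i + z' b i)" by (simp_all add: z_def z'_def)
  have "\<bar>(sqrt (tot m B v))\<^sup>2 - (sqrt (tot m B w))\<^sup>2\<bar> \<le> 2 * sqrt E * e"
  proof (rule square_diff_le)
    show "sqrt (tot m B v) \<le> sqrt (tot m B w) + e"
      using sqrt_tot_add[of m B w z] te[of z] by (simp add: vw(1)[symmetric])
    show "sqrt (tot m B w) \<le> sqrt (tot m B v) + e"
      using sqrt_tot_add[of m B v z'] te[of z'] by (simp add: vw(2)[symmetric])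
  qed (use E e0 in \<open>auto intro: real_sqrt_le_mono\<close>)
  then have 1: "\<bar>tot m B v - tot m B w\<bar> \<le> 2 * sqrt E * e" by simp
  have sy: "sqrt (sqn m B \<sigma> y) \<le> sqrt (real B) * e" if "y = z \<or> y = z'" for y
    using se[of y] mult_left_mono[OF te[OF that], of "sqrt (real B)"] by simp
  have sE: "sqrt (sqn m B \<sigma> y) \<le> sqrt (real B) * sqrt E" if "tot m B y \<le> E" for y
    using se[of y] mult_left_mono[OF real_sqrt_le_mono[OF that], of "sqrt (real B)"] by simp
  have "\<bar>(sqrt (sqn m B \<sigma> v))\<^sup>2 - (sqrt (sqn m B \<sigma> w))\<^sup>2\<bar> \<le> 2 * (sqrt (real B) * sqrt E) * (sqrt (real B) * e)"
  proof (rule square_diff_le)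
    show "sqrt (sqn m B \<sigma> v) \<le> sqrt (sqn m B \<sigma> w) + sqrt (real B) * e"
      using sqrt_sqn_add_right[of m B \<sigma> w z] sy[of z] by (simp add: vw(1)[symmetric])
    show "sqrt (sqn m B \<sigma> w) \<le> sqrt (sqn m B \<sigma> v) + sqrt (real B) * e"
      using sqrt_sqn_add_right[of m B \<sigma> v z'] sy[of z'] by (simp add: vw(2)[symmetric])
  qed (use E e0 sE in auto)
  moreover have "2 * (sqrt (real B) * sqrt E) * (sqrt (real B) * e) = 2 * (sqrt (real B) * sqrt (real B)) * (sqrt E * e)"
    by (simp only: mult_ac)
  ultimately have 2: "\<bar>sqn m B \<sigma> v - sqn m B \<sigma> w\<bar> \<le> 2 * real B * (sqrt E * e)" by simp
  have "1 * (sqrt E * e) \<le> real B * (sqrt E * e)" using B e0 \<open>0 \<le> E\<close> by (intro mult_right_mono) auto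
  then have "2 * sqrt E * e + 2 * real B * (sqrt E * e) \<le> 4 * real B * (sqrt E * e)" by linarith
  also have "\<dots> = 4 * real B * sqrt (real m * E) * \<delta>" by (simp add: e_def real_sqrt_mult mult_ac)
  finally show ?thesis using 1 2 by linarith
qed

text \<open>\<open>h\<close> stands for the supremum over the ball: for \<open>B \<ge> 2\<close> it
  is a finite maximum over the net plus the discretisation error. The factor 3 in the constant
  counts the terms \<open>G^2\<close>, \<open>G * sqrt E0\<close> and
  \<open>\<epsilon> * M\<close>.\<close>

lemma sign_average_bound:
  fixes R l \<epsilon> c :: real
  assumes a: "\<And>b i j. b < m \<Longrightarrow> i < B \<Longrightarrow> j < d \<Longrightarrow> cmod (a b i j) \<le> 1"
    and pos: "0 < k" "2 \<le> d" "0 < m" "0 < B" "0 < \<epsilon>" "\<epsilon> < 1" "1 \<le> c"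
    and R: "\<And>y b. y \<in> sparse_ball d k \<Longrightarrow> b < m \<Longrightarrow> sqrt (bn B (app d a y) b) \<le> R" "0 \<le> R"
    and l: "1 \<le> l" "ln (real m) \<le> l" "R * l \<le> 2 * sqrt (real k * real B)"
    and E: "\<And>x. x \<in> sparse_ball d k \<Longrightarrow> tot m B (app d a x) \<le> c * real (m * B)"
    and m: "real k * ln (real d) * (ln (real (B * k)))\<^sup>2 \<le> real m * \<epsilon>\<^sup>2"
  shows "\<exists>h. (\<forall>\<sigma>\<in>sgns m B. 0 \<le> h \<sigma> \<and> (\<forall>x\<in>sparse_ball d k. \<bar>sqn m B \<sigma> (app d a x) - tot m B (app d a x)\<bar> \<le> h \<sigma>)) \<and>
    avg (sgns m B) h \<le> 3 * 51200\<^sup>2 * c * \<epsilon> * real (m * B)"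
proof (cases "B = 1")
  \<comment> \<open>With one row per block the signs change no modulus. The case is separate because
    \<open>ln (B * k)\<close> vanishes for \<open>B = k = 1\<close>.\<close>
  case True
  then show ?thesis using pos
    by (intro exI[of _ "\<lambda>_. 0"]) (auto simp: sqn_one_block[simplified] avg_def)
next
  case False
  define M where "M = real (m * B)"
  define E0 where "E0 = c * M"
  have M: "M > 0" using pos by (simp add: M_def)
  have E0: "E0 > 0" using M pos by (simp add: E0_def)
  \<comment> \<open>Chosen so that the error in \<open>deviation_near\<close> is exactly
    \<open>\<epsilon> * M\<close>.\<close>
  define \<delta> where "\<delta> = \<epsilon> * M / (4 * real B * sqrt (real m * E0))"
  have \<delta>: "\<delta> > 0" using pos M E0 by (simp add: \<delta>_def)
  have tE: "tot m B v \<le> E0" if "v \<in> app d a ` sparse_ball d k" for v using that E by (auto simp: E0_def M_def)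
  have tE': "tot m B (app d a x) \<le> E0" if "x \<in> sparse_ball d k" for x using that by (intro tE imageI)
  have B2: "2 \<le> B" using False pos(4) by simp
  have "\<exists>V G. finite V \<and> V \<noteq> {} \<and> V \<subseteq> app d a ` sparse_ball d k \<and>
    (\<forall>v\<in>app d a ` sparse_ball d k. \<exists>w\<in>V. near m B \<delta> v w) \<and>
    0 \<le> G \<and> G \<le> 51200 * (sqrt (real k * real B) * sqrt (ln (real d)) * ln (real (B * k))) \<and>
    avg (sgns m B) (\<lambda>\<sigma>. MAX v\<in>V. \<bar>sqn m B \<sigma> v - tot m B v\<bar>) \<le> G\<^sup>2 + G * sqrt E0"
    by (rule chaining_sparse_ball[where R = R and l = l]; (fact pos B2 R(2) l \<delta>)?; erule a R(1) tE'; assumption)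
  then obtain V G where V: "finite V" "V \<noteq> {}" "V \<subseteq> app d a ` sparse_ball d k"
      "\<And>v. v \<in> app d a ` sparse_ball d k \<Longrightarrow> \<exists>w\<in>V. near m B \<delta> v w"
    and G: "0 \<le> G" "G \<le> 51200 * (sqrt (real k * real B) * sqrt (ln (real d)) * ln (real (B * k)))"
    and avgV: "avg (sgns m B) (\<lambda>\<sigma>. MAX v\<in>V. \<bar>sqn m B \<sigma> v - tot m B v\<bar>) \<le> G\<^sup>2 + G * sqrt E0"
    by (elim exE conjE) (rule that, (assumption | erule bspec)+)
  define D where "D = (\<lambda>\<sigma>. MAX v\<in>V. \<bar>sqn m B \<sigma> v - tot m B v\<bar>)"
  have DV: "\<bar>sqn m B \<sigma> v - tot m B v\<bar> \<le> D \<sigma>" if "v \<in> V" for v \<sigma>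
    unfolding D_def using that V by (intro Max_ge) auto
  have D0: "0 \<le> D \<sigma>" for \<sigma>
  proof -
    obtain v where "v \<in> V" using V by auto
    then show ?thesis using DV[of v \<sigma>] by linarith
  qed
  \<comment> \<open>Hypothesis (v), multiplied by \<open>B\<close>, bounds the square of the entropy
    sum.\<close>
  have G': "G \<le> 51200 * (\<epsilon> * sqrt M)"
  proof -
    have L0: "0 \<le> ln (real (B * k))"
    proof (rule ln_ge_zero)
      have "1 \<le> B * k" using pos by (simp add: Suc_le_eq)
      then show "1 \<le> real (B * k)" by (simp only: real_of_nat_ge_one_iff)
    qed
    have "(sqrt (real k * real B) * sqrt (ln (real d)) * ln (real (B * k)))\<^sup>2 = real B * (real k * ln (real d) * (ln (real (B * k)))\<^sup>2)"
      using pos by (simp add: power_mult_distrib)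
    also have "\<dots> \<le> real B * (real m * \<epsilon>\<^sup>2)" using m by (intro mult_left_mono) auto
    also have "\<dots> = (\<epsilon> * sqrt M)\<^sup>2" using M by (simp add: power_mult_distrib) (simp add: M_def)
    finally have "sqrt (real k * real B) * sqrt (ln (real d)) * ln (real (B * k)) \<le> \<epsilon> * sqrt M"
      by (rule power2_le_imp_le) (use pos M in simp)
    then show ?thesis using G(2) by linarith
  qed
  have "avg (sgns m B) (\<lambda>\<sigma>. D \<sigma> + \<epsilon> * M) \<le> (G\<^sup>2 + G * sqrt E0) + \<epsilon> * M"
    using avgV by (simp add: avg_add avg_const D_def)
  also have "\<dots> \<le> 3 * 51200\<^sup>2 * c * \<epsilon> * M"
  proof -
    have "G\<^sup>2 \<le> (51200 * (\<epsilon> * sqrt M))\<^sup>2" using G' G(1) by (intro power_mono) auto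
    also have "\<dots> = 51200\<^sup>2 * (\<epsilon> * \<epsilon>) * M" using M by (simp add: power_mult_distrib power2_eq_square)
    also have "\<dots> \<le> 51200\<^sup>2 * (c * \<epsilon>) * M" using pos M by (intro mult_right_mono mult_left_mono) auto
    finally have 1: "G\<^sup>2 \<le> 51200\<^sup>2 * (c * \<epsilon> * M)" by (simp only: mult.assoc)
    have "c \<le> c\<^sup>2" using pos by (simp add: power2_eq_square)
    then have "sqrt E0 \<le> sqrt (c\<^sup>2 * M)" unfolding E0_def using M by (intro real_sqrt_le_mono mult_right_mono) auto
    then have "sqrt E0 \<le> c * sqrt M" using pos by (simp add: real_sqrt_mult)
    then have "G * sqrt E0 \<le> (51200 * (\<epsilon> * sqrt M)) * (c * sqrt M)"
      using G' pos M E0 by (intro mult_mono) auto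
    also have "\<dots> = 51200 * (c * \<epsilon> * (sqrt M * sqrt M))" by (simp only: mult_ac)
    also have "\<dots> = 51200 * (c * \<epsilon> * M)" using M by simp
    also have "\<dots> \<le> 51200\<^sup>2 * (c * \<epsilon> * M)" using pos M by (intro mult_right_mono) auto
    finally have 2: "G * sqrt E0 \<le> 51200\<^sup>2 * (c * \<epsilon> * M)" .
    have "1 * (\<epsilon> * M) \<le> (51200\<^sup>2 * c) * (\<epsilon> * M)" using pos M by (intro mult_right_mono) auto
    then have 3: "\<epsilon> * M \<le> 51200\<^sup>2 * (c * \<epsilon> * M)" by (simp only: mult.assoc mult_1)
    have "3 * 51200\<^sup>2 * c * \<epsilon> * M = 3 * (51200\<^sup>2 * (c * \<epsilon> * M))" by (simp only: mult.assoc)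
    then show ?thesis using 1 2 3 by linarith
  qed
  finally have "avg (sgns m B) (\<lambda>\<sigma>. D \<sigma> + \<epsilon> * M) \<le> 3 * 51200\<^sup>2 * c * \<epsilon> * real (m * B)" unfolding M_def .
  moreover have "\<bar>sqn m B \<sigma> (app d a x) - tot m B (app d a x)\<bar> \<le> D \<sigma> + \<epsilon> * M"
    if s: "\<sigma> \<in> sgns m B" and x: "x \<in> sparse_ball d k" for \<sigma> x
  proof -
    obtain w where w: "w \<in> V" "near m B \<delta> (app d a x) w" using V(4) x by blast
    have "\<bar>sqn m B \<sigma> (app d a x) - tot m B (app d a x)\<bar> \<le> \<bar>sqn m B \<sigma> w - tot m B w\<bar> + 4 * real B * sqrt (real m * E0) * \<delta>"
      using w V(3) x \<delta> pos(4) by (intro deviation_near[OF s] tE) auto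
    also have "4 * real B * sqrt (real m * E0) * \<delta> = \<epsilon> * M" using pos E0 by (simp add: \<delta>_def)
    finally show ?thesis using DV[OF w(1), of \<sigma>] by linarith
  qed
  ultimately show ?thesis using D0 pos M by (intro exI[of _ "\<lambda>\<sigma>. D \<sigma> + \<epsilon> * M"]) (auto intro: add_nonneg_nonneg)
qed

section \<open>Matrices and the sign measure\<close>

definition vfun :: "nat \<Rightarrow> complex vec \<Rightarrow> nat \<Rightarrow> complex" where
  "vfun d x j = (if j < d then x $ j else 0)"

definition bent :: "nat \<Rightarrow> complex mat \<Rightarrow> nat \<Rightarrow> nat \<Rightarrow> nat \<Rightarrow> complex" where
  "bent B A b i j = A $$ (block_index B b i, j)"

lemma vec_norm2_square: "x \<in> carrier_vec d \<Longrightarrow> (vec_norm2 x)\<^sup>2 = (\<Sum>j<d. (cmod (x $ j))\<^sup>2)"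
  by (simp add: vec_norm2_def L2_set_def sum_nonneg)

lemma vec_norm2_nonneg: "0 \<le> vec_norm2 x"
  by (simp add: vec_norm2_def L2_set_nonneg)

lemma vec_norm2_mult_square:
  assumes "M \<in> carrier_mat n d" "x \<in> carrier_vec d"
  shows "(vec_norm2 (M *\<^sub>v x))\<^sup>2 = (\<Sum>r<n. (cmod (\<Sum>j<d. M $$ (r, j) * x $ j))\<^sup>2)"
proof -
  have "M *\<^sub>v x \<in> carrier_vec n" using assms by simp
  then have "(vec_norm2 (M *\<^sub>v x))\<^sup>2 = (\<Sum>r<n. (cmod ((M *\<^sub>v x) $ r))\<^sup>2)" by (rule vec_norm2_square)
  also have "\<dots> = (\<Sum>r<n. (cmod (\<Sum>j<d. M $$ (r, j) * x $ j))\<^sup>2)"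
    using assms by (intro sum.cong refl) (simp add: scalar_prod_def lessThan_atLeast0)
  finally show ?thesis .
qed

lemma vfun_in_sparse_ball: "x \<in> sparse_unit_ball d k \<Longrightarrow> vfun d x \<in> sparse_ball d k"
proof -
  assume x: "x \<in> sparse_unit_ball d k"
  then have c: "x \<in> carrier_vec d" by (simp add: sparse_unit_ball_def)
  have "{j. vfun d x j \<noteq> 0} = {i. i < dim_vec x \<and> x $ i \<noteq> 0}" using c by (auto simp: vfun_def)
  moreover have "(\<Sum>j<d. (cmod (vfun d x j))\<^sup>2) = (vec_norm2 x)\<^sup>2"
    by (simp add: vec_norm2_square[OF c] vfun_def)
  ultimately show ?thesis using x vec_norm2_nonneg[of x]
    by (simp add: sparse_ball_def sparse_unit_ball_def nnz_def power_le_one_iff) (simp add: vfun_def)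
qed

lemma sparse_ball_eq_vfun:
  assumes y: "y \<in> sparse_ball d k"
  obtains x where "x \<in> sparse_unit_ball d k" "y = vfun d x"
proof
  define x where "x = vec d y"
  have y0: "y j = 0" if "\<not> j < d" for j using y that by (auto simp: sparse_ball_def)
  show yx: "y = vfun d (vec d y)" using y0 by (auto simp: vfun_def fun_eq_iff)
  have c: "vec d y \<in> carrier_vec d" by simp
  have "{i. i < dim_vec (vec d y) \<and> vec d y $ i \<noteq> 0} = {j. y j \<noteq> 0}"
    by (intro Collect_cong) (metis dim_vec index_vec y0)
  moreover have "(vec_norm2 (vec d y))\<^sup>2 \<le> 1" unfolding vec_norm2_square[OF c] using y by (simp add: sparse_ball_def)
  ultimately show "vec d y \<in> sparse_unit_ball d k"
    using y by (simp add: sparse_unit_ball_def nnz_def sparse_ball_def power_le_one_iff vec_norm2_nonneg)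
qed

lemma app_vfun: "app d a (vfun d x) b i = (\<Sum>j<d. a b i j * x $ j)"
  by (simp add: app_def vfun_def)

lemma tot_app_bent:
  assumes "A \<in> carrier_mat (m * B) d" "x \<in> carrier_vec d"
  shows "tot m B (app d (bent B A) (vfun d x)) = (vec_norm2 (A *\<^sub>v x))\<^sup>2"
proof -
  define f where "f = (\<lambda>r. (cmod (\<Sum>j<d. A $$ (r, j) * x $ j))\<^sup>2)"
  have "(vec_norm2 (A *\<^sub>v x))\<^sup>2 = (\<Sum>r<m * B. f r)" unfolding vec_norm2_mult_square[OF assms] f_def ..
  also have "\<dots> = (\<Sum>b<m. \<Sum>r\<in>{b * B..<b * B + B}. f r)" by (rule sum.nat_group[symmetric])
  also have "\<dots> = (\<Sum>b<m. \<Sum>i<B. f (B * b + i))"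
  proof (rule sum.cong[OF refl])
    fix b
    show "sum f {b * B..<b * B + B} = (\<Sum>i<B. f (B * b + i))"
      using sum.shift_bounds_nat_ivl[of f 0 "b * B" B] by (simp add: lessThan_atLeast0 ac_simps)
  qed
  also have "\<dots> = tot m B (app d (bent B A) (vfun d x))"
    by (simp add: tot_def bn_def app_vfun bent_def block_index_def f_def)
  finally show ?thesis by simp
qed

lemma bn_app_bent:
  assumes "A \<in> carrier_mat (m * B) d" "x \<in> carrier_vec d"
  shows "bn B (app d (bent B A) (vfun d x)) b = (vec_norm2 (block B A b *\<^sub>v x))\<^sup>2"
proof -
  have c: "block B A b \<in> carrier_mat B d" using assms by (simp add: block_def)
  have "block B A b $$ (i, j) = A $$ (block_index B b i, j)" if "i < B" "j < d" for i j
    using assms(1) that by (simp add: block_def)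
  then show ?thesis
    unfolding vec_norm2_mult_square[OF c assms(2)] by (simp add: bn_def app_vfun bent_def)
qed

lemma sqn_app_bent:
  assumes "A \<in> carrier_mat (m * B) d" "x \<in> carrier_vec d"
  shows "sqn m B \<sigma> (app d (bent B A) (vfun d x)) = (vec_norm2 (signed_mat m B A \<sigma> *\<^sub>v x))\<^sup>2"
proof -
  have c: "signed_mat m B A \<sigma> \<in> carrier_mat m d" using assms by (simp add: signed_mat_def)
  have "phi B \<sigma> (app d (bent B A) (vfun d x)) b = (\<Sum>j<d. signed_mat m B A \<sigma> $$ (b, j) * x $ j)" if "b < m" for b
  proof -
    have "(\<Sum>j<d. signed_mat m B A \<sigma> $$ (b, j) * x $ j) =
        (\<Sum>j<d. \<Sum>i<B. complex_of_real (\<sigma> (b, i)) * A $$ (block_index B b i, j) * x $ j)"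
      using assms that by (intro sum.cong refl) (simp add: signed_mat_def sum_distrib_right)
    also have "\<dots> = (\<Sum>i<B. \<Sum>j<d. complex_of_real (\<sigma> (b, i)) * A $$ (block_index B b i, j) * x $ j)"
      by (rule sum.swap)
    also have "\<dots> = phi B \<sigma> (app d (bent B A) (vfun d x)) b"
      by (simp add: phi_def app_vfun bent_def sum_distrib_left mult.assoc)
    finally show ?thesis by simp
  qed
  then show ?thesis unfolding vec_norm2_mult_square[OF c assms(2)] sqn_def by simp
qed

section \<open>The sign measure as normalised counting\<close>

lemma space_signs: "space (signs m B) = sgns m B"
  by (simp add: signs_def sgns_def space_PiM space_uniform_count_measure)

lemma prob_space_signs: "prob_space (signs m B)"
  unfolding signs_def by (intro prob_space_PiM prob_space_uniform_count_measure) auto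

text \<open>Transfers finite averages to \<open>signs\<close>. As every set of sign patterns is
  measurable, the good signs of a fixed \<open>A\<close> need no further argument.\<close>

lemma measure_signs:
  assumes S: "S \<subseteq> sgns m B"
  shows "S \<in> sets (signs m B)" "measure (signs m B) S = real (card S) / real (card (sgns m B))"
proof -
  let ?U = "uniform_count_measure {-1, 1 :: real}" and ?I = "{..<m} \<times> {..<B}"
  interpret U: prob_space ?U by (rule prob_space_uniform_count_measure) auto
  interpret product_sigma_finite "\<lambda>_. ?U" by standard
  interpret P: prob_space "signs m B" by (rule prob_space_signs)
  have finS: "finite S" using S finite_sgns finite_subset by blast
  have single: "{\<sigma>} \<in> sets (signs m B) \<and> emeasure (signs m B) {\<sigma>} = ennreal ((1 / 2) ^ (m * B))"
    if \<sigma>: "\<sigma> \<in> sgns m B" for \<sigma>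
  proof -
    have eq: "{\<sigma>} = PiE ?I (\<lambda>p. {\<sigma> p})"
    proof -
      have "\<sigma> \<in> extensional ?I" using \<sigma> by (simp add: sgns_def PiE_def)
      then show ?thesis by (simp add: PiE_singleton)
    qed
    have sub: "{\<sigma> p} \<subseteq> {-1, 1}" if "p \<in> ?I" for p using \<sigma> that by (auto simp: sgns_def)
    have "{\<sigma>} \<in> sets (signs m B)" unfolding eq signs_def
      using sub by (intro sets_PiM_I_finite) (auto simp: sets_uniform_count_measure)
    moreover have "emeasure (signs m B) {\<sigma>} = (\<Prod>p\<in>?I. emeasure ?U {\<sigma> p})"
      unfolding eq signs_def using sub by (intro emeasure_PiM) (auto simp: sets_uniform_count_measure)
    moreover have "emeasure ?U {\<sigma> p} = ennreal (1 / 2)" if "p \<in> ?I" for p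
      using sub[OF that] by (subst emeasure_uniform_count_measure) auto
    then have "(\<Prod>p\<in>?I. emeasure ?U {\<sigma> p}) = (\<Prod>p\<in>?I. ennreal (1 / 2))" by (intro prod.cong) auto
    moreover have "(\<Prod>p\<in>?I. ennreal (1 / 2)) = ennreal ((1 / 2) ^ (m * B))"
      by (subst prod_ennreal) simp_all
    ultimately show ?thesis by (simp only: simp_thms)
  qed
  have "(\<Union>\<sigma>\<in>S. {\<sigma>}) \<in> sets (signs m B)" using finS single S by (intro sets.finite_UN) auto
  then show "S \<in> sets (signs m B)" by simp
  have "measure (signs m B) (\<Union>\<sigma>\<in>S. {\<sigma>}) = (\<Sum>\<sigma>\<in>S. measure (signs m B) {\<sigma>})"
  proof (rule P.finite_measure_finite_Union[OF finS])
    show "(\<lambda>\<sigma>. {\<sigma>}) ` S \<subseteq> sets (signs m B)" using single S by blast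
  qed (simp add: disjoint_family_on_def)
  then have "measure (signs m B) S = (\<Sum>\<sigma>\<in>S. measure (signs m B) {\<sigma>})" by simp
  also have "\<dots> = (\<Sum>\<sigma>\<in>S. (1 / 2) ^ (m * B))"
    using single S by (intro sum.cong refl) (simp add: measure_def subset_iff)
  also have "\<dots> = real (card S) / real (card (sgns m B))" by (simp add: card_sgns power_divide)
  finally show "measure (signs m B) S = real (card S) / real (card (sgns m B))" .
qed

lemma measure_signs_Markov:
  assumes h: "\<And>\<sigma>. \<sigma> \<in> sgns m B \<Longrightarrow> 0 \<le> h \<sigma>" and avg: "avg (sgns m B) h \<le> t" and t: "0 < t" and c: "0 < c"
  shows "1 - 1 / c \<le> measure (signs m B) {\<sigma> \<in> sgns m B. h \<sigma> \<le> c * t}"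
proof -
  let ?G = "{\<sigma> \<in> sgns m B. h \<sigma> \<le> c * t}" and ?H = "{\<sigma> \<in> sgns m B. \<not> h \<sigma> \<le> c * t}"
  let ?n = "real (card (sgns m B))"
  have n: "?n > 0" by (simp add: card_sgns)
  have "real (card ?H) * (c * t) = (\<Sum>\<sigma>\<in>?H. c * t)" by simp
  also have "\<dots> \<le> (\<Sum>\<sigma>\<in>?H. h \<sigma>)" by (intro sum_mono) auto
  also have "\<dots> \<le> (\<Sum>\<sigma>\<in>sgns m B. h \<sigma>)" using h by (intro sum_mono2) auto
  also have "\<dots> \<le> t * ?n" using avg n by (simp add: avg_def divide_le_eq)
  finally have "real (card ?H) * c \<le> ?n" using t by (simp add: mult.left_commute mult.commute)
  then have H: "real (card ?H) / ?n \<le> 1 / c" using n c by (simp add: field_simps)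
  have "card (sgns m B) = card ?G + card ?H"
    by (subst card_Un_disjoint[symmetric]) (auto intro!: arg_cong[where f = card])
  then have "?n = real (card ?G) + real (card ?H)" by simp
  then have "real (card ?G) / ?n = 1 - real (card ?H) / ?n" using n by (simp add: field_simps)
  moreover have "measure (signs m B) ?G = real (card ?G) / ?n" by (rule measure_signs(2)) auto
  ultimately show ?thesis using H by linarith
qed

section \<open>Measurability\<close>

text \<open>Expressed through entries, so that measurability in \<open>M\<close>, continuity in
  \<open>x\<close> and boundedness can be read off.\<close>

definition rip_dev :: "nat \<Rightarrow> nat \<Rightarrow> real \<Rightarrow> complex mat \<Rightarrow> complex vec \<Rightarrow> real" where
  "rip_dev n d c M x = \<bar>c * (\<Sum>r<n. (cmod (\<Sum>j<d. M $$ (r, j) * x $ j))\<^sup>2) - (\<Sum>j<d. (cmod (x $ j))\<^sup>2)\<bar>"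

lemma rip_dev_eq:
  assumes "M \<in> carrier_mat n d" "x \<in> carrier_vec d"
  shows "\<bar>c * (vec_norm2 (M *\<^sub>v x))\<^sup>2 - (vec_norm2 x)\<^sup>2\<bar> = rip_dev n d c M x"
  unfolding rip_dev_def vec_norm2_mult_square[OF assms] vec_norm2_square[OF assms(2)] ..

lemma sparse_unit_ball_entry: "x \<in> sparse_unit_ball d k \<Longrightarrow> j < d \<Longrightarrow> cmod (x $ j) \<le> 1"
  using sparse_ball_coord[OF vfun_in_sparse_ball, of x d k j] by (simp add: vfun_def)

lemma zero_in_sparse_unit_ball: "0\<^sub>v d \<in> sparse_unit_ball d k"
  by (simp add: sparse_unit_ball_def nnz_def vec_norm2_def L2_set_def cong: conj_cong)

text \<open>Gives boundedness, without which a real \<open>SUP\<close> has no useful value; the same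
  bound yields integrability in the theorem.\<close>

lemma rip_dev_le:
  assumes "x \<in> sparse_unit_ball d k"
  shows "rip_dev n d c M x \<le> \<bar>c\<bar> * (\<Sum>r<n. (\<Sum>j<d. cmod (M $$ (r, j)))\<^sup>2) + real d"
proof -
  note x = sparse_unit_ball_entry[OF assms]
  have "(\<Sum>j<d. (cmod (x $ j))\<^sup>2) \<le> (\<Sum>j<d. 1)" using x by (intro sum_mono) (simp add: power_le_one_iff)
  then have 1: "\<bar>\<Sum>j<d. (cmod (x $ j))\<^sup>2\<bar> \<le> real d" by (simp add: sum_nonneg)
  have "(\<Sum>r<n. (cmod (\<Sum>j<d. M $$ (r, j) * x $ j))\<^sup>2) \<le> (\<Sum>r<n. (\<Sum>j<d. cmod (M $$ (r, j)))\<^sup>2)"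
  proof (intro sum_mono power_mono)
    fix r
    have "cmod (M $$ (r, j) * x $ j) \<le> cmod (M $$ (r, j))" if "j < d" for j
      using mult_left_mono[OF x[OF that], of "cmod (M $$ (r, j))"] by (simp add: norm_mult)
    then show "cmod (\<Sum>j<d. M $$ (r, j) * x $ j) \<le> (\<Sum>j<d. cmod (M $$ (r, j)))"
      by (intro order_trans[OF norm_sum] sum_mono) simp
  qed simp
  then have "\<bar>c\<bar> * \<bar>\<Sum>r<n. (cmod (\<Sum>j<d. M $$ (r, j) * x $ j))\<^sup>2\<bar> \<le> \<bar>c\<bar> * (\<Sum>r<n. (\<Sum>j<d. cmod (M $$ (r, j)))\<^sup>2)"
    by (intro mult_left_mono) (simp_all add: sum_nonneg)
  then show ?thesis using 1 unfolding rip_dev_def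
    by (intro order_trans[OF abs_triangle_ineq4]) (simp add: abs_mult)
qed

lemma SUP_rip_dev:
  assumes M: "M \<in> carrier_mat n d"
  shows "(SUP x\<in>sparse_unit_ball d k. \<bar>c * (vec_norm2 (M *\<^sub>v x))\<^sup>2 - (vec_norm2 x)\<^sup>2\<bar>) = (SUP x\<in>sparse_unit_ball d k. rip_dev n d c M x)"
    and "(SUP x\<in>sparse_unit_ball d k. rip_dev n d c M x) \<le> t \<longleftrightarrow> (\<forall>x\<in>sparse_unit_ball d k. rip_dev n d c M x \<le> t)"
proof -
  show "(SUP x\<in>sparse_unit_ball d k. \<bar>c * (vec_norm2 (M *\<^sub>v x))\<^sup>2 - (vec_norm2 x)\<^sup>2\<bar>) = (SUP x\<in>sparse_unit_ball d k. rip_dev n d c M x)"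
    by (rule SUP_cong[OF refl]) (rule rip_dev_eq[OF M], simp add: sparse_unit_ball_def)
  have "bdd_above (rip_dev n d c M ` sparse_unit_ball d k)"
    by (rule bdd_aboveI2) (rule rip_dev_le)
  then show "(SUP x\<in>sparse_unit_ball d k. rip_dev n d c M x) \<le> t \<longleftrightarrow> (\<forall>x\<in>sparse_unit_ball d k. rip_dev n d c M x \<le> t)"
    using zero_in_sparse_unit_ball by (intro cSUP_le_iff) auto
qed

text \<open>Rounding towards zero with mesh \<open>1 / Suc n\<close>. No modulus grows and zeros are
  kept, so rounded vectors stay in the sparse ball.\<close>

definition rtrunc :: "nat \<Rightarrow> real \<Rightarrow> real" where
  "rtrunc n t = sgn t * (real_of_int \<lfloor>\<bar>t\<bar> * real (Suc n)\<rfloor> / real (Suc n))"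

lemma rtrunc: "\<bar>rtrunc n t\<bar> \<le> \<bar>t\<bar>" "rtrunc n t \<in> \<rat>" "(\<lambda>n. rtrunc n t) \<longlonglongrightarrow> t"
proof -
  define q where "q = (\<lambda>n. real_of_int \<lfloor>\<bar>t\<bar> * real (Suc n)\<rfloor> / real (Suc n))"
  have q: "q n \<le> \<bar>t\<bar>" "\<bar>t\<bar> - 1 / real (Suc n) \<le> q n" "0 \<le> q n" for n
  proof -
    have f: "real_of_int \<lfloor>\<bar>t\<bar> * real (Suc n)\<rfloor> \<le> \<bar>t\<bar> * real (Suc n)" "\<bar>t\<bar> * real (Suc n) - 1 \<le> real_of_int \<lfloor>\<bar>t\<bar> * real (Suc n)\<rfloor>"
      by linarith+
    show "q n \<le> \<bar>t\<bar>" unfolding q_def using f(1) by (simp add: divide_le_eq)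
    have "(\<bar>t\<bar> * real (Suc n) - 1) / real (Suc n) \<le> q n" unfolding q_def using f(2) by (rule divide_right_mono) simp
    then show "\<bar>t\<bar> - 1 / real (Suc n) \<le> q n" by (simp add: diff_divide_distrib)
    show "0 \<le> q n" unfolding q_def by simp
  qed
  have rq: "rtrunc n t = sgn t * q n" for n by (simp add: rtrunc_def q_def)
  show "\<bar>rtrunc n t\<bar> \<le> \<bar>t\<bar>" unfolding rq using q(1,3)[of n] by (auto simp: abs_mult sgn_if)
  show "rtrunc n t \<in> \<rat>" unfolding rtrunc_def by (auto simp: sgn_if intro!: Rats_divide)
  have "q \<longlonglongrightarrow> \<bar>t\<bar>"
  proof (rule tendsto_sandwich[where f = "\<lambda>n. \<bar>t\<bar> - 1 / real (Suc n)" and h = "\<lambda>n. \<bar>t\<bar>"])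
    have "(\<lambda>n. \<bar>t\<bar> - 1 / real (Suc n)) \<longlonglongrightarrow> \<bar>t\<bar> - 0"
      by (intro tendsto_diff tendsto_const LIMSEQ_inverse_real_of_nat[unfolded inverse_eq_divide])
    then show "(\<lambda>n. \<bar>t\<bar> - 1 / real (Suc n)) \<longlonglongrightarrow> \<bar>t\<bar>" by simp
  qed (use q in auto)
  then have "(\<lambda>n. sgn t * q n) \<longlonglongrightarrow> sgn t * \<bar>t\<bar>" by (intro tendsto_mult tendsto_const)
  then show "(\<lambda>n. rtrunc n t) \<longlonglongrightarrow> t" by (simp add: rq mult_sgn_abs)
qed

definition rational_vecs :: "nat \<Rightarrow> complex vec set" where
  "rational_vecs d = {x \<in> carrier_vec d. \<forall>j<d. Re (x $ j) \<in> \<rat> \<and> Im (x $ j) \<in> \<rat>}"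

lemma countable_rational_vecs: "countable (rational_vecs d)"
proof -
  define Q where "Q = (\<lambda>(p, q). Complex p q) ` (\<rat> \<times> \<rat>)"
  have "countable Q" unfolding Q_def by (intro countable_image countable_SIGMA countable_rat)
  then have "countable (PiE {..<d} (\<lambda>_. Q))" by (intro countable_PiE) auto
  then have "countable (vec d ` PiE {..<d} (\<lambda>_. Q))" by (rule countable_image)
  moreover have "rational_vecs d \<subseteq> vec d ` PiE {..<d} (\<lambda>_. Q)"
  proof
    fix x assume x: "x \<in> rational_vecs d"
    show "x \<in> vec d ` PiE {..<d} (\<lambda>_. Q)"
    proof (rule image_eqI)
      show "x = vec d (restrict (\<lambda>j. x $ j) {..<d})" using x by (auto simp: rational_vecs_def)
      have "x $ j \<in> Q" if "j < d" for j
        unfolding Q_def using x that by (intro image_eqI[of _ _ "(Re (x $ j), Im (x $ j))"]) (auto simp: rational_vecs_def)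
      then show "restrict (\<lambda>j. x $ j) {..<d} \<in> PiE {..<d} (\<lambda>_. Q)" by auto
    qed
  qed
  ultimately show ?thesis by (rule countable_subset[rotated])
qed

text \<open>By continuity in \<open>x\<close>, countably many test vectors decide the bound. This is
  the source of measurability for the suprema.\<close>

lemma all_sparse_unit_ball_iff_rational:
  "(\<forall>x\<in>sparse_unit_ball d k. rip_dev n d c M x \<le> t) \<longleftrightarrow>
   (\<forall>x\<in>sparse_unit_ball d k \<inter> rational_vecs d. rip_dev n d c M x \<le> t)"
proof (intro iffI ballI)
  fix x assume *: "\<forall>x\<in>sparse_unit_ball d k \<inter> rational_vecs d. rip_dev n d c M x \<le> t" and x: "x \<in> sparse_unit_ball d k"
  then have cx: "x \<in> carrier_vec d" by (simp add: sparse_unit_ball_def)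
  define y where "y = (\<lambda>N. vec d (\<lambda>j. Complex (rtrunc N (Re (x $ j))) (rtrunc N (Im (x $ j)))))"
  have yc: "y N \<in> carrier_vec d" for N by (simp add: y_def)
  have yj: "y N $ j = Complex (rtrunc N (Re (x $ j))) (rtrunc N (Im (x $ j)))" if "j < d" for N j
    using that by (simp add: y_def)
  have y_le: "cmod (y N $ j) \<le> cmod (x $ j)" if "j < d" for N j
    unfolding yj[OF that] cmod_def using rtrunc(1)
    by (intro real_sqrt_le_mono add_mono) (simp_all add: abs_le_square_iff)
  have y_ball: "y N \<in> sparse_unit_ball d k" for N
  proof -
    have "{i. i < dim_vec (y N) \<and> y N $ i \<noteq> 0} \<subseteq> {i. i < dim_vec x \<and> x $ i \<noteq> 0}"
      using cx yc[of N] y_le[of _ N] by fastforce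
    then have "nnz (y N) \<le> nnz x" unfolding nnz_def by (intro card_mono) auto
    moreover have "(vec_norm2 (y N))\<^sup>2 \<le> (vec_norm2 x)\<^sup>2"
      unfolding vec_norm2_square[OF yc] vec_norm2_square[OF cx] using y_le by (intro sum_mono power_mono) auto
    then have "vec_norm2 (y N) \<le> vec_norm2 x" by (rule power2_le_imp_le) (rule vec_norm2_nonneg)
    ultimately show ?thesis using x yc[of N] by (simp add: sparse_unit_ball_def)
  qed
  have y_rat: "y N \<in> rational_vecs d" for N
    using yc yj rtrunc(2) by (simp add: rational_vecs_def)
  have lim: "(\<lambda>N. y N $ j) \<longlonglongrightarrow> x $ j" if "j < d" for j
  proof -
    have "(\<lambda>N. Complex (rtrunc N (Re (x $ j))) (rtrunc N (Im (x $ j)))) \<longlonglongrightarrow> Complex (Re (x $ j)) (Im (x $ j))"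
      by (intro tendsto_Complex rtrunc(3))
    then show ?thesis using that by (simp add: yj)
  qed
  have "(\<lambda>N. rip_dev n d c M (y N)) \<longlonglongrightarrow> rip_dev n d c M x"
    unfolding rip_dev_def by (intro tendsto_intros lim) auto
  moreover have "rip_dev n d c M (y N) \<le> t" for N using * y_ball y_rat by blast
  ultimately show "rip_dev n d c M x \<le> t" by (intro LIMSEQ_le_const2) auto
qed blast

lemma sets_all_rip_dev_le:
  assumes meas: "\<And>r j. r < n \<Longrightarrow> j < d \<Longrightarrow> (\<lambda>\<omega>. F \<omega> $$ (r, j)) \<in> borel_measurable \<Omega>"
  shows "{\<omega> \<in> space \<Omega>. \<forall>x\<in>sparse_unit_ball d k. rip_dev n d c (F \<omega>) x \<le> t} \<in> sets \<Omega>"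
  unfolding all_sparse_unit_ball_iff_rational
proof (rule sets.sets_Collect_countable_All')
  show "countable (sparse_unit_ball d k \<inter> rational_vecs d)" 
    by (rule countable_subset[OF _ countable_rational_vecs]) blast
  fix x
  have "(\<lambda>\<omega>. rip_dev n d c (F \<omega>) x) \<in> borel_measurable \<Omega>"
    unfolding rip_dev_def
    by (intro borel_measurable_abs borel_measurable_diff borel_measurable_times borel_measurable_const
        borel_measurable_sum borel_measurable_power borel_measurable_norm meas measurable_compose[OF _ borel_measurable_norm]) auto
  then show "{\<omega> \<in> space \<Omega>. rip_dev n d c (F \<omega>) x \<le> t} \<in> sets \<Omega>" by measurable
qed

lemma measurable_mat_entry:
  assumes "sets \<A> = sets (mat_borel n d)" "r < n" "j < d"
  shows "(\<lambda>A. A $$ (r, j)) \<in> borel_measurable \<A>"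
proof -
  let ?P = "{..<n} \<times> {..<d}" 
  let ?f = "\<lambda>A. \<lambda>p\<in>?P. (A $$ p :: complex)"
  have "?f \<in> measurable (mat_borel n d) (\<Pi>\<^sub>M p\<in>?P. borel)"
    unfolding mat_borel_def by (rule measurable_vimage_algebra1) (auto simp: space_PiM)
  moreover have "(\<lambda>w. w (r, j)) \<in> borel_measurable (\<Pi>\<^sub>M p\<in>?P. (borel :: complex measure))"
    using assms by (intro measurable_component_singleton) auto
  ultimately have "(\<lambda>A. ?f A (r, j)) \<in> borel_measurable (mat_borel n d)" by (rule measurable_compose)
  then have "(\<lambda>A. A $$ (r, j)) \<in> borel_measurable (mat_borel n d)" using assms by simp
  then show ?thesis by (simp add: measurable_cong_sets[OF assms(1) refl])
qed

lemma measurable_sign: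
  assumes "b < m" "i < B"
  shows "(\<lambda>\<sigma>. \<sigma> (b, i)) \<in> borel_measurable (signs m B)"
proof -
  have "(\<lambda>\<sigma>. \<sigma> (b, i)) \<in> measurable (signs m B) (uniform_count_measure {-1, 1 :: real})"
    unfolding signs_def using assms by (intro measurable_component_singleton) auto
  moreover have "(\<lambda>t. t) \<in> borel_measurable (uniform_count_measure {-1, 1 :: real})"
    by (simp add: measurable_def sets_uniform_count_measure space_uniform_count_measure)
  ultimately show ?thesis by (rule measurable_compose)
qed

text \<open>Homogeneity: a nonzero vector is normalised, and the zero vector is treated
  directly.\<close>

lemma RIP_of_sparse_unit_ball:
  assumes M: "M \<in> carrier_mat n d" and c: "0 < c"
    and le: "\<forall>x\<in>sparse_unit_ball d k. rip_dev n d c M x \<le> \<delta>"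
  shows "RIP \<delta> k (complex_of_real (sqrt c) \<cdot>\<^sub>m M)"
  unfolding RIP_def
proof (intro ballI impI)
  let ?P = "complex_of_real (sqrt c) \<cdot>\<^sub>m M"
  have P: "?P \<in> carrier_mat n d" using M by simp
  fix x assume "x \<in> carrier_vec (dim_col ?P)" and nz: "nnz x \<le> k"
  then have x: "x \<in> carrier_vec d" using M by simp
  define S where "S = (\<lambda>x :: complex vec. \<Sum>r<n. (cmod (\<Sum>j<d. M $$ (r, j) * x $ j))\<^sup>2)"
  have PS: "(vec_norm2 (?P *\<^sub>v x))\<^sup>2 = c * S x"
  proof -
    have "(\<Sum>j<d. ?P $$ (r, j) * x $ j) = complex_of_real (sqrt c) * (\<Sum>j<d. M $$ (r, j) * x $ j)" if "r < n" for r
      using M that by (simp add: sum_distrib_left mult.assoc)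
    then have "(cmod (\<Sum>j<d. ?P $$ (r, j) * x $ j))\<^sup>2 = c * (cmod (\<Sum>j<d. M $$ (r, j) * x $ j))\<^sup>2" if "r < n" for r
      using c that by (simp only: norm_mult norm_of_real power_mult_distrib) simp
    then show ?thesis unfolding vec_norm2_mult_square[OF P x] S_def by (simp add: sum_distrib_left)
  qed
  define N where "N = vec_norm2 x"
  have "\<bar>c * S x - N\<^sup>2\<bar> \<le> \<delta> * N\<^sup>2"
  proof (cases "N = 0")
    case True
    then have "(\<Sum>j<d. (cmod (x $ j))\<^sup>2) = 0" using vec_norm2_square[OF x] by (simp add: N_def)
    then have "x $ j = 0" if "j < d" for j using that by (simp add: sum_nonneg_eq_0_iff)
    then have "S x = 0" by (simp add: S_def)
    then show ?thesis using True by simp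
  next
    case False
    then have N: "N > 0" using vec_norm2_nonneg[of x] by (simp add: N_def)
    define y where "y = complex_of_real (1 / N) \<cdot>\<^sub>v x"
    have y: "y \<in> carrier_vec d" using x by (simp add: y_def)
    have yj: "y $ j = complex_of_real (1 / N) * x $ j" if "j < d" for j using that x by (simp add: y_def)
    have "(vec_norm2 y)\<^sup>2 = (\<Sum>j<d. (1 / N)\<^sup>2 * (cmod (x $ j))\<^sup>2)"
      unfolding vec_norm2_square[OF y] using N by (intro sum.cong refl) (simp add: yj norm_mult norm_divide power_divide)
    also have "\<dots> = (1 / N)\<^sup>2 * N\<^sup>2" unfolding N_def vec_norm2_square[OF x] sum_distrib_left ..
    also have "\<dots> = 1" using N by (simp add: power_divide)
    finally have yn: "(vec_norm2 y)\<^sup>2 = 1" .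
    then have "vec_norm2 y \<le> 1" using vec_norm2_nonneg[of y] by (simp add: power2_eq_1_iff)
    moreover have "nnz y = nnz x" unfolding nnz_def using x N by (intro arg_cong[where f = card] Collect_cong) (auto simp: y_def)
    ultimately have "y \<in> sparse_unit_ball d k" using y nz by (simp add: sparse_unit_ball_def)
    then have "rip_dev n d c M y \<le> \<delta>" using le by blast
    moreover have "S y = S x / N\<^sup>2"
    proof -
      have "(\<Sum>j<d. M $$ (r, j) * y $ j) = complex_of_real (1 / N) * (\<Sum>j<d. M $$ (r, j) * x $ j)" for r
        unfolding sum_distrib_left by (intro sum.cong refl) (simp add: yj)
      then show ?thesis unfolding S_def sum_divide_distrib
        using N by (intro sum.cong refl) (simp add: norm_mult norm_divide power_divide)
    qed
    moreover have "rip_dev n d c M y = \<bar>c * S y - (vec_norm2 y)\<^sup>2\<bar>"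
      by (simp add: rip_dev_def S_def vec_norm2_square[OF y])
    ultimately have "\<bar>c * (S x / N\<^sup>2) - 1\<bar> \<le> \<delta>" using yn by simp
    then have "\<bar>c * (S x / N\<^sup>2) - 1\<bar> * N\<^sup>2 \<le> \<delta> * N\<^sup>2" by (rule mult_right_mono) simp
    moreover have "\<bar>c * (S x / N\<^sup>2) - 1\<bar> * N\<^sup>2 = \<bar>(c * (S x / N\<^sup>2) - 1) * N\<^sup>2\<bar>" by (simp add: abs_mult)
    moreover have "(c * (S x / N\<^sup>2) - 1) * N\<^sup>2 = c * S x - N\<^sup>2" using N by (simp add: algebra_simps)
    ultimately show ?thesis by simp
  qed
  then show "(1 - \<delta>) * (vec_norm2 x)\<^sup>2 \<le> (vec_norm2 (?P *\<^sub>v x))\<^sup>2 \<and> (vec_norm2 (?P *\<^sub>v x))\<^sup>2 \<le> (1 + \<delta>) * (vec_norm2 x)\<^sup>2"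
    unfolding PS N_def[symmetric] by (simp add: abs_le_iff algebra_simps)
qed

section \<open>The restricted isometry property\<close>

text \<open>For \<open>ln m \<ge> 1\<close> this is (iii) at \<open>s = k\<close> combined with
  (iv). For smaller \<open>m\<close>, \<open>l\<close> must still be at least 1, and the entry bound
  \<open>R = sqrt k * sqrt B\<close> with \<open>l = 1\<close> takes over.\<close>

lemma operator_bound_cases:
  fixes Q\<^sub>1 Q\<^sub>2 :: real
  assumes a: "\<And>b i j. b < m \<Longrightarrow> i < B \<Longrightarrow> j < d \<Longrightarrow> cmod (a b i j) \<le> 1"
    and pos: "0 < k" "0 < m" "0 < B" "0 < Q\<^sub>1" "0 < Q\<^sub>2"
    and Q: "\<And>y b. y \<in> sparse_ball d k \<Longrightarrow> b < m \<Longrightarrow> sqrt (bn B (app d a y) b) \<le> Q\<^sub>1 * sqrt (real B) + Q\<^sub>2 * sqrt (real k)"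
    and B: "Q\<^sub>2\<^sup>2 * (ln (real m))\<^sup>2 \<le> real B" and k: "Q\<^sub>1\<^sup>2 * (ln (real m))\<^sup>2 \<le> real k"
  shows "\<exists>R l. 0 \<le> R \<and> 1 \<le> l \<and> ln (real m) \<le> l \<and> R * l \<le> 2 * sqrt (real k * real B) \<and>
    (\<forall>y\<in>sparse_ball d k. \<forall>b<m. sqrt (bn B (app d a y) b) \<le> R)"
proof (cases "1 \<le> ln (real m)")
  case True
  let ?l = "ln (real m)"
  show ?thesis
  proof (rule exI[of _ "Q\<^sub>1 * sqrt (real B) + Q\<^sub>2 * sqrt (real k)"], rule exI[of _ ?l], intro conjI ballI allI impI)
    have "Q\<^sub>1 * ?l \<le> sqrt (real k)" using k by (intro real_le_rsqrt) (simp add: power_mult_distrib)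
    then have "(Q\<^sub>1 * ?l) * sqrt (real B) \<le> sqrt (real k) * sqrt (real B)" by (rule mult_right_mono) simp
    moreover have "Q\<^sub>2 * ?l \<le> sqrt (real B)" using B by (intro real_le_rsqrt) (simp add: power_mult_distrib)
    then have "(Q\<^sub>2 * ?l) * sqrt (real k) \<le> sqrt (real B) * sqrt (real k)" by (rule mult_right_mono) simp
    ultimately show "(Q\<^sub>1 * sqrt (real B) + Q\<^sub>2 * sqrt (real k)) * ?l \<le> 2 * sqrt (real k * real B)"
      by (simp add: real_sqrt_mult algebra_simps)
  qed (use True pos Q in auto)
next
  case False
  show ?thesis
  proof (rule exI[of _ "sqrt (real k) * sqrt (real B)"], rule exI[of _ 1], intro conjI ballI allI impI)
    fix y b assume y: "y \<in> sparse_ball d k" and b: "b < m"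
    show "sqrt (bn B (app d a y) b) \<le> sqrt (real k) * sqrt (real B)"
    proof (rule sqrt_bn_le_entries)
      fix i assume i: "i < B"
      have "cmod (app d a y b i) \<le> sqrt (real (min k d))" by (rule app_entry_le[OF y]) (rule a[OF b i])
      also have "\<dots> \<le> sqrt (real k)" by simp
      finally show "cmod (app d a y b i) \<le> sqrt (real k)" .
    qed simp
  qed (use False in \<open>auto simp: real_sqrt_mult\<close>)
qed

text \<open>The part for a fixed \<open>A\<close>. In the constant, 48 is 3 times the Markov factor
  16, \<open>1 + c\<close> bounds the normalised squared norm of \<open>A x\<close>, and the last
  \<open>c\<close> is the deviation of \<open>A\<close> itself.\<close>

lemma signs_good:
  fixes \<epsilon> c Q\<^sub>1 Q\<^sub>2 :: real
  assumes A: "A \<in> carrier_mat (m * B) d"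
    and ent: "\<And>i j. i < m * B \<Longrightarrow> j < d \<Longrightarrow> cmod (A $$ (i, j)) \<le> 1"
    and pos: "0 < k" "2 \<le> d" "0 < m" "0 < B" "0 < \<epsilon>" "\<epsilon> < 1" "0 < c" "0 < Q\<^sub>1" "0 < Q\<^sub>2"
    and Q: "\<And>b x. b < m \<Longrightarrow> x \<in> sparse_unit_ball d k \<Longrightarrow> vec_norm2 (block B A b *\<^sub>v x) \<le> Q\<^sub>1 * sqrt (real B) + Q\<^sub>2 * sqrt (real k)"
    and dev: "\<forall>x\<in>sparse_unit_ball d k. rip_dev (m * B) d (1 / real (m * B)) A x \<le> c * \<epsilon>"
    and B: "Q\<^sub>2\<^sup>2 * (ln (real m))\<^sup>2 \<le> real B" and k: "Q\<^sub>1\<^sup>2 * (ln (real m))\<^sup>2 \<le> real k"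
    and m: "real k * ln (real d) * (ln (real (B * k)))\<^sup>2 \<le> real m * \<epsilon>\<^sup>2"
  shows "\<exists>S. S \<subseteq> sgns m B \<and> 15 / 16 \<le> measure (signs m B) S \<and>
    (\<forall>\<sigma>\<in>S. \<forall>x\<in>sparse_unit_ball d k. rip_dev m d (1 / real (m * B)) (signed_mat m B A \<sigma>) x \<le> (48 * 51200\<^sup>2 * (1 + c) + c) * \<epsilon>)"
proof -
  let ?M = "real (m * B)"
  let ?a = "bent B A"
  have M: "?M > 0" using pos by simp
  have car: "x \<in> carrier_vec d" if "x \<in> sparse_unit_ball d k" for x using that by (simp add: sparse_unit_ball_def)
  have a: "cmod (?a b i j) \<le> 1" if "b < m" "i < B" "j < d" for b i j
  proof -
    have "B * b + i < B * (b + 1)" using that by simp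
    also have "\<dots> \<le> B * m" using that by (intro mult_left_mono) auto
    finally show ?thesis unfolding bent_def block_index_def using that by (intro ent) (simp_all add: mult.commute)
  qed
  have devA: "\<bar>1 / ?M * tot m B (app d ?a (vfun d x)) - (vec_norm2 x)\<^sup>2\<bar> \<le> c * \<epsilon>" if x: "x \<in> sparse_unit_ball d k" for x
    using dev x unfolding tot_app_bent[OF A car[OF x]] rip_dev_eq[OF A car[OF x]] by blast
  have tot: "tot m B (app d ?a y) \<le> (1 + c) * ?M" if y: "y \<in> sparse_ball d k" for y
  proof -
    obtain x where x: "x \<in> sparse_unit_ball d k" "y = vfun d x" using sparse_ball_eq_vfun[OF y] by blast
    have "(vec_norm2 x)\<^sup>2 \<le> 1" using x vec_norm2_nonneg[of x] by (simp add: sparse_unit_ball_def power_le_one)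
    moreover have "c * \<epsilon> \<le> c * 1" using pos by (intro mult_left_mono) auto
    ultimately have "1 / ?M * tot m B (app d ?a y) \<le> 1 + c" using devA[OF x(1)] unfolding x(2) by linarith
    then show ?thesis using M by (simp add: divide_le_eq)
  qed
  have Q': "sqrt (bn B (app d ?a y) b) \<le> Q\<^sub>1 * sqrt (real B) + Q\<^sub>2 * sqrt (real k)" if y: "y \<in> sparse_ball d k" and b: "b < m" for y b
  proof -
    obtain x where x: "x \<in> sparse_unit_ball d k" "y = vfun d x" using sparse_ball_eq_vfun[OF y] by blast
    show ?thesis unfolding x(2) bn_app_bent[OF A car[OF x(1)]] using Q[OF b x(1)] vec_norm2_nonneg by simp
  qed
  have "\<exists>R l. 0 \<le> R \<and> 1 \<le> l \<and> ln (real m) \<le> l \<and> R * l \<le> 2 * sqrt (real k * real B) \<and>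
    (\<forall>y\<in>sparse_ball d k. \<forall>b<m. sqrt (bn B (app d ?a y) b) \<le> R)"
  proof (rule operator_bound_cases)
    show "cmod (?a b i j) \<le> 1" if "b < m" "i < B" "j < d" for b i j using that by (rule a)
    show "0 < k" "0 < m" "0 < B" "0 < Q\<^sub>1" "0 < Q\<^sub>2" by (fact pos)+
    show "sqrt (bn B (app d ?a y) b) \<le> Q\<^sub>1 * sqrt (real B) + Q\<^sub>2 * sqrt (real k)"
      if "y \<in> sparse_ball d k" "b < m" for y b using that by (rule Q')
    show "Q\<^sub>2\<^sup>2 * (ln (real m))\<^sup>2 \<le> real B" by (fact B)
    show "Q\<^sub>1\<^sup>2 * (ln (real m))\<^sup>2 \<le> real k" by (fact k)
  qed
  then obtain R l where Rl: "0 \<le> R" "1 \<le> l" "ln (real m) \<le> l" "R * l \<le> 2 * sqrt (real k * real B)"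
    and R: "\<And>y b. y \<in> sparse_ball d k \<Longrightarrow> b < m \<Longrightarrow> sqrt (bn B (app d ?a y) b) \<le> R"
    by auto
  have "\<exists>h. (\<forall>\<sigma>\<in>sgns m B. 0 \<le> h \<sigma> \<and> (\<forall>x\<in>sparse_ball d k. \<bar>sqn m B \<sigma> (app d ?a x) - tot m B (app d ?a x)\<bar> \<le> h \<sigma>)) \<and>
    avg (sgns m B) h \<le> 3 * 51200\<^sup>2 * (1 + c) * \<epsilon> * ?M"
  proof (rule sign_average_bound[where R = R and l = l])
    show "cmod (?a b i j) \<le> 1" if "b < m" "i < B" "j < d" for b i j using that by (rule a)
    show "0 < k" "2 \<le> d" "0 < m" "0 < B" "0 < \<epsilon>" "\<epsilon> < 1" by (fact pos)+
    show "1 \<le> 1 + c" using pos by simp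
    show "sqrt (bn B (app d ?a y) b) \<le> R" if "y \<in> sparse_ball d k" "b < m" for y b using that by (rule R)
    show "0 \<le> R" "1 \<le> l" "ln (real m) \<le> l" "R * l \<le> 2 * sqrt (real k * real B)" by (fact Rl)+
    show "tot m B (app d ?a x) \<le> (1 + c) * ?M" if "x \<in> sparse_ball d k" for x using that by (rule tot)
    show "real k * ln (real d) * (ln (real (B * k)))\<^sup>2 \<le> real m * \<epsilon>\<^sup>2" by (fact m)
  qed
  then obtain h where h: "\<And>\<sigma>. \<sigma> \<in> sgns m B \<Longrightarrow> 0 \<le> h \<sigma>"
      "\<And>\<sigma> x. \<sigma> \<in> sgns m B \<Longrightarrow> x \<in> sparse_ball d k \<Longrightarrow> \<bar>sqn m B \<sigma> (app d ?a x) - tot m B (app d ?a x)\<bar> \<le> h \<sigma>"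
    and avg: "avg (sgns m B) h \<le> 3 * 51200\<^sup>2 * (1 + c) * \<epsilon> * ?M"
    by auto
  let ?t = "3 * 51200\<^sup>2 * (1 + c) * \<epsilon> * ?M"
  let ?S = "{\<sigma> \<in> sgns m B. h \<sigma> \<le> 16 * ?t}"
  have "0 < ?t" using pos M by (intro mult_pos_pos) auto
  then have "1 - 1 / 16 \<le> measure (signs m B) ?S" using h(1) avg by (intro measure_signs_Markov) auto
  moreover have "rip_dev m d (1 / ?M) (signed_mat m B A \<sigma>) x \<le> (48 * 51200\<^sup>2 * (1 + c) + c) * \<epsilon>"
    if \<sigma>: "\<sigma> \<in> ?S" and x: "x \<in> sparse_unit_ball d k" for \<sigma> x
  proof -
    have cs: "signed_mat m B A \<sigma> \<in> carrier_mat m d" using A by (simp add: signed_mat_def)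
    let ?v = "app d ?a (vfun d x)"
    have "\<bar>sqn m B \<sigma> ?v - tot m B ?v\<bar> \<le> 16 * ?t" using h(2)[of \<sigma> "vfun d x"] \<sigma> vfun_in_sparse_ball[OF x] by auto
    then have "\<bar>sqn m B \<sigma> ?v - tot m B ?v\<bar> / ?M \<le> (16 * ?t) / ?M" using M by (intro divide_right_mono) auto
    moreover have "(16 * (3 * 51200\<^sup>2 * (1 + c) * \<epsilon> * q)) / q = 48 * 51200\<^sup>2 * (1 + c) * \<epsilon>" if "0 < q" for q
      using that by simp
    note this[OF M]
    ultimately have "\<bar>sqn m B \<sigma> ?v - tot m B ?v\<bar> / ?M \<le> 48 * 51200\<^sup>2 * (1 + c) * \<epsilon>" by (simp only:)
    then have "\<bar>1 / ?M * sqn m B \<sigma> ?v - 1 / ?M * tot m B ?v\<bar> \<le> 48 * 51200\<^sup>2 * (1 + c) * \<epsilon>"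
      using M by (simp add: diff_divide_distrib[symmetric] abs_divide)
    then have "\<bar>(1 / ?M * sqn m B \<sigma> ?v - 1 / ?M * tot m B ?v) + (1 / ?M * tot m B ?v - (vec_norm2 x)\<^sup>2)\<bar>
        \<le> 48 * 51200\<^sup>2 * (1 + c) * \<epsilon> + c * \<epsilon>"
      by (rule order_trans[OF abs_triangle_ineq add_mono[OF _ devA[OF x]]])
    then have "\<bar>1 / ?M * sqn m B \<sigma> ?v - (vec_norm2 x)\<^sup>2\<bar> \<le> 48 * 51200\<^sup>2 * (1 + c) * \<epsilon> + c * \<epsilon>"
      by (simp only: add_diff_eq diff_add_cancel)
    then show ?thesis
      unfolding rip_dev_eq[OF cs car[OF x], symmetric] sqn_app_bent[OF A car[OF x]] by (simp only: distrib_right)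
  qed
  ultimately show ?thesis by (intro exI[of _ ?S]) auto
qed

text \<open>Lets the bound on the \<open>SUP\<close> in (iii) pass to each single
  \<open>x\<close>.\<close>

lemma bdd_above_block:
  assumes A: "A \<in> carrier_mat (m * B) d"
  shows "bdd_above ((\<lambda>x. vec_norm2 (block B A b *\<^sub>v x)) ` sparse_unit_ball d s)"
proof -
  have c: "block B A b \<in> carrier_mat B d" using A by (simp add: block_def)
  have "vec_norm2 (block B A b *\<^sub>v x) \<le> sqrt ((\<Sum>r<B. (\<Sum>j<d. cmod (block B A b $$ (r, j)))\<^sup>2) + real d + 1)"
    if x: "x \<in> sparse_unit_ball d s" for x
  proof -
    have cx: "x \<in> carrier_vec d" using x by (simp add: sparse_unit_ball_def)
    have "(vec_norm2 x)\<^sup>2 \<le> 1" using x vec_norm2_nonneg[of x] by (simp add: sparse_unit_ball_def power_le_one)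
    moreover have "\<bar>1 * (vec_norm2 (block B A b *\<^sub>v x))\<^sup>2 - (vec_norm2 x)\<^sup>2\<bar>
        \<le> \<bar>1\<bar> * (\<Sum>r<B. (\<Sum>j<d. cmod (block B A b $$ (r, j)))\<^sup>2) + real d"
      unfolding rip_dev_eq[OF c cx] by (rule rip_dev_le[OF x])
    ultimately show ?thesis by (intro real_le_rsqrt) linarith
  qed
  then show ?thesis by (rule bdd_aboveI2)
qed

theorem theorem1:
  fixes C\<^sub>0 :: real
  assumes "C\<^sub>0 > 0"
  shows "\<exists>C>0. \<forall>(\<epsilon>::real) (d::nat) (k::nat) (m::nat) (B::nat) (L::real) (Q\<^sub>1::real) (Q\<^sub>2::real)
      (\<A> :: complex mat measure).
    0 < \<epsilon> \<and> \<epsilon> < 1 \<and> d \<ge> 2 \<and> k > 0 \<and> m > 0 \<and> B > 0 \<and> L > 0 \<and> Q\<^sub>1 > 0 \<and> Q\<^sub>2 > 0 \<longrightarrow>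
    prob_space \<A> \<longrightarrow> sets \<A> = sets (mat_borel (m * B) d) \<longrightarrow>
    (AE A in \<A>. \<forall>i<m * B. \<forall>j<d. cmod (A $$ (i, j)) \<le> 1) \<longrightarrow>
    (\<integral>A. (SUP x\<in>sparse_unit_ball d k.
        \<bar>1 / real (m * B) * (vec_norm2 (A *\<^sub>v x))\<^sup>2 - (vec_norm2 x)\<^sup>2\<bar>) \<partial>\<A>)
      \<le> C\<^sub>0 * sqrt (L / real (m * B)) \<longrightarrow>
    L \<le> real (m * B) * \<epsilon>\<^sup>2 \<longrightarrow>
    measure \<A> {A \<in> space \<A>. \<forall>s. 1 \<le> s \<and> s \<le> 2 * k \<longrightarrow>
        (MAX b\<in>{..<m}. SUP x\<in>sparse_unit_ball d s. vec_norm2 (block B A b *\<^sub>v x))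
          \<le> Q\<^sub>1 * sqrt (real B) + Q\<^sub>2 * sqrt (real s)} \<ge> 7 / 8 \<longrightarrow>
    real B \<ge> max (Q\<^sub>2\<^sup>2 * (ln (real m))\<^sup>2) (Q\<^sub>1\<^sup>2 * ln (real m) * ln (real k)) \<longrightarrow>
    real k \<ge> Q\<^sub>1\<^sup>2 * (ln (real m))\<^sup>2 \<longrightarrow>
    real m > real k * ln (real d) * (ln (real (B * k)))\<^sup>2 / \<epsilon>\<^sup>2 \<longrightarrow>
    measure (\<A> \<Otimes>\<^sub>M signs m B) {(A, \<sigma>) \<in> space (\<A> \<Otimes>\<^sub>M signs m B).
        (SUP x\<in>sparse_unit_ball d k.
          \<bar>1 / real (m * B) * (vec_norm2 (signed_mat m B A \<sigma> *\<^sub>v x))\<^sup>2 - (vec_norm2 x)\<^sup>2\<bar>)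
            \<le> C * \<epsilon> \<and>
        RIP (C * \<epsilon>) k (complex_of_real (1 / sqrt (real (m * B))) \<cdot>\<^sub>m signed_mat m B A \<sigma>)} \<ge> 3 / 4"
proof -
  \<comment> \<open>With this factor, Markov's inequality lets the deviation of \<open>A\<close>
    reach \<open>c * \<epsilon>\<close> with probability at most 1/16.\<close>
  define c where "c = 16 * C\<^sub>0"
  define C where "C = 48 * 51200\<^sup>2 * (1 + c) + c"
  have c: "c > 0" using assms by (simp add: c_def)
  then have C: "C > 0" by (simp add: C_def add_pos_pos)
  show ?thesis
  proof (intro exI[of _ C] conjI allI impI C)
    fix \<epsilon> :: real and d k m B :: nat and L Q\<^sub>1 Q\<^sub>2 :: real and \<A> :: "complex mat measure"
    assume pos: "0 < \<epsilon> \<and> \<epsilon> < 1 \<and> d \<ge> 2 \<and> k > 0 \<and> m > 0 \<and> B > 0 \<and> L > 0 \<and> Q\<^sub>1 > 0 \<and> Q\<^sub>2 > 0"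
      and prob: "prob_space \<A>" and sets: "sets \<A> = sets (mat_borel (m * B) d)"
      and ent: "AE A in \<A>. \<forall>i<m * B. \<forall>j<d. cmod (A $$ (i, j)) \<le> 1"
      and exp: "(\<integral>A. (SUP x\<in>sparse_unit_ball d k.
        \<bar>1 / real (m * B) * (vec_norm2 (A *\<^sub>v x))\<^sup>2 - (vec_norm2 x)\<^sup>2\<bar>) \<partial>\<A>) \<le> C\<^sub>0 * sqrt (L / real (m * B))"
      and L: "L \<le> real (m * B) * \<epsilon>\<^sup>2"
      and ev: "measure \<A> {A \<in> space \<A>. \<forall>s. 1 \<le> s \<and> s \<le> 2 * k \<longrightarrow>
        (MAX b\<in>{..<m}. SUP x\<in>sparse_unit_ball d s. vec_norm2 (block B A b *\<^sub>v x))
          \<le> Q\<^sub>1 * sqrt (real B) + Q\<^sub>2 * sqrt (real s)} \<ge> 7 / 8"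
      and Bge: "real B \<ge> max (Q\<^sub>2\<^sup>2 * (ln (real m))\<^sup>2) (Q\<^sub>1\<^sup>2 * ln (real m) * ln (real k))"
      and kge: "real k \<ge> Q\<^sub>1\<^sup>2 * (ln (real m))\<^sup>2"
      and mge: "real m > real k * ln (real d) * (ln (real (B * k)))\<^sup>2 / \<epsilon>\<^sup>2"
    interpret A: prob_space \<A> by (rule prob)
    interpret S: prob_space "signs m B" by (rule prob_space_signs)
    have M: "real (m * B) > 0" using pos by simp
    have space: "space \<A> = carrier_mat (m * B) d"
      using sets_eq_imp_space_eq[OF sets] by (simp add: mat_borel_def)
    let ?M = "real (m * B)"
    define g where "g = (\<lambda>A. SUP x\<in>sparse_unit_ball d k. rip_dev (m * B) d (1 / ?M) A x)"
    have g_le: "g A \<le> t \<longleftrightarrow> (\<forall>x\<in>sparse_unit_ball d k. rip_dev (m * B) d (1 / ?M) A x \<le> t)" if "A \<in> space \<A>" for A t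
      unfolding g_def by (rule SUP_rip_dev(2)) (use that space in simp)
    have g_nonneg: "0 \<le> g A" if "A \<in> space \<A>" for A
    proof -
      have "rip_dev (m * B) d (1 / ?M) A (0\<^sub>v d) \<le> g A" using g_le[OF that, of "g A"] zero_in_sparse_unit_ball by blast
      then show ?thesis by (simp add: rip_dev_def)
    qed
    have exp': "(\<integral>A. g A \<partial>\<A>) \<le> C\<^sub>0 * \<epsilon>"
    proof -
      have "(\<integral>A. g A \<partial>\<A>) \<le> C\<^sub>0 * sqrt (L / ?M)"
        using exp SUP_rip_dev(1)[where n = "m * B" and d = d and k = k and c = "1 / ?M"] unfolding g_def
        by (subst Bochner_Integration.integral_cong[OF refl]) (auto simp: space)
      also have "sqrt (L / ?M) \<le> sqrt (\<epsilon>\<^sup>2)" using L M by (intro real_sqrt_le_mono) (simp add: divide_le_eq mult.commute)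
      finally show ?thesis using assms pos by (simp add: mult_left_mono order_trans)
    qed
    have g_meas: "g \<in> borel_measurable \<A>"
      unfolding borel_measurable_iff_le
    proof
      fix t
      have "{A \<in> space \<A>. g A \<le> t} = {A \<in> space \<A>. \<forall>x\<in>sparse_unit_ball d k. rip_dev (m * B) d (1 / ?M) A x \<le> t}"
        using g_le by auto
      also have "\<dots> \<in> sets \<A>" by (rule sets_all_rip_dev_le[where F = "\<lambda>A. A"]) (rule measurable_mat_entry[OF sets])
      finally show "{A \<in> space \<A>. g A \<le> t} \<in> sets \<A>" .
    qed
    \<comment> \<open>A Bochner integral of a non-integrable function is 0 by convention, so (ii)
      can be used only after integrability has been derived, here from (i).\<close>
    have g_int: "integrable \<A> g"
    proof (rule A.integrable_const_bound[OF _ g_meas])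
      let ?b = "\<bar>1 / ?M\<bar> * (\<Sum>r<m * B. (\<Sum>j<d. 1)\<^sup>2) + real d"
      show "AE A in \<A>. norm (g A) \<le> ?b"
        using ent AE_space
      proof eventually_elim
        case (elim A)
        have "g A \<le> \<bar>1 / ?M\<bar> * (\<Sum>r<m * B. (\<Sum>j<d. cmod (A $$ (r, j)))\<^sup>2) + real d"
          unfolding g_le[OF elim(2)] by (intro ballI rip_dev_le)
        also have "\<dots> \<le> ?b"
          using elim(1) by (intro add_right_mono mult_left_mono sum_mono power_mono sum_nonneg) auto
        finally show ?case using g_nonneg[OF elim(2)] by simp
      qed
    qed
    define H where "H = {A \<in> space \<A>. \<forall>s. 1 \<le> s \<and> s \<le> 2 * k \<longrightarrow>
        (MAX b\<in>{..<m}. SUP x\<in>sparse_unit_ball d s. vec_norm2 (block B A b *\<^sub>v x))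
          \<le> Q\<^sub>1 * sqrt (real B) + Q\<^sub>2 * sqrt (real s)}"
    \<comment> \<open>A set outside the sigma-algebra has \<open>measure\<close> 0, so the lower
      bound 7/8 forces \<open>H\<close> to be measurable.\<close>
    have H: "H \<in> sets \<A>" "measure \<A> H \<ge> 7 / 8"
      using ev measure_notin_sets[of H \<A>] unfolding H_def[symmetric] by fastforce+
    define E where "E = {A \<in> space \<A>. \<forall>i<m * B. \<forall>j<d. cmod (A $$ (i, j)) \<le> 1}"
    have E: "E \<in> sets \<A>" "measure \<A> E = 1"
    proof -
      have "{A \<in> space \<A>. \<forall>p\<in>{..<m * B} \<times> {..<d}. cmod (A $$ p) \<le> 1} \<in> sets \<A>"
      proof (rule sets.sets_Collect_countable_All')
        fix p assume "p \<in> {..<m * B} \<times> {..<d}"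
        then have "(\<lambda>A. A $$ p) \<in> borel_measurable \<A>" using measurable_mat_entry[OF sets, of "fst p" "snd p"] by auto
        then show "{A \<in> space \<A>. cmod (A $$ p) \<le> 1} \<in> sets \<A>" by measurable
      qed (simp add: countable_finite)
      moreover have "{A \<in> space \<A>. \<forall>p\<in>{..<m * B} \<times> {..<d}. cmod (A $$ p) \<le> 1} = E" by (auto simp: E_def)
      ultimately show Es: "E \<in> sets \<A>" by simp
      have "AE A in \<A>. A \<in> E" using ent AE_space
      proof eventually_elim
        case (elim A)
        then show ?case unfolding E_def by (intro CollectI conjI)
      qed
      then show "measure \<A> E = 1" by (simp only: A.prob_eq_1[OF Es])
    qed
    define F where "F = {A \<in> space \<A>. g A \<ge> c * \<epsilon>}"
    have F: "F \<in> sets \<A>" unfolding F_def using g_meas by measurable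
    have Fm: "measure \<A> F \<le> 1 / 16"
    proof -
      have "measure \<A> F \<le> (\<integral>A. g A \<partial>\<A>) / (c * \<epsilon>)"
        unfolding F_def using c pos g_nonneg by (intro integral_Markov_inequality_measure[where A = "space \<A>"] g_int) auto
      also have "\<dots> \<le> (C\<^sub>0 * \<epsilon>) / (c * \<epsilon>)" using exp' c pos by (intro divide_right_mono) auto
      also have "\<dots> = 1 / 16" using assms pos by (simp add: c_def)
      finally show ?thesis .
    qed
    define Gd where "Gd = (H \<inter> E) - F"
    have Gd: "Gd \<in> sets \<A>" using H E F by (simp add: Gd_def)
    \<comment> \<open>This is 7/8 - 1/16, since \<open>E\<close> has full measure.\<close>
    have Gdm: "13 / 16 \<le> measure \<A> Gd"
    proof -
      have "measure \<A> (H \<union> E) = measure \<A> H + measure \<A> E - measure \<A> (H \<inter> E)"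
        using A.finite_measure_Union'[OF H(1) E(1)] A.finite_measure_Diff'[OF E(1) H(1)] by (simp add: Int_commute)
      moreover have "measure \<A> (H \<union> E) \<le> 1" by simp
      ultimately have "7 / 8 \<le> measure \<A> (H \<inter> E)" using H(2) E(2) by linarith
      moreover have "measure \<A> Gd = measure \<A> (H \<inter> E) - measure \<A> ((H \<inter> E) \<inter> F)"
        unfolding Gd_def using H E F by (intro A.finite_measure_Diff') auto
      moreover have "measure \<A> ((H \<inter> E) \<inter> F) \<le> measure \<A> F" using F by (intro A.finite_measure_mono) auto
      ultimately show ?thesis using Fm by linarith
    qed
    have good: "\<exists>S. S \<subseteq> sgns m B \<and> 15 / 16 \<le> measure (signs m B) S \<and>
        (\<forall>\<sigma>\<in>S. \<forall>x\<in>sparse_unit_ball d k. rip_dev m d (1 / ?M) (signed_mat m B A \<sigma>) x \<le> C * \<epsilon>)"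
      if A: "A \<in> Gd" for A
      unfolding C_def
    proof (rule signs_good)
      have sp: "A \<in> space \<A>" using A by (auto simp: Gd_def H_def)
      show car: "A \<in> carrier_mat (m * B) d" using sp space by simp
      show "cmod (A $$ (i, j)) \<le> 1" if "i < m * B" "j < d" for i j using A that by (auto simp: Gd_def E_def)
      show "0 < k" "2 \<le> d" "0 < m" "0 < B" "0 < \<epsilon>" "\<epsilon> < 1" "0 < Q\<^sub>1" "0 < Q\<^sub>2" using pos by auto
      show "0 < c" by (rule c)
      show "Q\<^sub>2\<^sup>2 * (ln (real m))\<^sup>2 \<le> real B" using Bge by simp
      show "Q\<^sub>1\<^sup>2 * (ln (real m))\<^sup>2 \<le> real k" by (rule kge)
      show "real k * ln (real d) * (ln (real (B * k)))\<^sup>2 \<le> real m * \<epsilon>\<^sup>2"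
        using mge pos by (simp add: divide_less_eq)
      have "g A \<le> c * \<epsilon>" using A sp by (auto simp: Gd_def F_def)
      then show "\<forall>x\<in>sparse_unit_ball d k. rip_dev (m * B) d (1 / ?M) A x \<le> c * \<epsilon>" unfolding g_le[OF sp] .
      fix b x assume b: "b < m" and x: "x \<in> sparse_unit_ball d k"
      have "vec_norm2 (block B A b *\<^sub>v x) \<le> (SUP x\<in>sparse_unit_ball d k. vec_norm2 (block B A b *\<^sub>v x))"
        by (rule cSUP_upper[OF x bdd_above_block[OF car]])
      also have "\<dots> \<le> (MAX b\<in>{..<m}. SUP x\<in>sparse_unit_ball d k. vec_norm2 (block B A b *\<^sub>v x))"
        using b by (intro Max_ge) auto
      also have "\<dots> \<le> Q\<^sub>1 * sqrt (real B) + Q\<^sub>2 * sqrt (real k)"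
        using A pos by (auto simp: Gd_def H_def)
      finally show "vec_norm2 (block B A b *\<^sub>v x) \<le> Q\<^sub>1 * sqrt (real B) + Q\<^sub>2 * sqrt (real k)" .
    qed
    let ?N = "\<A> \<Otimes>\<^sub>M signs m B"
    define W where "W = {\<omega> \<in> space ?N. \<forall>x\<in>sparse_unit_ball d k. rip_dev m d (1 / ?M) (signed_mat m B (fst \<omega>) (snd \<omega>)) x \<le> C * \<epsilon>}"
    have W: "W \<in> sets ?N"
      unfolding W_def
    proof (rule sets_all_rip_dev_le)
      fix r j assume rj: "r < m" "j < d"
      have "(\<lambda>\<omega>. \<Sum>i<B. complex_of_real (snd \<omega> (r, i)) * fst \<omega> $$ (block_index B r i, j)) \<in> borel_measurable ?N"
      proof (intro borel_measurable_sum borel_measurable_times)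
        fix i assume i: "i \<in> {..<B}"
        have "(\<lambda>\<omega>. snd \<omega> (r, i)) \<in> borel_measurable ?N"
          using i rj by (intro measurable_compose[OF measurable_snd measurable_sign]) auto
        then show "(\<lambda>\<omega>. complex_of_real (snd \<omega> (r, i))) \<in> borel_measurable ?N"
          by (rule measurable_compose[OF _ borel_measurable_continuous_onI]) (intro continuous_intros)
        have "B * r + i < B * (r + 1)" using i by simp
        also have "\<dots> \<le> B * m" using rj by (intro mult_left_mono) auto
        finally show "(\<lambda>\<omega>. fst \<omega> $$ (block_index B r i, j)) \<in> borel_measurable ?N"
          using rj unfolding block_index_def
          by (intro measurable_compose[OF measurable_fst measurable_mat_entry[OF sets]]) (simp_all add: mult.commute)
      qed
      moreover have "signed_mat m B (fst \<omega>) (snd \<omega>) $$ (r, j) = (\<Sum>i<B. complex_of_real (snd \<omega> (r, i)) * fst \<omega> $$ (block_index B r i, j))"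
        if "\<omega> \<in> space ?N" for \<omega>
        using that rj space by (auto simp: signed_mat_def space_pair_measure)
      ultimately show "(\<lambda>\<omega>. signed_mat m B (fst \<omega>) (snd \<omega>) $$ (r, j)) \<in> borel_measurable ?N"
        by (subst measurable_cong) auto
    qed
    \<comment> \<open>The restricted isometry property follows from the bound on the supremum, so
      the event is the measurable set \<open>W\<close>.\<close>
    have W_eq: "{(A, \<sigma>) \<in> space ?N.
        (SUP x\<in>sparse_unit_ball d k. \<bar>1 / ?M * (vec_norm2 (signed_mat m B A \<sigma> *\<^sub>v x))\<^sup>2 - (vec_norm2 x)\<^sup>2\<bar>) \<le> C * \<epsilon> \<and>
        RIP (C * \<epsilon>) k (complex_of_real (1 / sqrt ?M) \<cdot>\<^sub>m signed_mat m B A \<sigma>)} = W"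
    proof -
      have "(SUP x\<in>sparse_unit_ball d k. \<bar>1 / ?M * (vec_norm2 (signed_mat m B A \<sigma> *\<^sub>v x))\<^sup>2 - (vec_norm2 x)\<^sup>2\<bar>) \<le> C * \<epsilon> \<and>
          RIP (C * \<epsilon>) k (complex_of_real (1 / sqrt ?M) \<cdot>\<^sub>m signed_mat m B A \<sigma>) \<longleftrightarrow>
          (\<forall>x\<in>sparse_unit_ball d k. rip_dev m d (1 / ?M) (signed_mat m B A \<sigma>) x \<le> C * \<epsilon>)" (is "?l \<longleftrightarrow> ?r")
        if "(A, \<sigma>) \<in> space ?N" for A \<sigma>
      proof -
        have cs: "signed_mat m B A \<sigma> \<in> carrier_mat m d" using that space by (auto simp: signed_mat_def space_pair_measure)
        have "RIP (C * \<epsilon>) k (complex_of_real (1 / sqrt ?M) \<cdot>\<^sub>m signed_mat m B A \<sigma>)" if ?r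
          using RIP_of_sparse_unit_ball[OF cs _ that] M by (simp add: real_sqrt_divide)
        then show ?thesis unfolding SUP_rip_dev[OF cs] by blast
      qed
      note eq = this
      show ?thesis
      proof (rule Set.set_eqI)
        fix \<omega> :: "complex mat \<times> (nat \<times> nat \<Rightarrow> real)"
        obtain A \<sigma> where \<omega>: "\<omega> = (A, \<sigma>)" by (cases \<omega>)
        show "\<omega> \<in> {(A, \<sigma>) \<in> space ?N.
          (SUP x\<in>sparse_unit_ball d k. \<bar>1 / ?M * (vec_norm2 (signed_mat m B A \<sigma> *\<^sub>v x))\<^sup>2 - (vec_norm2 x)\<^sup>2\<bar>) \<le> C * \<epsilon> \<and>
          RIP (C * \<epsilon>) k (complex_of_real (1 / sqrt ?M) \<cdot>\<^sub>m signed_mat m B A \<sigma>)} \<longleftrightarrow> \<omega> \<in> W"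
          unfolding W_def \<omega> mem_Collect_eq prod.case fst_conv snd_conv using eq[of A \<sigma>] by blast
      qed
    qed
    \<comment> \<open>Integration over the slices of \<open>W\<close>: 13/16 * 15/16 = 195/256,
      which exceeds 192/256 = 3/4.\<close>
    have "ennreal (13 / 16) * ennreal (15 / 16) \<le> emeasure \<A> Gd * ennreal (15 / 16)"
      using Gdm by (intro mult_right_mono) (auto simp: A.emeasure_eq_measure)
    also have "\<dots> = (\<integral>\<^sup>+A. ennreal (15 / 16) * indicator Gd A \<partial>\<A>)"
      unfolding nn_integral_cmult_indicator[OF Gd] by (rule mult.commute)
    also have "\<dots> \<le> (\<integral>\<^sup>+A. emeasure (signs m B) (Pair A -` W) \<partial>\<A>)"
    proof (rule nn_integral_mono)
      fix A assume sp: "A \<in> space \<A>"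
      show "ennreal (15 / 16) * indicator Gd A \<le> emeasure (signs m B) (Pair A -` W)"
      proof (cases "A \<in> Gd")
        case True
        obtain S where S: "S \<subseteq> sgns m B" "15 / 16 \<le> measure (signs m B) S"
          "\<forall>\<sigma>\<in>S. \<forall>x\<in>sparse_unit_ball d k. rip_dev m d (1 / ?M) (signed_mat m B A \<sigma>) x \<le> C * \<epsilon>"
          using good[OF True] by blast
        have "S \<subseteq> Pair A -` W" using S sp by (auto simp: W_def space_pair_measure space_signs)
        then have "emeasure (signs m B) S \<le> emeasure (signs m B) (Pair A -` W)"
          using W by (intro emeasure_mono sets_Pair1) auto
        moreover have "ennreal (15 / 16) \<le> emeasure (signs m B) S" using S(2) by (simp add: S.emeasure_eq_measure)
        ultimately show ?thesis using True by simp
      qed simp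
    qed
    also have "\<dots> = emeasure ?N W" using S.emeasure_pair_measure_alt[OF W] by simp
    finally have em: "ennreal (195 / 256) \<le> emeasure ?N W" by (simp add: ennreal_mult'[symmetric])
    interpret P: pair_prob_space \<A> "signs m B" ..
    have "195 / 256 \<le> measure ?N W" using em by (simp add: P.emeasure_eq_measure)
    then show "measure (\<A> \<Otimes>\<^sub>M signs m B) {(A, \<sigma>) \<in> space (\<A> \<Otimes>\<^sub>M signs m B).
        (SUP x\<in>sparse_unit_ball d k.
          \<bar>1 / real (m * B) * (vec_norm2 (signed_mat m B A \<sigma> *\<^sub>v x))\<^sup>2 - (vec_norm2 x)\<^sup>2\<bar>)
            \<le> C * \<epsilon> \<and>
        RIP (C * \<epsilon>) k (complex_of_real (1 / sqrt (real (m * B))) \<cdot>\<^sub>m signed_mat m B A \<sigma>)} \<ge> 3 / 4"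
      unfolding W_eq by linarith
  qed
qed

end
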